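(* Let $W$ be an irreducible finite real reflection group acting on its reflection representation $V$ of dimension $n$. The Kirkman numbers are the multiplicities of the exterior powers $\wedge^kV$ in the irreducible decomposition of the parking space $\mathsf{Park}(W)$; that is, $$\mathrm{Kirk}_W(t)=\sum_{k=0}^n\langle\chi_{\wedge^kV},\chi_{\mathsf{Park}(W)}\rangle_W\cdot t^k.$$
   Context: $V\cong\mathbb{R}^n$ with $W$ acting irreducibly and orthogonally; it is complexified to $\mathbb{C}^n$ when needed. $T\subset W$ is the set of reflections; $c$ is a fixed Coxeter element, of order $h$. $\mathcal{L}$ is the set of all intersections (flats) of reflecting hyperplanes of $W$ (including $V$). For $X\in\mathcal{L}$, $W_X$ is the pointwise stabilizer of $X$. Let $\ell_T(w)$ be the least $k$ such that $w$ is a product of $k$ reflections, and write $u\le_T v$ iff $\ell_T(v)=\ell_T(u)+\ell_T(u^{-1}v)$. $NC(W)=\{w\in W:w\le_T c\}$, identified via the injection $w\mapsto V^w$ with a set of flats. Define $\mathrm{Nar}_W(t)=\sum_{X\in NC(W)}t^{\dim X}$ and $\mathrm{Kirk}_W(t)=\mathrm{Nar}_W(t+1)$; the Kirkman numbers are the coefficients of $\mathrm{Kirk}_W(t)$. $\mathsf{Park}^{NC}_W$ is the set of classes $[w,X]$ with $w\in W$, $X\in NC(W)$, where $[w,X]=[w',X']$ iff $X=X'$ and $wW_X=w'W_X$; $W$ acts by $v.[w,X]=[vw,X]$. $\mathsf{Park}^{alg}_W=\mathbb{C}[V]/(\theta_1-x_1,\dots,\theta_n-x_n)$ where $x_1,\dots,x_n$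 is a basis of $V^*$ and $\Theta=(\theta_1,\dots,\theta_n)$ is any homogeneous system of parameters of degree $h+1$ in $\mathbb{C}[V]$ such that the linear isomorphism $V^*\to\mathbb{C}\theta_1+\cdots+\mathbb{C}\theta_n$, $x_i\mapsto\theta_i$, is $W$-equivariant. $\mathsf{Park}(W)$ denotes either of the $\mathbb{C}[W]$-modules $\mathbb{C}[\mathsf{Park}^{NC}_W]$ (permutation representation) and $\mathsf{Park}^{alg}_W$, which are known to be isomorphic as $\mathbb{C}[W]$-modules. $\chi_U$ denotes the character of $U$ and $\langle\cdot,\cdot\rangle_W$ the usual inner product of class functions on $W$. *)

theory Defs
  imports
    "HOL-Analysis.Analysis"
    "HOL-Algebra.QuotRing"
    "HOL-Algebra.Generated_Groups"
    "HOL-Algebra.Multiplicative_Group"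
    "HOL-Computational_Algebra.Polynomial"
begin

section \<open>Finite real reflection groups\<close>

text \<open>Matrices are multiplied with \<open>**\<close>; the product \<open>*\<close> and the powers \<open>^\<close> on
  the type \<open>real^'n^'n\<close> are componentwise and are never used here.\<close>

definition orth_group :: "(real^'n^'n) monoid" where
  "orth_group = \<lparr>carrier = {A. orthogonal_matrix A}, mult = (**), one = mat 1\<rparr>"

lemma group_orth_group: "group orth_group"
proof (rule groupI)
  fix A :: "real^'n^'n" assume "A \<in> carrier orth_group"
  then show "\<exists>B\<in>carrier orth_group. B \<otimes>\<^bsub>orth_group\<^esub> A = \<one>\<^bsub>orth_group\<^esub>"
    by (intro bexI[of _ "transpose A"])
       (auto simp: orth_group_def orthogonal_matrix_def)
qed (auto simp: orth_group_def orthogonal_matrix_id orthogonal_matrix_mul matrix_mul_assoc)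

definition refl_mat :: "real^'n \<Rightarrow> real^'n^'n" where
  "refl_mat \<alpha> = matrix (\<lambda>v. v - (2 * (\<alpha> \<bullet> v) / (\<alpha> \<bullet> \<alpha>)) *\<^sub>R \<alpha>)"

definition reflections :: "(real^'n^'n) set \<Rightarrow> (real^'n^'n) set" where
  "reflections W = {t \<in> W. \<exists>\<alpha>. \<alpha> \<noteq> 0 \<and> t = refl_mat \<alpha>}"

text \<open>The condition \<open>W \<noteq> {mat 1}\<close> only matters in dimension one, where the
  trivial group acts irreducibly although the line is not its reflection representation
  (the trivial group has rank zero).\<close>

definition irreducible_reflection_group :: "(real^'n^'n) set \<Rightarrow> bool" where
  "irreducible_reflection_group W \<longleftrightarrow>
     subgroup W orth_group \<and> finite W \<and> W \<noteq> {mat 1} \<and>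
     generate orth_group (reflections W) = W \<and>
     (\<forall>U. subspace U \<and> (\<forall>w\<in>W. \<forall>u\<in>U. w *v u \<in> U) \<longrightarrow> U = {0} \<or> U = UNIV)"

definition roots :: "(real^'n^'n) set \<Rightarrow> (real^'n) set" where
  "roots W = {\<alpha>. norm \<alpha> = 1 \<and> refl_mat \<alpha> \<in> W}"

definition simple_system :: "(real^'n^'n) set \<Rightarrow> (real^'n) set \<Rightarrow> bool" where
  "simple_system W \<Delta> \<longleftrightarrow> \<Delta> \<subseteq> roots W \<and> independent \<Delta> \<and>
     (\<forall>\<beta>\<in>roots W. \<exists>a. \<beta> = (\<Sum>\<alpha>\<in>\<Delta>. a \<alpha> *\<^sub>R \<alpha>) \<and>
        ((\<forall>\<alpha>\<in>\<Delta>. a \<alpha> \<ge> 0) \<or> (\<forall>\<alpha>\<in>\<Delta>. a \<alpha> \<le> 0)))"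

definition mat_prod :: "(real^'n^'n) list \<Rightarrow> real^'n^'n" where
  "mat_prod ts = foldr (**) ts (mat 1)"

definition coxeter_element :: "(real^'n^'n) set \<Rightarrow> real^'n^'n \<Rightarrow> bool" where
  "coxeter_element W c \<longleftrightarrow>
     (\<exists>\<alpha>s. distinct \<alpha>s \<and> simple_system W (set \<alpha>s) \<and> c = mat_prod (map refl_mat \<alpha>s))"

definition refl_length :: "(real^'n^'n) set \<Rightarrow> real^'n^'n \<Rightarrow> nat" where
  "refl_length W w =
     (LEAST k. \<exists>ts. length ts = k \<and> set ts \<subseteq> reflections W \<and> w = mat_prod ts)"

definition abs_le :: "(real^'n^'n) set \<Rightarrow> real^'n^'n \<Rightarrow> real^'n^'n \<Rightarrow> bool" where
  "abs_le W u v \<longleftrightarrow>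
     refl_length W v = refl_length W u + refl_length W (inv\<^bsub>orth_group\<^esub> u ** v)"

definition fixed_space :: "real^'n^'n \<Rightarrow> (real^'n) set" where
  "fixed_space w = {v. w *v v = v}"

definition nc_flats :: "(real^'n^'n) set \<Rightarrow> real^'n^'n \<Rightarrow> (real^'n) set set" where
  "nc_flats W c = fixed_space ` {w \<in> W. abs_le W w c}"

definition pointwise_stabilizer ::
  "(real^'n^'n) set \<Rightarrow> (real^'n) set \<Rightarrow> (real^'n^'n) set" where
  "pointwise_stabilizer W X = {w \<in> W. \<forall>v\<in>X. w *v v = v}"

definition Nar :: "(real^'n^'n) set \<Rightarrow> real^'n^'n \<Rightarrow> complex poly" where
  "Nar W c = (\<Sum>X\<in>nc_flats W c. Polynomial.monom 1 (dim X))"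

definition Kirk :: "(real^'n^'n) set \<Rightarrow> real^'n^'n \<Rightarrow> complex poly" where
  "Kirk W c = pcompose (Nar W c) [:1, 1:]"


section \<open>Complex representations and characters\<close>

definition complex_ring :: "complex ring" where
  "complex_ring = \<lparr>carrier = UNIV, mult = (*), one = 1, zero = 0, add = (+)\<rparr>"

text \<open>The record type \<open>module\<close> of HOL-Algebra extends the record type of rings; of the
  fields of a module only \<open>carrier\<close>, \<open>zero\<close>, \<open>add\<close> and \<open>smult\<close> are relevant.\<close>

type_synonym ('g, 'b) rep = "(complex, 'b) module \<times> ('g \<Rightarrow> 'b \<Rightarrow> 'b)"

definition is_basis :: "(complex, 'b) module \<Rightarrow> 'b set \<Rightarrow> bool" where
  "is_basis M B \<longleftrightarrow> finite B \<and> B \<subseteq> carrier M \<and>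
     (\<forall>v\<in>carrier M. \<exists>!a. a \<in> B \<rightarrow>\<^sub>E UNIV \<and> v = (\<Oplus>\<^bsub>M\<^esub>b\<in>B. a b \<odot>\<^bsub>M\<^esub> b))"

definition finite_dimensional :: "(complex, 'b) module \<Rightarrow> bool" where
  "finite_dimensional M \<longleftrightarrow> (\<exists>B. is_basis M B)"

definition coords :: "(complex, 'b) module \<Rightarrow> 'b set \<Rightarrow> 'b \<Rightarrow> 'b \<Rightarrow> complex" where
  "coords M B v = (THE a. a \<in> B \<rightarrow>\<^sub>E UNIV \<and> v = (\<Oplus>\<^bsub>M\<^esub>b\<in>B. a b \<odot>\<^bsub>M\<^esub> b))"

definition lin_trace :: "(complex, 'b) module \<Rightarrow> ('b \<Rightarrow> 'b) \<Rightarrow> complex" where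
  "lin_trace M f = (let B = SOME B. is_basis M B in \<Sum>b\<in>B. coords M B (f b) b)"

definition character :: "('g, 'b) rep \<Rightarrow> 'g \<Rightarrow> complex" where
  "character R g = lin_trace (fst R) (snd R g)"

definition class_inner :: "'g set \<Rightarrow> ('g \<Rightarrow> complex) \<Rightarrow> ('g \<Rightarrow> complex) \<Rightarrow> complex" where
  "class_inner G \<phi> \<psi> = (\<Sum>g\<in>G. \<phi> g * cnj (\<psi> g)) / of_nat (card G)"

definition rep_iso :: "'g set \<Rightarrow> ('g, 'b) rep \<Rightarrow> ('g, 'd) rep \<Rightarrow> bool" where
  "rep_iso G R S \<longleftrightarrow> (\<exists>\<phi>. bij_betw \<phi> (carrier (fst R)) (carrier (fst S)) \<and>
     (\<forall>x\<in>carrier (fst R). \<forall>y\<in>carrier (fst R).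
        \<phi> (x \<oplus>\<^bsub>fst R\<^esub> y) = \<phi> x \<oplus>\<^bsub>fst S\<^esub> \<phi> y) \<and>
     (\<forall>a. \<forall>x\<in>carrier (fst R). \<phi> (a \<odot>\<^bsub>fst R\<^esub> x) = a \<odot>\<^bsub>fst S\<^esub> \<phi> x) \<and>
     (\<forall>g\<in>G. \<forall>x\<in>carrier (fst R). \<phi> (snd R g x) = snd S g (\<phi> x)))"

text \<open>The quotient of a module by a submodule: the additive group is that of the
  HOL-Algebra quotient, and \<open>a\<close> times a coset is the coset of the multiples of its
  elements.\<close>

definition quot_module ::
  "(complex, 'b) module \<Rightarrow> 'b set \<Rightarrow> (complex, 'b set) module" where
  "quot_module M N = ring.extend (M Quot N)
     (module.fields (\<lambda>a C. \<Union>x\<in>C. N +>\<^bsub>M\<^esub> (a \<odot>\<^bsub>M\<^esub> x)))"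

definition free_module :: "'a set \<Rightarrow> (complex, 'a \<Rightarrow> complex) module" where
  "free_module X =
     \<lparr>carrier = {f. finite {x. f x \<noteq> 0} \<and> (\<forall>x. f x \<noteq> 0 \<longrightarrow> x \<in> X)},
      mult = undefined, one = undefined,
      zero = (\<lambda>_. 0), add = (\<lambda>f g x. f x + g x), smult = (\<lambda>a f x. a * f x)\<rparr>"

definition delta :: "'a \<Rightarrow> 'a \<Rightarrow> complex" where
  "delta x = (\<lambda>y. if y = x then 1 else 0)"

text \<open>The linear extension \<open>\<Sum>x. f x \<cdot> x \<mapsto> \<Sum>x. f x \<cdot> g x\<close> of a map \<open>g\<close> of the
  underlying sets.\<close>

definition free_map :: "('a \<Rightarrow> 'a) \<Rightarrow> ('a \<Rightarrow> complex) \<Rightarrow> 'a \<Rightarrow> complex" where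
  "free_map g f = (\<lambda>y. \<Sum>x | f x \<noteq> 0 \<and> g x = y. f x)"

lemma cring_complex_ring: "cring complex_ring"
proof (rule cringI)
  show "abelian_group complex_ring"
  proof (rule abelian_groupI)
    fix x assume "x \<in> carrier complex_ring"
    show "\<exists>y\<in>carrier complex_ring. y \<oplus>\<^bsub>complex_ring\<^esub> x = \<zero>\<^bsub>complex_ring\<^esub>"
      by (intro bexI[of _ "- x"]) (auto simp: complex_ring_def)
  qed (auto simp: complex_ring_def)
  show "Group.comm_monoid complex_ring"
    by unfold_locales (auto simp: complex_ring_def)
qed (auto simp: complex_ring_def algebra_simps)

lemma module_free_module: "module complex_ring (free_module X)"
proof (rule moduleI)
  have fin: "finite {x. f x + g x \<noteq> 0}"
    if "finite {x. f x \<noteq> 0}" "finite {x. g x \<noteq> 0}" for f g :: "'a \<Rightarrow> complex"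
    by (rule finite_subset[OF _ finite_UnI[OF that]]) auto
  show "abelian_group (free_module X)"
  proof (rule abelian_groupI)
    fix f assume "f \<in> carrier (free_module X)"
    then show "\<exists>g\<in>carrier (free_module X).
        g \<oplus>\<^bsub>free_module X\<^esub> f = \<zero>\<^bsub>free_module X\<^esub>"
      by (intro bexI[of _ "\<lambda>x. - f x"]) (auto simp: free_module_def)
  next
    fix f g assume "f \<in> carrier (free_module X)" "g \<in> carrier (free_module X)"
    then show "f \<oplus>\<^bsub>free_module X\<^esub> g \<in> carrier (free_module X)"
      using fin[of f g] by (auto simp: free_module_def) (metis add_0)
  qed (auto simp: free_module_def algebra_simps)
  fix a f assume "f \<in> carrier (free_module X)"
  then show "a \<odot>\<^bsub>free_module X\<^esub> f \<in> carrier (free_module X)"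
    by (auto simp: free_module_def)
qed (use cring_complex_ring in \<open>auto simp: free_module_def complex_ring_def algebra_simps\<close>)


section \<open>Exterior powers of the reflection representation\<close>

definition complexify :: "real^'n^'n \<Rightarrow> complex^'n^'n" where
  "complexify w = map_matrix complex_of_real w"

text \<open>The \<open>k\<close>-th exterior power is the free vector space on the \<open>k\<close>-tuples of vectors
  modulo the relations that make \<open>(v\<^sub>1, \<dots>, v\<^sub>k) \<mapsto> v\<^sub>1 \<and> \<dots> \<and> v\<^sub>k\<close> multilinear and
  alternating.\<close>

definition ext_relators :: "nat \<Rightarrow> ((complex^'n) list \<Rightarrow> complex) set" where
  "ext_relators k =
     {(\<lambda>l. delta (xs @ [a *s u + v] @ ys) l
           - a * delta (xs @ [u] @ ys) l - delta (xs @ [v] @ ys) l)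
        | xs ys a u v. length xs + length ys + 1 = k} \<union>
     {delta (xs @ [u] @ ys @ [u] @ zs)
        | xs ys zs u. length xs + length ys + length zs + 2 = k}"

definition ext_relations :: "nat \<Rightarrow> ((complex^'n) list \<Rightarrow> complex) set" where
  "ext_relations k =
     \<Inter>{N. submodule N complex_ring (free_module {l. length l = k}) \<and> ext_relators k \<subseteq> N}"

definition ext_power :: "nat \<Rightarrow> (real^'n^'n, ((complex^'n) list \<Rightarrow> complex) set) rep" where
  "ext_power k = (quot_module (free_module {l. length l = k}) (ext_relations k),
     \<lambda>w C. free_map (map ((*v) (complexify w))) ` C)"


section \<open>The noncrossing parking space\<close>

definition park_rel ::
  "(real^'n^'n) set \<Rightarrow> real^'n^'n \<Rightarrow>
     (((real^'n^'n) \<times> (real^'n) set) \<times> ((real^'n^'n) \<times> (real^'n) set)) set" where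
  "park_rel W c =
     {((w, X), (w', X')). w \<in> W \<and> w' \<in> W \<and> X \<in> nc_flats W c \<and> X = X' \<and>
        w <#\<^bsub>orth_group\<^esub> pointwise_stabilizer W X =
        w' <#\<^bsub>orth_group\<^esub> pointwise_stabilizer W X'}"

definition nc_parking_functions ::
  "(real^'n^'n) set \<Rightarrow> real^'n^'n \<Rightarrow> ((real^'n^'n) \<times> (real^'n) set) set set" where
  "nc_parking_functions W c = (W \<times> nc_flats W c) // park_rel W c"

definition park_nc ::
  "(real^'n^'n) set \<Rightarrow> real^'n^'n \<Rightarrow>
     (real^'n^'n, ((real^'n^'n) \<times> (real^'n) set) set \<Rightarrow> complex) rep" where
  "park_nc W c = (free_module (nc_parking_functions W c),
     \<lambda>v. free_map (\<lambda>C. (\<lambda>(w, X). (v ** w, X)) ` C))"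


section \<open>The algebraic parking space\<close>

text \<open>Polynomials on the complexification of \<open>V\<close> are represented by polynomial functions;
  \<open>poly_funs M\<close> is the span of the monomials whose exponent vector lies in \<open>M\<close>.\<close>

definition poly_funs :: "('n \<Rightarrow> nat) set \<Rightarrow> (complex^'n \<Rightarrow> complex) set" where
  "poly_funs M = {\<lambda>v. \<Sum>e\<in>E. a e * (\<Prod>i\<in>UNIV. (v $ i) ^ e i) | E a. finite E \<and> E \<subseteq> M}"

definition homogeneous :: "nat \<Rightarrow> (complex^'n \<Rightarrow> complex) set" where
  "homogeneous d = poly_funs {e. sum e UNIV = d}"

definition poly_algebra :: "(complex, complex^'n \<Rightarrow> complex) module" where
  "poly_algebra =
     \<lparr>carrier = poly_funs UNIV,
      mult = (\<lambda>f g v. f v * g v), one = (\<lambda>_. 1),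
      zero = (\<lambda>_. 0), add = (\<lambda>f g v. f v + g v), smult = (\<lambda>a f v. a * f v)\<rparr>"

definition poly_act ::
  "real^'n^'n \<Rightarrow> (complex^'n \<Rightarrow> complex) \<Rightarrow> complex^'n \<Rightarrow> complex" where
  "poly_act w f = (\<lambda>v. f (complexify (inv\<^bsub>orth_group\<^esub> w) *v v))"

definition dual_basis :: "('n \<Rightarrow> complex^'n \<Rightarrow> complex) \<Rightarrow> bool" where
  "dual_basis x \<longleftrightarrow> (\<forall>i. x i \<in> homogeneous 1) \<and>
     (\<forall>f\<in>homogeneous 1. \<exists>!a. f = (\<lambda>v. \<Sum>i\<in>UNIV. a i * x i v))"

definition hsop :: "nat \<Rightarrow> ('n \<Rightarrow> complex^'n \<Rightarrow> complex) \<Rightarrow> bool" where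
  "hsop d \<theta> \<longleftrightarrow> (\<forall>i. \<theta> i \<in> homogeneous d) \<and>
     finite_dimensional (quot_module poly_algebra (Idl\<^bsub>poly_algebra\<^esub> (range \<theta>)))"

definition equivariant_params ::
  "(real^'n^'n) set \<Rightarrow> ('n \<Rightarrow> complex^'n \<Rightarrow> complex) \<Rightarrow>
     ('n \<Rightarrow> complex^'n \<Rightarrow> complex) \<Rightarrow> bool" where
  "equivariant_params W x \<theta> \<longleftrightarrow>
     (\<exists>\<phi>. bij_betw \<phi> (homogeneous 1) {\<lambda>v. \<Sum>i\<in>UNIV. a i * \<theta> i v | a. True} \<and>
        (\<forall>a. \<phi> (\<lambda>v. \<Sum>i\<in>UNIV. a i * x i v) = (\<lambda>v. \<Sum>i\<in>UNIV. a i * \<theta> i v)) \<and>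
        (\<forall>w\<in>W. \<forall>f\<in>homogeneous 1. \<phi> (poly_act w f) = poly_act w (\<phi> f)))"

definition parking_params ::
  "(real^'n^'n) set \<Rightarrow> real^'n^'n \<Rightarrow> ('n \<Rightarrow> complex^'n \<Rightarrow> complex) \<Rightarrow>
     ('n \<Rightarrow> complex^'n \<Rightarrow> complex) \<Rightarrow> bool" where
  "parking_params W c x \<theta> \<longleftrightarrow>
     dual_basis x \<and> hsop (group.ord orth_group c + 1) \<theta> \<and> equivariant_params W x \<theta>"

text \<open>The existence of an isomorphism \<open>rep_iso W (park_alg x \<theta>) (park_nc W c)\<close> is what allows
  both representations to be denoted by \<open>Park(W)\<close>; it is a separate theorem, which is not
  part of these definitions.\<close>

definition park_alg ::
  "('n \<Rightarrow> complex^'n \<Rightarrow> complex) \<Rightarrow> ('n \<Rightarrow> complex^'n \<Rightarrow> complex) \<Rightarrow>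
     (real^'n^'n, (complex^'n \<Rightarrow> complex) set) rep" where
  "park_alg x \<theta> =
     (quot_module poly_algebra (Idl\<^bsub>poly_algebra\<^esub> (range (\<lambda>i v. \<theta> i v - x i v))),
      \<lambda>w C. poly_act w ` C)"

end

theory Submission
  imports Defs
begin

text \<open>As a permutation module the parking space is the sum of the modules
  \<open>\<complex>[W/W\<^sub>X]\<close>, so everything reduces to computing the average of \<open>det (1 + t w)\<close>, the
  generating function of the characters of the exterior powers, over a stabilizer \<open>W\<^sub>X\<close>.
  The function \<open>M \<mapsto> \<Sum>w. det (1 + t w M)\<close> on matrices does not change when a rank one
  matrix with column space spanned by a root of \<open>W\<^sub>X\<close> is added to \<open>M\<close>.  Noncrossing flats
  are cut out by the roots of their stabilizers, so \<open>M = 1\<close> may be replaced by the orthogonal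
  projection onto \<open>X\<close>, where every summand is \<open>(1 + t)\<^bsup>dim X\<^esup>\<close>.\<close>


section \<open>Determinants and reflections\<close>

text \<open>The shift in \<open>Kirk\<close> has a concrete source: for the orthogonal projection P
  onto X, the matrix 1 + t P has eigenvalue 1 + t on X and 1 on the complement, so each flat
  contributes its monomial in \<open>Nar\<close> evaluated at 1 + t. In terms of representations,
  the W_X-invariants in the exterior powers of V are exactly the exterior powers of X. Much of the
  remaining work lies in the traces. \<open>lin_trace\<close> refers to a basis picked by SOME and
  to coordinates picked by THE, so a character can be evaluated only after a basis has been
  exhibited and the trace shown to be independent of it. The exterior power is a quotient of an
  infinite-dimensional free module: minors supply dual functionals, which give independence, and
  multilinearity gives spanning. The algebraic parking space has no visible basis; its traces are
  carried over from the permutation module along the isomorphism, once the defining ideal is known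
  to be stable under W. Determinants are taken over the reals, and the identity of complex
  polynomials is recovered from its values at real t.\<close>

lemma det_rows_add_expand:
  fixes u v z :: "'n::finite \<Rightarrow> 'a::comm_ring_1^'n"
  assumes "finite K"
  shows "det (\<chi> i. if i \<in> K then u i + v i else z i) =
    (\<Sum>S\<in>Pow K. det (\<chi> i. if i \<in> S then u i else if i \<in> K then v i else z i))"
  using assms
\<comment> \<open>Splitting row k freezes it at \<open>u k\<close> or \<open>v k\<close>, which
  moves it among the untouched rows. The induction hypothesis is therefore used at two different
  \<open>z\<close>.\<close>
proof (induction K arbitrary: z)
  case empty
  then show ?case by simp
next
  case (insert k K)
  have split: "det (\<chi> i. if i \<in> insert k K then u i + v i else z i) =
      det (\<chi> i. if i \<in> K then u i + v i else (z(k := u k)) i)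
      + det (\<chi> i. if i \<in> K then u i + v i else (z(k := v k)) i)"
  proof -
    let ?c = "\<lambda>i. if i \<in> K then u i + v i else z i"
    have "(\<chi> i. if i \<in> insert k K then u i + v i else z i) = (\<chi> i. if i = k then u i + v i else ?c i)"
      by (auto simp: vec_eq_iff)
    moreover have "(\<chi> i. if i = k then u i else ?c i) = (\<chi> i. if i \<in> K then u i + v i else (z(k := u k)) i)"
      "(\<chi> i. if i = k then v i else ?c i) = (\<chi> i. if i \<in> K then u i + v i else (z(k := v k)) i)"
      using insert.hyps by (auto simp: vec_eq_iff)
    ultimately show ?thesis by (simp only: det_row_add)
  qed
  have disj: "Pow K \<inter> insert k ` Pow K = {}" and inj: "inj_on (insert k) (Pow K)"
    using insert.hyps by (auto simp: inj_on_def)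
  have 1: "(\<chi> i. if i \<in> S then u i else if i \<in> K then v i else (z(k := v k)) i)
      = (\<chi> i. if i \<in> S then u i else if i \<in> insert k K then v i else z i)" if "S \<in> Pow K" for S
    using that insert.hyps by (auto simp: vec_eq_iff)
  have 2: "(\<chi> i. if i \<in> S then u i else if i \<in> K then v i else (z(k := u k)) i)
      = (\<chi> i. if i \<in> insert k S then u i else if i \<in> insert k K then v i else z i)" if "S \<in> Pow K" for S
    using that insert.hyps by (auto simp: vec_eq_iff)
  show ?case
    unfolding split insert.IH Pow_insert
    by (subst sum.union_disjoint[OF _ _ disj])
       (use insert.hyps in \<open>simp_all add: sum.reindex[OF inj] 1 2 add.commute\<close>)
qed

text \<open>The rank one matrix u v^T, which sends x to (v . x) u. It is written row by row because
  the determinant lemmas expand along rows.\<close>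

definition outer :: "real^'n \<Rightarrow> real^'n \<Rightarrow> real^'n^'n" where
  "outer u v = (\<chi> i. (u $ i) *\<^sub>R v)"

lemma matrix_add_rdistrib:
  fixes A B :: "real^'n^'m"
  shows "(A + B) ** C = A ** C + B ** C"
  by (simp add: vec_eq_iff matrix_matrix_mult_def sum.distrib distrib_right)

lemma outer_nth [simp]: "outer u v $ i $ j = u $ i * v $ j"
  by (simp add: outer_def)

lemma outer_arith:
  "outer (u + u') v = outer u v + outer u' v" "outer (c *\<^sub>R u) v = outer u (c *\<^sub>R v)"
  "outer 0 v = 0" "outer u 0 = 0"
  by (simp_all add: vec_eq_iff algebra_simps)

lemma matrix_mul_outer: "A ** outer u v = outer (A *v u) v"
  by (simp add: vec_eq_iff matrix_matrix_mult_def matrix_vector_mult_def sum_distrib_right mult.assoc)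

text \<open>All rows of \<open>outer u v\<close> are multiples of v. In the multilinear expansion, a
  term taking two or more rows from it has proportional rows and vanishes, so only the subsets of
  size at most one remain. No inverse of A enters, so singular A are covered.\<close>

lemma det_add_outer:
  fixes A :: "real^'n^'n"
  shows "det (A + outer u v) = det A + (\<Sum>k\<in>UNIV. det (\<chi> i. if i = k then u $ k *\<^sub>R v else A $ i))"
proof -
  let ?d = "\<lambda>S. det (\<chi> i. if i \<in> S then u $ i *\<^sub>R v else A $ i)"
  have "A + outer u v = (\<chi> i. if i \<in> UNIV then u $ i *\<^sub>R v + A $ i else 0)"
    by (simp add: vec_eq_iff)
  then have "det (A + outer u v) = (\<Sum>S\<in>UNIV. ?d S)"
    using det_rows_add_expand[OF finite_class.finite_UNIV, of "\<lambda>i. u $ i *\<^sub>R v" "\<lambda>i. A $ i"] by (simp cong: if_cong)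
  also have "\<dots> = (\<Sum>S\<in>insert {} (range (\<lambda>k. {k})). ?d S)"
  proof (rule sum.mono_neutral_right)
    show "\<forall>S\<in>UNIV - insert {} (range (\<lambda>k. {k})). ?d S = 0"
    proof
      fix S :: "'n set" assume S: "S \<in> UNIV - insert {} (range (\<lambda>k. {k}))"
      then obtain a where a: "a \<in> S" by auto
      with S obtain b where b: "b \<in> S" "a \<noteq> b" by auto
      have "(\<chi> i. if i \<in> S then u $ i *\<^sub>R v else A $ i)
          = (\<chi> i. (if i \<in> S then u $ i else 1) *s (if i \<in> S then v else A $ i))"
        by (auto simp: vec_eq_iff)
      moreover have "det (\<chi> i. if i \<in> S then v else A $ i) = 0"
        by (rule det_identical_rows[OF b(2)]) (use a b in \<open>simp add: row_def\<close>)
      ultimately show "?d S = 0"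
        by (simp add: det_rows_mul)
    qed
  qed auto
  also have "\<dots> = det A + (\<Sum>k\<in>UNIV. ?d {k})"
    by (subst sum.insert) (auto simp: sum.reindex inj_on_def)
  also have "(\<Sum>k\<in>UNIV. ?d {k}) = (\<Sum>k\<in>UNIV. det (\<chi> i. if i = k then u $ k *\<^sub>R v else A $ i))"
    by (intro sum.cong arg_cong[where f = det]) (auto simp: vec_eq_iff)
  finally show ?thesis .
qed

text \<open>By \<open>det_add_outer\<close> the determinant is a constant plus a linear function of
  the second factor; adding \<open>det A\<close> on the left balances the constant counted twice on
  the right.\<close>

lemma det_add_outer_affine:
  "det (A + outer u (x + y)) + det A = det (A + outer u x) + det (A + outer u y)"
proof -
  have "det (\<chi> i. if i = k then u $ k *\<^sub>R (x + y) else A $ i) =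
      det (\<chi> i. if i = k then u $ k *\<^sub>R x else A $ i) + det (\<chi> i. if i = k then u $ k *\<^sub>R y else A $ i)" for k
    unfolding scaleR_add_right by (rule det_row_add)
  then show ?thesis
    unfolding det_add_outer by (simp add: sum.distrib)
qed

section \<open>Reflections as rank one perturbations of the identity\<close>

lemma refl_mat_apply: "refl_mat \<alpha> *v x = x - (2 * (\<alpha> \<bullet> x) / (\<alpha> \<bullet> \<alpha>)) *\<^sub>R \<alpha>"
proof -
  have "linear (\<lambda>v. v - (2 * (\<alpha> \<bullet> v) / (\<alpha> \<bullet> \<alpha>)) *\<^sub>R \<alpha>)"
    by (rule linearI) (auto simp: algebra_simps add_divide_distrib)
  then show ?thesis
    by (simp add: refl_mat_def linear_matrix_vector_mul_eq matrix_works)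
qed

lemma refl_mat_involution:
  assumes "\<alpha> \<noteq> 0" shows "refl_mat \<alpha> ** refl_mat \<alpha> = mat 1"
proof -
  have "refl_mat \<alpha> *v (refl_mat \<alpha> *v x) = x" for x
    using assms by (simp add: refl_mat_apply inner_diff_right)
  then show ?thesis
    by (simp add: matrix_eq matrix_vector_mul_assoc[symmetric])
qed

lemma refl_mat_fixes_iff:
  assumes "\<alpha> \<noteq> 0" shows "refl_mat \<alpha> *v x = x \<longleftrightarrow> \<alpha> \<bullet> x = 0"
  using assms by (simp add: refl_mat_apply)

lemma refl_mat_mult:
  "refl_mat \<alpha> ** M = M - outer \<alpha> ((2 / (\<alpha> \<bullet> \<alpha>)) *\<^sub>R (transpose M *v \<alpha>))"
proof -
  have "outer \<alpha> v *v x = (v \<bullet> x) *\<^sub>R \<alpha>" for v x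
    by (simp add: vec_eq_iff matrix_vector_mult_def inner_vec_def sum_distrib_left sum_distrib_right mult_ac)
  then have "(refl_mat \<alpha> ** M) *v x = (M - outer \<alpha> ((2 / (\<alpha> \<bullet> \<alpha>)) *\<^sub>R (transpose M *v \<alpha>))) *v x" for x
    by (simp add: matrix_vector_mul_assoc[symmetric] refl_mat_apply matrix_vector_mult_diff_rdistrib dot_lmul_matrix)
  then show ?thesis by (simp add: matrix_eq)
qed

text \<open>The average is an affine function of a rank one perturbation in the direction
  \<open>\<alpha>\<close>; being invariant under the reflection in \<open>\<alpha>\<close>, an odd symmetry of the perturbation,
  it is constant.\<close>

lemma sum_det_add_outer_root:
  assumes refl: "\<alpha> \<noteq> 0" and closed: "\<And>w. w \<in> G \<Longrightarrow> w ** refl_mat \<alpha> \<in> G"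
  shows "(\<Sum>w\<in>G. det (mat 1 + t *\<^sub>R (w ** (M + outer \<alpha> v)))) = (\<Sum>w\<in>G. det (mat 1 + t *\<^sub>R (w ** M)))"
proof -
  define F where "F = (\<lambda>M. \<Sum>w\<in>G. det (mat 1 + t *\<^sub>R (w ** M)))"
  let ?s = "refl_mat \<alpha>"
  have F_refl: "F (?s ** M) = F M" for M
    unfolding F_def
  proof (rule sum.reindex_bij_witness[of _ "\<lambda>w. w ** ?s" "\<lambda>w. w ** ?s"])
  qed (use closed refl_mat_involution[OF refl] in \<open>simp_all add: matrix_mul_assoc[symmetric]\<close>)
  \<comment> \<open>The vector \<open>a\<close> is determined by s M = M +
    \<open>outer \<alpha> a\<close>. Since s negates \<alpha>, left multiplication by s acts on the
    second factor as the point reflection v to a - v.\<close>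
  define a where "a = - (2 / (\<alpha> \<bullet> \<alpha>)) *\<^sub>R (transpose M *v \<alpha>)"
  have "?s *v \<alpha> = - \<alpha>"
    using refl by (simp add: refl_mat_apply scaleR_2)
  then have s: "?s ** (M + outer \<alpha> v) = M + outer \<alpha> (a - v)" for v
    unfolding matrix_add_ldistrib matrix_mul_outer refl_mat_mult a_def
    by (simp add: vec_eq_iff algebra_simps)
  have affine: "F (M + outer \<alpha> (x + y)) + F M = F (M + outer \<alpha> x) + F (M + outer \<alpha> y)" for x y
  proof -
    have "mat 1 + t *\<^sub>R (w ** (M + outer \<alpha> v)) = (mat 1 + t *\<^sub>R (w ** M)) + outer (t *\<^sub>R (w *v \<alpha>)) v" for w v
      by (simp add: matrix_add_ldistrib matrix_mul_outer vec_eq_iff algebra_simps)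
    then show ?thesis
      unfolding F_def by (simp only: sum.distrib[symmetric] det_add_outer_affine)
  qed
  have sym: "F (M + outer \<alpha> (a - v)) = F (M + outer \<alpha> v)" for v
    using F_refl[of "M + outer \<alpha> v"] by (simp add: s)
  have "F (M + outer \<alpha> a) = F M"
    using sym[of 0] by (simp add: outer_arith)
  \<comment> \<open>Affinity at v and a - v gives F(a) + F(0) = F(v) + F(a - v), abbreviating by the
    second factor. The symmetry turns the left side into 2 F(0) and the right side into 2
    F(v).\<close>
  then have "F (M + outer \<alpha> v) = F M"
    using affine[of v "a - v"] sym[of v] by simp
  then show ?thesis by (simp add: F_def)
qed

text \<open>A scalar in front of a root moves into the second factor, and the summands of a linear
  combination can be added one root at a time. Each such step alters the matrix, hence the induction
  is over all M and v at once.\<close>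

lemma sum_det_add_outer_span:
  assumes closed: "\<And>w s. w \<in> G \<Longrightarrow> s \<in> G \<Longrightarrow> w ** s \<in> G"
    and u: "u \<in> span {\<alpha>. \<alpha> \<noteq> 0 \<and> refl_mat \<alpha> \<in> G}"
  shows "(\<Sum>w\<in>G. det (mat 1 + t *\<^sub>R (w ** (M + outer u v)))) = (\<Sum>w\<in>G. det (mat 1 + t *\<^sub>R (w ** M)))"
proof -
  define F where "F = (\<lambda>M. \<Sum>w\<in>G. det (mat 1 + t *\<^sub>R (w ** M)))"
  have "\<forall>M v. F (M + outer u v) = F M"
    using u
  proof (induction rule: span_induct_alt)
    case base
    show ?case by (simp add: outer_arith)
  next
    case (step c x y)
    have "F (M + outer (c *\<^sub>R x + y) v) = F ((M + outer y v) + outer x (c *\<^sub>R v))" for M v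
      by (simp add: outer_arith algebra_simps)
    also have "\<dots> M v = F (M + outer y v)" for M v
      using step.hyps sum_det_add_outer_root[of x G t] closed by (simp add: F_def)
    finally show ?case
      using step.IH by simp
  qed
  then show ?thesis by (simp add: F_def)
qed

text \<open>The basis is indexed by \<open>'n\<close> itself so that it can form the rows of an
  orthogonal matrix; J marks the rows lying in X.\<close>

lemma orthonormal_basis_adapted:
  fixes X :: "(real^'n) set"
  assumes X: "subspace X"
  obtains f :: "'n \<Rightarrow> real^'n" and J where "\<And>i j. f i \<bullet> f j = (if i = j then 1 else 0)"
    "card J = dim X" "\<And>i. i \<in> J \<Longrightarrow> f i \<in> X" "\<And>i x. i \<notin> J \<Longrightarrow> x \<in> X \<Longrightarrow> f i \<bullet> x = 0"
proof -
  obtain S where S: "S \<subseteq> X" "pairwise orthogonal S" "\<And>x. x \<in> S \<Longrightarrow> norm x = 1"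
    "independent S" "card S = dim X" "span S = X"
    using orthonormal_basis_subspace[OF X] by metis
  obtain U where U: "U \<inter> insert 0 S = {}" "pairwise orthogonal (S \<union> U)" "span (S \<union> U) = span (S \<union> UNIV)"
    using orthogonal_extension_strong[OF S(2)] by metis
  \<comment> \<open>The extending vectors U are orthogonal and nonzero but not of length
    one.\<close>
  define N where "N = (\<lambda>x::real^'n. x /\<^sub>R norm x)"
  define B where "B = S \<union> U"
  have B0: "0 \<notin> B" using U(1) S(3)[of 0] by (auto simp: B_def)
  have ind: "independent B"
    using U(2) B0 pairwise_orthogonal_independent by (auto simp: B_def)
  have "card B = CARD('n)"
    using ind U(3) dim_eq_card[of B UNIV] by (simp add: B_def)
  moreover have "finite B" using ind independent_imp_finite by blast
  ultimately obtain g where g: "bij_betw g (UNIV::'n set) B"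
    by (metis finite_class.finite_UNIV bij_betw_iff_card)
  have gB: "g i \<in> B" for i using g by (auto simp: bij_betw_def)
  have ginj: "g i = g j \<longleftrightarrow> i = j" for i j using g by (auto simp: bij_betw_def inj_on_def)
  have orth: "x \<bullet> y = 0" if "x \<in> B" "y \<in> B" "x \<noteq> y" for x y
    using U(2) that by (auto simp: pairwise_def orthogonal_def B_def)
  show ?thesis
  proof (rule that[of "\<lambda>i. N (g i)" "{i. g i \<in> S}"])
    show "N (g i) \<bullet> N (g j) = (if i = j then 1 else 0)" for i j
    proof (cases "i = j")
      case True
      have "g j \<noteq> 0" using B0 gB[of j] by metis
      then have "norm (N (g j)) = 1" by (simp add: N_def)
      then show ?thesis using True by (simp add: norm_eq_1)
    next
      case False
      then show ?thesis using orth[OF gB gB, of i j] ginj[of i j] by (simp add: N_def)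
    qed
    have "g ` {i. g i \<in> S} = S"
      using g by (auto simp: bij_betw_def B_def)
    then show "card {i. g i \<in> S} = dim X"
      using S(5) ginj by (metis (no_types, lifting) card_image inj_onI)
    show "N (g i) \<in> X" if "i \<in> {i. g i \<in> S}" for i
      using that S(1) X by (auto simp: N_def subspace_scale)
    show "N (g i) \<bullet> x = 0" if "i \<notin> {i. g i \<in> S}" "x \<in> X" for i x
    proof -
      have "orthogonal (g i) x"
      proof (rule orthogonal_to_span[of x S])
        show "x \<in> span S" using that S(6) by simp
        show "orthogonal (g i) y" if "y \<in> S" for y
          using orth[OF gB, of y i] that \<open>i \<notin> {i. g i \<in> S}\<close> by (auto simp: orthogonal_def B_def)
      qed
      then show ?thesis by (simp add: N_def orthogonal_def)
    qed
  qed
qed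

text \<open>The hypotheses on X work in opposite directions. By \<open>flat\<close> the roots of G
  span the complement of X, so the identity matrix may be replaced by the projection onto X; by
  \<open>fixX\<close> every element of G then disappears from its summand.\<close>

lemma sum_det_reflection_group:
  fixes G :: "(real^'n^'n) set"
  assumes closed: "\<And>w s. w \<in> G \<Longrightarrow> s \<in> G \<Longrightarrow> w ** s \<in> G"
    and X: "subspace X" and fixX: "\<And>w x. w \<in> G \<Longrightarrow> x \<in> X \<Longrightarrow> w *v x = x"
    and flat: "\<And>x. (\<And>\<alpha>. \<alpha> \<noteq> 0 \<Longrightarrow> refl_mat \<alpha> \<in> G \<Longrightarrow> \<alpha> \<bullet> x = 0) \<Longrightarrow> x \<in> X"
  shows "(\<Sum>w\<in>G. det (mat 1 + t *\<^sub>R w)) = of_nat (card G) * (1 + t) ^ dim X"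
proof -
  let ?R = "{\<alpha>. \<alpha> \<noteq> 0 \<and> refl_mat \<alpha> \<in> G}"
  define F where "F = (\<lambda>M. \<Sum>w\<in>G. det (mat 1 + t *\<^sub>R (w ** M)))"
  obtain f :: "'n \<Rightarrow> real^'n" and J where f: "\<And>i j. f i \<bullet> f j = (if i = j then 1 else 0)"
    and J: "card J = dim X" "\<And>i. i \<in> J \<Longrightarrow> f i \<in> X" "\<And>i x. i \<notin> J \<Longrightarrow> x \<in> X \<Longrightarrow> f i \<bullet> x = 0"
    using orthonormal_basis_adapted[OF X] by metis
  \<comment> \<open>Hypothesis \<open>flat\<close> says that the complement of the roots lies in X.
    Taking complements once more puts the complement of X inside the span of the roots.\<close>
  have perp: "x \<in> span ?R" if "\<And>y. y \<in> X \<Longrightarrow> x \<bullet> y = 0" for x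
  proof -
    have "(span ?R)\<^sup>\<bottom> \<subseteq> X"
      using flat by (auto simp: orthogonal_comp_def orthogonal_def span_base)
    then have "x \<in> (span ?R)\<^sup>\<bottom>\<^sup>\<bottom>"
      using that by (auto simp: orthogonal_comp_def orthogonal_def inner_commute)
    then show ?thesis by (simp add: orthogonal_comp_self)
  qed
  define Q where "Q = (\<chi> i. f i)"
  have "orthogonal_matrix Q"
    by (simp add: orthogonal_matrix_orthonormal_rows Q_def row_def f norm_eq_sqrt_inner orthogonal_def)
  then have QQ: "transpose Q ** Q = mat 1" "Q ** transpose Q = mat 1"
    by (auto simp: orthogonal_matrix_def)
  define P where "P = (\<lambda>K. \<Sum>i\<in>K. outer (f i) (f i))"
  \<comment> \<open>P K is the projection onto the span of the f i with i in K. This diagonal form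
    yields both P UNIV = 1 and the determinant of 1 + t P J.\<close>
  have P_diag: "P K = transpose Q ** (\<chi> i j. if i = j \<and> i \<in> K then 1 else 0) ** Q" for K
  proof -
    have "(\<chi> i j. if i = j \<and> i \<in> K then 1 else 0) ** Q = (\<chi> i. if i \<in> K then f i else 0)"
    proof -
      have "(\<Sum>k\<in>UNIV. (if i = k \<and> i \<in> K then 1 else 0) * f k $ j) = (if i \<in> K then f i else 0) $ j" for i j
        by (cases "i \<in> K") (simp_all add: if_distrib[of "\<lambda>x. x * _"] cong: if_cong)
      then show ?thesis by (simp add: vec_eq_iff matrix_matrix_mult_def Q_def)
    qed
    then show ?thesis
      by (simp add: P_def Q_def vec_eq_iff matrix_mul_assoc[symmetric])
         (simp add: matrix_matrix_mult_def transpose_def if_distrib[of "\<lambda>x. x $ _"]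
            if_distrib[of "\<lambda>x. _ * x"] sum.If_cases)
  qed
  have "(\<chi> i j. if i = j \<and> i \<in> UNIV then 1 else 0) = (mat 1 :: real^'n^'n)"
    by (simp add: mat_def)
  then have P_UNIV: "P UNIV = mat 1"
    unfolding P_diag by (simp add: QQ)
  \<comment> \<open>Each direction f k outside J is removed from the identity by adding the rank one
    matrix \<open>outer (f k) (- f k)\<close>, whose column space lies in the span of the
    roots.\<close>
  have "F (mat 1 - P K) = F (mat 1)" if "K \<inter> J = {}" for K
  proof -
    have "finite K" by simp
    then show ?thesis using that
    proof induction
      case empty
      then show ?case by (simp add: P_def)
    next
      case (insert k K)
      have "f k \<in> span ?R" using insert J(3) perp by auto
      moreover have "mat 1 - P (insert k K) = (mat 1 - P K) + outer (f k) (- f k)"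
        using insert.hyps by (simp add: P_def vec_eq_iff)
      ultimately have "F (mat 1 - P (insert k K)) = F (mat 1 - P K)"
        using sum_det_add_outer_span[OF closed, of "f k" t "mat 1 - P K" "- f k"] by (simp only: F_def)
      then show ?case using insert by simp
    qed
  qed
  from this[of "- J"] have F1: "F (mat 1 - P (- J)) = F (mat 1)" by simp
  have "P UNIV = P J + P (- J)"
    unfolding P_def by (subst sum.union_disjoint[symmetric]) (auto intro: arg_cong2[where f = sum])
  then have PJ: "mat 1 - P (- J) = P J" using P_UNIV by (simp add: algebra_simps)
  have wP: "w ** P J = P J" if "w \<in> G" for w
  proof -
    have "w ** P K = P K" if "K \<subseteq> J" for K
    proof -
      have "finite K" by simp
      then show ?thesis using that
      proof induction
        case empty then show ?case by (simp add: P_def)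
      next
        case (insert k K)
        then show ?case using fixX[OF \<open>w \<in> G\<close>] J(2)
          by (simp add: P_def matrix_add_ldistrib matrix_mul_outer)
      qed
    qed
    then show ?thesis by simp
  qed
  let ?D = "(\<chi> i j. if i = j then 1 + (if i \<in> J then t else 0) else 0) :: real^'n^'n"
  have "mat 1 + t *\<^sub>R P J = transpose Q ** ?D ** Q"
  proof -
    have "?D = mat 1 + t *\<^sub>R (\<chi> i j. if i = j \<and> i \<in> J then 1 else 0)"
      by (simp add: mat_def vec_eq_iff)
    then show ?thesis
      by (simp add: P_diag matrix_add_ldistrib matrix_add_rdistrib QQ matrix_scalar_ac scalar_matrix_assoc[symmetric])
  qed
  then have "det (mat 1 + t *\<^sub>R P J) = det (transpose Q) * det ?D * det Q"
    by (simp add: det_mul)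
  also have "\<dots> = det ?D * det (transpose Q ** Q)"
    by (simp add: det_mul)
  also have "\<dots> = (\<Prod>i\<in>UNIV. 1 + (if i \<in> J then t else 0))"
    by (simp add: QQ det_diagonal)
  also have "\<dots> = (\<Prod>i\<in>J. 1 + t)"
    by (rule prod.mono_neutral_cong_right) auto
  finally have det: "det (mat 1 + t *\<^sub>R P J) = (1 + t) ^ dim X"
    by (simp add: J(1))
  have "F (mat 1) = F (P J)" using F1 PJ by simp
  also have "\<dots> = of_nat (card G) * (1 + t) ^ dim X"
    by (simp add: F_def wP det)
  finally show ?thesis by (simp add: F_def)
qed

text \<open>The inner sum is the sum of the principal k by k minors of A, padded with unit rows to
  full size. Columns of A are placed as rows because column i is the image of the i-th axis vector;
  this is the form in which the trace on the k-th exterior power appears.\<close>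

lemma det_mat_1_add_scaleR:
  fixes A :: "real^'n^'n"
  shows "det (mat 1 + t *\<^sub>R A) =
    (\<Sum>k = 0..CARD('n). t ^ k * (\<Sum>S | card S = k. det (\<chi> i. if i \<in> S then column i A else axis i 1)))"
proof -
  let ?m = "\<lambda>S. det (\<chi> i. if i \<in> S then column i A else axis i 1)"
  have "transpose (mat 1 + t *\<^sub>R A) = (\<chi> i. t *\<^sub>R column i A + axis i 1)"
    by (auto simp: vec_eq_iff transpose_def mat_def column_def axis_def)
  then have "det (mat 1 + t *\<^sub>R A) = det (\<chi> i. t *\<^sub>R column i A + axis i 1)"
    by (metis det_transpose)
  also have "\<dots> = (\<Sum>S\<in>UNIV. det (\<chi> i. if i \<in> S then t *\<^sub>R column i A else axis i 1))"
    using det_rows_add_expand[OF finite_class.finite_UNIV, of "\<lambda>i. t *\<^sub>R column i A" "\<lambda>i. axis i 1"]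
    by (simp cong: if_cong)
  also have "\<dots> = (\<Sum>S\<in>UNIV. t ^ card S * ?m S)"
  proof (rule sum.cong)
    fix S :: "'n set"
    have "(\<chi> i. if i \<in> S then t *\<^sub>R column i A else axis i 1) =
        (\<chi> i. (if i \<in> S then t else 1) *s (if i \<in> S then column i A else axis i 1))"
      by (auto simp: vec_eq_iff)
    then show "det (\<chi> i. if i \<in> S then t *\<^sub>R column i A else axis i 1) = t ^ card S * ?m S"
      by (simp add: det_rows_mul prod.If_cases)
  qed simp
  also have "\<dots> = (\<Sum>k = 0..CARD('n). \<Sum>S\<in>{S\<in>UNIV. card S = k}. t ^ card S * ?m S)"
    by (rule sum.group[symmetric]) (auto simp: card_mono)
  also have "\<dots> = (\<Sum>k = 0..CARD('n). t ^ k * (\<Sum>S | card S = k. ?m S))"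
    by (intro sum.cong) (auto simp: sum_distrib_left)
  finally show ?thesis .
qed


section \<open>Noncrossing flats\<close>

lemma mat_prod_simps [simp]:
  "mat_prod [] = mat 1" "mat_prod (t # ts) = t ** mat_prod ts"
  by (simp_all add: mat_prod_def)

lemma mat_prod_append: "mat_prod (ts @ us) = mat_prod ts ** mat_prod us"
  by (induction ts) (simp_all add: matrix_mul_assoc)

lemma orth_group_simps [simp]:
  "carrier orth_group = {A. orthogonal_matrix A}" "x \<otimes>\<^bsub>orth_group\<^esub> y = x ** y" "\<one>\<^bsub>orth_group\<^esub> = mat 1"
  by (simp_all add: orth_group_def)

lemma inv_orth_group: "orthogonal_matrix A \<Longrightarrow> inv\<^bsub>orth_group\<^esub> A = transpose A"
  by (rule group.inv_equality[OF group_orth_group])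
     (simp_all add: orthogonal_matrix_def orthogonal_matrix_transpose)

context
  fixes W :: "(real^'n^'n) set"
  assumes W: "subgroup W orth_group"
begin

lemma orth_subgroup_orthogonal: "w \<in> W \<Longrightarrow> orthogonal_matrix w"
  using subgroup.subset[OF W] by auto

lemma orth_subgroup_one: "mat 1 \<in> W"
  using subgroup.one_closed[OF W] by simp

lemma orth_subgroup_mult: "u \<in> W \<Longrightarrow> v \<in> W \<Longrightarrow> u ** v \<in> W"
  using subgroup.m_closed[OF W] by simp

lemma orth_subgroup_transpose: "u \<in> W \<Longrightarrow> transpose u \<in> W"
  using subgroup.m_inv_closed[OF W] inv_orth_group[OF orth_subgroup_orthogonal] by metis

lemma orth_subgroup_cancel:
  assumes "u \<in> W" shows "transpose u ** u = mat 1" "u ** transpose u = mat 1"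
    "transpose u ** (u ** x) = x" "u ** (transpose u ** x) = x"
    "x ** transpose u ** u = x" "x ** u ** transpose u = x"
    "transpose u *v (u *v y) = y" "u *v (transpose u *v y) = y"
proof -
  show 1: "transpose u ** u = mat 1" "u ** transpose u = mat 1"
    using orth_subgroup_orthogonal[OF assms] by (auto simp: orthogonal_matrix_def)
  show "transpose u ** (u ** x) = x" "u ** (transpose u ** x) = x"
    by (simp_all add: matrix_mul_assoc 1)
  show "x ** transpose u ** u = x" "x ** u ** transpose u = x"
    by (simp_all add: matrix_mul_assoc[symmetric] 1)
  show "transpose u *v (u *v y) = y" "u *v (transpose u *v y) = y"
    unfolding matrix_vector_mul_assoc 1 by simp_all
qed

end

text \<open>Write the product as s_a P. If it fixes v, then P v = s_a v = v - k a. But v - P v lies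
  in the span of the other roots, so independence forces k = 0. Hence a is orthogonal to v, P fixes
  v as well, and the argument repeats.\<close>

lemma fixed_space_mat_prod_independent:
  assumes "distinct bs" "independent (set bs)" "mat_prod (map refl_mat bs) *v v = v" "b \<in> set bs"
  shows "b \<bullet> v = 0"
  using assms
proof (induction bs arbitrary: b)
  case (Cons a bs)
  let ?P = "mat_prod (map refl_mat bs)"
  have diff: "x - mat_prod (map refl_mat cs) *v x \<in> span (set cs)" for x :: "real^'n" and cs
  proof (induction cs)
    case (Cons c cs)
    let ?y = "mat_prod (map refl_mat cs) *v x"
    have "x - mat_prod (map refl_mat (c # cs)) *v x = (x - ?y) + (2 * (c \<bullet> ?y) / (c \<bullet> c)) *\<^sub>R c"
      by (simp add: matrix_vector_mul_assoc[symmetric] refl_mat_apply)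
    moreover have "x - ?y \<in> span (set (c # cs))"
      using Cons.IH span_mono[of "set cs" "set (c # cs)"] by auto
    ultimately show ?case
      by (metis span_add span_scale span_base list.set_intros(1))
  qed (simp add: span_zero)
  have a: "a \<noteq> 0" "a \<notin> span (set bs)" "independent (set bs)"
    using Cons.prems by (auto simp: independent_insert dependent_zero span_zero split: if_splits)
  have "refl_mat a *v (?P *v v) = v"
    using Cons.prems by (simp add: matrix_vector_mul_assoc)
  then have Pv: "refl_mat a *v v = ?P *v v"
    using refl_mat_involution[OF a(1)] by (metis matrix_vector_mul_assoc matrix_vector_mul_lid)
  moreover define k where "k = 2 * (a \<bullet> v) / (a \<bullet> a)"
  ultimately have "k *\<^sub>R a \<in> span (set bs)"
    using diff[of v bs] by (metis add_diff_cancel_left' diff_add_cancel refl_mat_apply)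
  then have "k = 0"
    using a(2) span_scale[of "k *\<^sub>R a" "set bs" "inverse k"] by (cases "k = 0") auto
  then have av: "a \<bullet> v = 0" using a(1) by (simp add: k_def)
  then have "?P *v v = v"
    using \<open>refl_mat a *v (?P *v v) = v\<close> refl_mat_fixes_iff[OF a(1)] refl_mat_involution[OF a(1)]
    by (metis matrix_vector_mul_assoc matrix_vector_mul_lid)
  then show ?case
    using Cons a av by auto
qed simp

lemma mat_prod_fixes:
  "(\<And>t. t \<in> set ts \<Longrightarrow> t *v v = v) \<Longrightarrow> mat_prod ts *v v = v"
  by (induction ts) (simp_all add: matrix_vector_mul_assoc[symmetric])

section \<open>Factorizations into reflections\<close>

lemma generate_reflections_mat_prod:
  assumes W: "subgroup W orth_group" and w: "w \<in> generate orth_group (reflections W)"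
  shows "\<exists>ts. set ts \<subseteq> reflections W \<and> w = mat_prod ts"
  using w
proof induction
  case one
  then show ?case by (intro exI[of _ "[]"]) simp
next
  case (incl h)
  then show ?case by (intro exI[of _ "[h]"]) simp
next
  case (inv h)
  then obtain a where "a \<noteq> 0" "h = refl_mat a" by (auto simp: reflections_def)
  then have hh: "h ** h = mat 1" by (simp add: refl_mat_involution)
  moreover have "orthogonal_matrix h"
    using inv orth_subgroup_orthogonal[OF W] by (auto simp: reflections_def)
  ultimately have "inv\<^bsub>orth_group\<^esub> h = h"
    by (intro group.inv_equality[OF group_orth_group]) simp_all
  then show ?case using inv by (intro exI[of _ "[h]"]) simp
next
  case (eng h1 h2)
  then show ?case by (metis mat_prod_append set_append le_sup_iff orth_group_simps(2))
qed

lemma refl_mat_scaleR: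
  assumes "k \<noteq> 0" shows "refl_mat (k *\<^sub>R a) = refl_mat a"
  using assms by (simp add: matrix_eq refl_mat_apply)

lemma refl_length_le:
  assumes "set ts \<subseteq> reflections W" "w = mat_prod ts"
  shows "refl_length W w \<le> length ts"
  unfolding refl_length_def using assms by (intro Least_le) blast

lemma reflectionsE_list:
  assumes "set ts \<subseteq> reflections W"
  obtains bs where "ts = map refl_mat bs" "\<And>b. b \<in> set bs \<Longrightarrow> b \<noteq> 0 \<and> refl_mat b \<in> W"
  using assms
proof (induction ts arbitrary: thesis)
  case Nil
  then show ?case by (metis list.simps(8) empty_iff list.set(1))
next
  case (Cons t ts)
  obtain bs where bs: "ts = map refl_mat bs" "\<And>b. b \<in> set bs \<Longrightarrow> b \<noteq> 0 \<and> refl_mat b \<in> W"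
    using Cons.IH Cons.prems(2) by auto
  obtain a where "a \<noteq> 0" "t = refl_mat a" "t \<in> W"
    using Cons.prems(2) by (auto simp: reflections_def)
  with bs show ?case by (intro Cons.prems(1)[of "a # bs"]) auto
qed

context
  fixes W :: "(real^'n^'n) set"
  assumes irred: "irreducible_reflection_group W"
begin

lemma irred_subgroup: "subgroup W orth_group" and irred_finite: "finite W"
  using irred by (auto simp: irreducible_reflection_group_def)

text \<open>Generation by reflections provides at least one expression, so the \<open>LEAST\<close>
  in \<open>refl_length\<close> is attained.\<close>

lemma reflection_expression:
  assumes "w \<in> W"
  obtains ts where "set ts \<subseteq> reflections W" "w = mat_prod ts" "length ts = refl_length W w"
proof -
  have "w \<in> generate orth_group (reflections W)"
    using irred assms by (simp add: irreducible_reflection_group_def)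
  then have "\<exists>k ts. length ts = k \<and> set ts \<subseteq> reflections W \<and> w = mat_prod ts"
    using generate_reflections_mat_prod[OF irred_subgroup] by blast
  then have "\<exists>ts. length ts = refl_length W w \<and> set ts \<subseteq> reflections W \<and> w = mat_prod ts"
    unfolding refl_length_def by (rule LeastI_ex)
  then show ?thesis using that by blast
qed

text \<open>The vectors fixed by all of W form an invariant subspace. It cannot be the whole space,
  since W would then be the trivial group.\<close>

lemma reflections_common_fixed:
  assumes "\<And>t. t \<in> reflections W \<Longrightarrow> t *v v = v"
  shows "v = 0"
proof -
  let ?U = "{v. \<forall>w\<in>W. w *v v = v}"
  have "w *v v = v" if "w \<in> W" for w
  proof -
    obtain ts where "set ts \<subseteq> reflections W" "w = mat_prod ts"
      using reflection_expression[OF \<open>w \<in> W\<close>] by metis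
    then show ?thesis using assms mat_prod_fixes by blast
  qed
  then have v: "v \<in> ?U" by simp
  have "subspace ?U"
    by (auto simp: subspace_def matrix_vector_right_distrib matrix_vector_mult_scaleR)
  then have "?U = {0} \<or> ?U = UNIV"
    using irred by (simp add: irreducible_reflection_group_def)
  moreover have "?U \<noteq> UNIV"
  proof
    assume "?U = UNIV"
    then have "w = mat 1" if "w \<in> W" for w
      using that by (auto simp: matrix_eq)
    then have "W = {mat 1}"
      using orth_subgroup_one[OF irred_subgroup] by blast
    then show False using irred by (simp add: irreducible_reflection_group_def)
  qed
  ultimately show ?thesis using v by blast
qed

lemma simple_system_common_orthogonal:
  assumes "simple_system W D" "\<And>b. b \<in> D \<Longrightarrow> b \<bullet> v = 0"
  shows "v = 0"
proof (rule reflections_common_fixed)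
  fix t assume "t \<in> reflections W"
  then obtain a where a: "a \<noteq> 0" "t = refl_mat a" "t \<in> W" by (auto simp: reflections_def)
  \<comment> \<open>\<open>roots\<close> contains only unit vectors, while a reflection is given by
    any nonzero vector on its line.\<close>
  define b where "b = (1 / norm a) *\<^sub>R a"
  have t: "t = refl_mat b" using a by (simp add: b_def refl_mat_scaleR)
  with a have "b \<in> roots W" by (simp add: roots_def b_def)
  then obtain f where "b = (\<Sum>\<alpha>\<in>D. f \<alpha> *\<^sub>R \<alpha>)"
    using assms(1) by (auto simp: simple_system_def)
  then have "b \<bullet> v = 0"
    using assms(2) by (simp add: inner_sum_left)
  then show "t *v v = v" by (simp add: t refl_mat_apply)
qed

lemma coxeter_element_in: "coxeter_element W c \<Longrightarrow> c \<in> W"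
proof -
  assume "coxeter_element W c"
  then obtain as where as: "set as \<subseteq> roots W" "c = mat_prod (map refl_mat as)"
    by (auto simp: coxeter_element_def simple_system_def)
  have "mat_prod ts \<in> W" if "set ts \<subseteq> W" for ts
    using that orth_subgroup_one[OF irred_subgroup] orth_subgroup_mult[OF irred_subgroup]
    by (induction ts) auto
  from this[of "map refl_mat as"] show "c \<in> W"
    using as by (auto simp: roots_def)
qed

text \<open>Carter's lemma for the elements below \<open>c\<close>: concatenating minimal expressions of
  \<open>w\<close> and \<open>w\<^sup>-\<^sup>1c\<close> writes \<open>c\<close>, which fixes only the origin, with at most \<open>n\<close>
  reflections, so the roots that occur are linearly independent.\<close>

lemma nc_flat_roots:
  assumes c: "coxeter_element W c" and X: "X \<in> nc_flats W c"
  obtains B where "X = {v. \<forall>b\<in>B. b \<bullet> v = 0}" "\<forall>b\<in>B. b \<noteq> 0 \<and> refl_mat b \<in> W"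
proof -
  obtain w where w: "w \<in> W" "abs_le W w c" "X = fixed_space w"
    using X by (auto simp: nc_flats_def)
  note inv = inv_orth_group[OF orth_subgroup_orthogonal[OF irred_subgroup w(1)]]
  have w': "transpose w ** c \<in> W"
    using orth_subgroup_mult[OF irred_subgroup orth_subgroup_transpose[OF irred_subgroup w(1)] coxeter_element_in[OF c]] .
  obtain ts where ts: "set ts \<subseteq> reflections W" "w = mat_prod ts" "length ts = refl_length W w"
    using reflection_expression[OF w(1)] .
  obtain us where us: "set us \<subseteq> reflections W" "transpose w ** c = mat_prod us"
      "length us = refl_length W (transpose w ** c)"
    using reflection_expression[OF w'] .
  obtain bs where bs: "ts = map refl_mat bs" "\<And>b. b \<in> set bs \<Longrightarrow> b \<noteq> 0 \<and> refl_mat b \<in> W"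
    using reflectionsE_list[OF ts(1)] by metis
  obtain ds where ds: "us = map refl_mat ds" "\<And>b. b \<in> set ds \<Longrightarrow> b \<noteq> 0 \<and> refl_mat b \<in> W"
    using reflectionsE_list[OF us(1)] by metis
  obtain as where as: "distinct as" "simple_system W (set as)" "c = mat_prod (map refl_mat as)"
    using c by (auto simp: coxeter_element_def)
  have ind: "independent (set as)" using as(2) by (simp add: simple_system_def)
  have c0: "v = 0" if "c *v v = v" for v
    using simple_system_common_orthogonal[OF as(2)] fixed_space_mat_prod_independent[OF as(1) ind] that as(3)
    by blast
  have c_prod: "c = mat_prod (map refl_mat (bs @ ds))"
    using orth_subgroup_cancel(4)[OF irred_subgroup w(1), of c] ts(2) us(2)
    by (simp add: mat_prod_append bs(1) ds(1))
  have "set (map refl_mat as) \<subseteq> reflections W"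
  proof
    fix t assume "t \<in> set (map refl_mat as)"
    then obtain a where "a \<in> roots W" "t = refl_mat a"
      using as(2) by (auto simp: simple_system_def)
    moreover then have "a \<noteq> 0" by (auto simp: roots_def)
    ultimately show "t \<in> reflections W" by (auto simp: roots_def reflections_def)
  qed
  \<comment> \<open>This bounds the number of reflections in the concatenated expression by n from
    above; spanning gives the opposite bound below.\<close>
  then have "refl_length W c \<le> length as"
    using refl_length_le[of "map refl_mat as"] as(3) by simp
  also have "\<dots> \<le> CARD('n)"
    using independent_card_le[OF ind] as(1) by (simp add: distinct_card)
  finally have len: "length (bs @ ds) \<le> CARD('n)"
    using w(2) ts(3) us(3) by (simp add: abs_le_def inv bs(1) ds(1))
  have "v = 0" if "\<And>b. b \<in> set (bs @ ds) \<Longrightarrow> b \<bullet> v = 0" for v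
  proof (rule c0)
    show "c *v v = v"
      unfolding c_prod by (rule mat_prod_fixes) (use that in \<open>auto simp: refl_mat_apply\<close>)
  qed
  then have "(span (set (bs @ ds)))\<^sup>\<bottom> = {0}"
    using subspace_0[OF subspace_orthogonal_comp]
    by (auto simp: orthogonal_comp_def orthogonal_def span_base)
  then have span: "span (set (bs @ ds)) = UNIV"
    by (metis orthogonal_comp_null orthogonal_comp_self subspace_span)
  have dim: "dim (set (bs @ ds)) = CARD('n)"
    using span by (metis dim_span dim_UNIV DIM_cart DIM_real mult_1_right)
  have "card (set (bs @ ds)) \<ge> CARD('n)"
    using dim_le_card'[of "set (bs @ ds)"] dim by simp
  with len card_length[of "bs @ ds"] have card: "card (set (bs @ ds)) = CARD('n)" "length (bs @ ds) = CARD('n)"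
    by linarith+
  then have "distinct (bs @ ds)" by (metis card_distinct)
  moreover have "independent (set (bs @ ds))"
    by (rule card_le_dim_spanning[of _ UNIV]) (use span card(1) in auto)
  ultimately have bs_ind: "distinct bs" "independent (set bs)"
    using independent_mono[of "set (bs @ ds)" "set bs"] by auto
  show ?thesis
  proof (rule that[of "set bs"])
    show "X = {v. \<forall>b\<in>set bs. b \<bullet> v = 0}"
    proof -
      have "w *v v = v \<longleftrightarrow> (\<forall>b\<in>set bs. b \<bullet> v = 0)" for v
      proof
        assume "w *v v = v"
        then show "\<forall>b\<in>set bs. b \<bullet> v = 0"
          using fixed_space_mat_prod_independent[OF bs_ind, of v] ts(2) bs(1) by auto
      next
        assume "\<forall>b\<in>set bs. b \<bullet> v = 0"
        then show "w *v v = v"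
          unfolding ts(2) bs(1) by (intro mat_prod_fixes) (auto simp: refl_mat_apply)
      qed
      then show ?thesis by (simp add: w(3) fixed_space_def)
    qed
  qed (use bs(2) in auto)
qed

text \<open>The roots that cut out X are orthogonal to X, so their reflections fix X pointwise and
  belong to the stabilizer. This supplies the hypothesis \<open>flat\<close> of
  \<open>sum_det_reflection_group\<close>.\<close>

lemma sum_det_pointwise_stabilizer:
  assumes c: "coxeter_element W c" and X: "X \<in> nc_flats W c"
  shows "(\<Sum>w\<in>pointwise_stabilizer W X. det (mat 1 + t *\<^sub>R w)) =
    of_nat (card (pointwise_stabilizer W X)) * (1 + t) ^ dim X"
proof -
  obtain B where B: "X = {v. \<forall>b\<in>B. b \<bullet> v = 0}" "\<forall>b\<in>B. b \<noteq> 0 \<and> refl_mat b \<in> W"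
    by (rule nc_flat_roots[OF c X])
  show ?thesis
  proof (rule sum_det_reflection_group)
    show "w ** s \<in> pointwise_stabilizer W X"
      if "w \<in> pointwise_stabilizer W X" "s \<in> pointwise_stabilizer W X" for w s
      using that orth_subgroup_mult[OF irred_subgroup]
      by (auto simp: pointwise_stabilizer_def matrix_vector_mul_assoc[symmetric])
    show "subspace X"
      by (auto simp: B(1) subspace_def inner_add_right)
    show "x \<in> X" if "\<And>\<alpha>. \<alpha> \<noteq> 0 \<Longrightarrow> refl_mat \<alpha> \<in> pointwise_stabilizer W X \<Longrightarrow> \<alpha> \<bullet> x = 0" for x
      using that B by (auto simp: pointwise_stabilizer_def refl_mat_apply)
  qed (auto simp: pointwise_stabilizer_def)
qed

end


section \<open>Traces on complex modules\<close>

lemma complex_ring_simps [simp]: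
  "carrier complex_ring = UNIV" "x \<oplus>\<^bsub>complex_ring\<^esub> y = x + y" "x \<otimes>\<^bsub>complex_ring\<^esub> y = x * y"
  "\<one>\<^bsub>complex_ring\<^esub> = 1" "\<zero>\<^bsub>complex_ring\<^esub> = 0"
  by (simp_all add: complex_ring_def)

section \<open>Linear functionals, bases and coordinates\<close>

definition functional :: "(complex, 'b) module \<Rightarrow> ('b \<Rightarrow> complex) \<Rightarrow> bool" where
  "functional M D \<longleftrightarrow> (\<forall>x\<in>carrier M. \<forall>y\<in>carrier M. D (x \<oplus>\<^bsub>M\<^esub> y) = D x + D y) \<and>
     (\<forall>a. \<forall>x\<in>carrier M. D (a \<odot>\<^bsub>M\<^esub> x) = a * D x)"

definition module_map :: "(complex, 'b) module \<Rightarrow> (complex, 'd) module \<Rightarrow> ('b \<Rightarrow> 'd) \<Rightarrow> bool" where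
  "module_map M N f \<longleftrightarrow> f \<in> carrier M \<rightarrow> carrier N \<and>
     (\<forall>x\<in>carrier M. \<forall>y\<in>carrier M. f (x \<oplus>\<^bsub>M\<^esub> y) = f x \<oplus>\<^bsub>N\<^esub> f y) \<and>
     (\<forall>a. \<forall>x\<in>carrier M. f (a \<odot>\<^bsub>M\<^esub> x) = a \<odot>\<^bsub>N\<^esub> f x)"

locale complex_module = module complex_ring M for M :: "(complex, 'b) module" (structure)
begin

lemma zero_smult: "0 \<odot> \<zero> = \<zero>"
  using smult_l_null[of \<zero>] by simp

lemma functional_finsum:
  assumes D: "functional M D" and "finite A" "g \<in> A \<rightarrow> carrier M"
  shows "D (\<Oplus>a\<in>A. g a) = (\<Sum>a\<in>A. D (g a))"
  using assms(2,3)
proof induction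
  case empty
  have "D (0 \<odot> \<zero>) = 0 * D \<zero>"
    using D unfolding functional_def by blast
  then show ?case by (simp add: zero_smult)
next
  case (insert x A)
  then show ?case using D by (simp add: functional_def Pi_iff)
qed

lemma functional_comb:
  assumes "functional M D" "finite A" "g \<in> A \<rightarrow> carrier M"
  shows "D (\<Oplus>a\<in>A. c a \<odot> g a) = (\<Sum>a\<in>A. c a * D (g a))"
  using assms by (subst functional_finsum) (auto simp: functional_def Pi_iff intro!: sum.cong)

lemma module_map_comb:
  assumes N: "module complex_ring N" and f: "module_map M N f" and "finite A" "g \<in> A \<rightarrow> carrier M"
  shows "f (\<Oplus>a\<in>A. c a \<odot> g a) = (\<Oplus>\<^bsub>N\<^esub>a\<in>A. c a \<odot>\<^bsub>N\<^esub> f (g a))"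
  using assms(3,4)
proof induction
  case empty
  interpret N: complex_module N using N by (simp add: complex_module_def)
  have "f (0 \<odot> \<zero>) = 0 \<odot>\<^bsub>N\<^esub> f \<zero>"
    using f unfolding module_map_def by blast
  moreover have "f \<zero> \<in> carrier N" using f by (auto simp: module_map_def)
  ultimately show ?case using N.smult_l_null[of "f \<zero>"] by (simp add: zero_smult)
next
  case (insert x A)
  interpret N: complex_module N using N by (simp add: complex_module_def)
  have "f (g a) \<in> carrier N" if "a \<in> insert x A" for a using f insert that by (auto simp: module_map_def Pi_iff)
  then show ?case using insert f by (simp add: module_map_def Pi_iff)
qed

context
  fixes B assumes B: "is_basis M B"
begin

lemma basis_finite: "finite B" and basis_subset: "B \<subseteq> carrier M"
  using B by (auto simp: is_basis_def)

lemma coords_props: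
  assumes "v \<in> carrier M"
  shows "coords M B v \<in> extensional B" "v = (\<Oplus>b\<in>B. coords M B v b \<odot> b)"
proof -
  have "\<exists>!a. a \<in> B \<rightarrow>\<^sub>E UNIV \<and> v = (\<Oplus>b\<in>B. a b \<odot> b)"
    using B assms unfolding is_basis_def by blast
  from theI'[OF this] show "coords M B v \<in> extensional B" "v = (\<Oplus>b\<in>B. coords M B v b \<odot> b)"
    by (auto simp: coords_def PiE_def)
qed

lemma coords_eqI:
  assumes "v \<in> carrier M" "v = (\<Oplus>b\<in>B. a b \<odot> b)" "b \<in> B"
  shows "coords M B v b = a b"
proof -
  have ex1: "\<exists>!a. a \<in> B \<rightarrow>\<^sub>E UNIV \<and> v = (\<Oplus>b\<in>B. a b \<odot> b)"
    using B assms unfolding is_basis_def by blast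
  have "v = (\<Oplus>b\<in>B. restrict a B b \<odot> b)"
    unfolding assms(2) using basis_subset by (intro finsum_cong') auto
  then have "coords M B v = restrict a B"
    unfolding coords_def by (intro the1_equality[OF ex1]) auto
  then show ?thesis using assms(3) by simp
qed

lemma functional_coords:
  assumes b: "b \<in> B" shows "functional M (\<lambda>v. coords M B v b)"
  unfolding functional_def
proof (intro conjI ballI allI)
  fix x y assume xy: "x \<in> carrier M" "y \<in> carrier M"
  have "x \<oplus> y = (\<Oplus>b\<in>B. coords M B x b \<odot> b) \<oplus> (\<Oplus>b\<in>B. coords M B y b \<odot> b)"
    using coords_props(2) xy by metis
  also have "\<dots> = (\<Oplus>b\<in>B. (coords M B x b \<odot> b) \<oplus> (coords M B y b \<odot> b))"
    using basis_subset by (intro finsum_addf[symmetric]) auto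
  also have "\<dots> = (\<Oplus>b\<in>B. (coords M B x b + coords M B y b) \<odot> b)"
    using basis_subset smult_l_distr by (intro finsum_cong') auto
  finally have eq: "x \<oplus> y = (\<Oplus>b\<in>B. (coords M B x b + coords M B y b) \<odot> b)" .
  show "coords M B (x \<oplus> y) b = coords M B x b + coords M B y b"
    by (rule coords_eqI[OF _ eq b]) (use xy in simp)
next
  fix a x assume x: "x \<in> carrier M"
  have "a \<odot> x = a \<odot> (\<Oplus>b\<in>B. coords M B x b \<odot> b)"
    using coords_props(2) x by metis
  also have "\<dots> = (\<Oplus>b\<in>B. a \<odot> (coords M B x b \<odot> b))"
    using basis_subset basis_finite by (intro finsum_smult_ldistr) auto
  also have "\<dots> = (\<Oplus>b\<in>B. (a * coords M B x b) \<odot> b)"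
    using basis_subset smult_assoc1 by (intro finsum_cong') auto
  finally have eq: "a \<odot> x = (\<Oplus>b\<in>B. (a * coords M B x b) \<odot> b)" .
  show "coords M B (a \<odot> x) b = a * coords M B x b"
    by (rule coords_eqI[OF _ eq b]) (use x in simp)
qed

end

text \<open>This is tr(PQ) = tr(QP) in coordinates: expand b in the basis C, swap the two sums, and
  read the result as the expansion of f c in B followed by coordinates in C.\<close>

lemma trace_basis_independent:
  assumes B: "is_basis M B" and C: "is_basis M C" and f: "module_map M M f"
  shows "(\<Sum>b\<in>B. coords M B (f b) b) = (\<Sum>c\<in>C. coords M C (f c) c)"
proof -
  note subs = basis_subset[OF B] basis_subset[OF C]
  have fc: "f x \<in> carrier M" if "x \<in> carrier M" for x
    using f that by (auto simp: module_map_def)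
  have M: "module complex_ring M" by unfold_locales
  have "coords M B (f b) b = (\<Sum>c\<in>C. coords M C b c * coords M B (f c) b)" if b: "b \<in> B" for b
  proof -
    have "f b = f (\<Oplus>c\<in>C. coords M C b c \<odot> c)"
      using coords_props(2)[OF C] b subs by (metis subsetD)
    also have "\<dots> = (\<Oplus>c\<in>C. coords M C b c \<odot> f c)"
      using module_map_comb[OF M f basis_finite[OF C], of "\<lambda>c. c"] subs by auto
    finally show ?thesis
      using functional_comb[OF functional_coords[OF B b] basis_finite[OF C]] fc subs
      by (simp add: Pi_iff subset_iff)
  qed
  then have "(\<Sum>b\<in>B. coords M B (f b) b) = (\<Sum>b\<in>B. \<Sum>c\<in>C. coords M C b c * coords M B (f c) b)"
    by simp
  also have "\<dots> = (\<Sum>c\<in>C. \<Sum>b\<in>B. coords M B (f c) b * coords M C b c)"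
    by (subst sum.swap) (simp add: mult.commute)
  also have "\<dots> = (\<Sum>c\<in>C. coords M C (f c) c)"
  proof (rule sum.cong[OF refl])
    fix c assume c: "c \<in> C"
    have "f c = (\<Oplus>b\<in>B. coords M B (f c) b \<odot> b)"
      using coords_props(2)[OF B] c subs fc by (metis subsetD)
    then have "coords M C (f c) c = coords M C (\<Oplus>b\<in>B. coords M B (f c) b \<odot> b) c" by simp
    also have "\<dots> = (\<Sum>b\<in>B. coords M B (f c) b * coords M C b c)"
      using functional_comb[OF functional_coords[OF C c] basis_finite[OF B], of "\<lambda>b. b"] subs by auto
    finally show "(\<Sum>b\<in>B. coords M B (f c) b * coords M C b c) = coords M C (f c) c" by simp
  qed
  finally show ?thesis .
qed

lemma lin_trace_eq:
  assumes B: "is_basis M B" and f: "module_map M M f"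
  shows "lin_trace M f = (\<Sum>b\<in>B. coords M B (f b) b)"
proof -
  have "is_basis M (SOME B. is_basis M B)" using B by (rule someI)
  from trace_basis_independent[OF this B f] show ?thesis by (simp add: lin_trace_def)
qed

text \<open>Applying \<open>D b\<close> to a linear combination returns its coefficient at b, which
  gives uniqueness. The criterion makes the coordinates explicit and is the way every basis below is
  obtained.\<close>

lemma dual_functionals_basis:
  assumes fin: "finite B" "B \<subseteq> carrier M" and D: "\<And>b. b \<in> B \<Longrightarrow> functional M (D b)"
    and dual: "\<And>b b'. b \<in> B \<Longrightarrow> b' \<in> B \<Longrightarrow> D b b' = (if b = b' then 1 else 0)"
    and span: "\<And>v. v \<in> carrier M \<Longrightarrow> v = (\<Oplus>b\<in>B. D b v \<odot> b)"
  shows "is_basis M B" "v \<in> carrier M \<Longrightarrow> b \<in> B \<Longrightarrow> coords M B v b = D b v"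
proof -
  have uniq: "a b = D b (\<Oplus>b\<in>B. a b \<odot> b)" if "b \<in> B" for a b
  proof -
    have "D b (\<Oplus>b\<in>B. a b \<odot> b) = (\<Sum>b'\<in>B. a b' * D b b')"
      using functional_comb[OF D[OF that] fin(1), of "\<lambda>b. b"] fin by auto
    also have "\<dots> = (\<Sum>b'\<in>B. if b = b' then a b' else 0)"
      by (intro sum.cong) (auto simp: dual that)
    finally show ?thesis using that fin by simp
  qed
  show basis: "is_basis M B"
    unfolding is_basis_def
  proof (intro conjI ballI fin)
    fix v assume v: "v \<in> carrier M"
    show "\<exists>!a. a \<in> B \<rightarrow>\<^sub>E UNIV \<and> v = (\<Oplus>b\<in>B. a b \<odot> b)"
    \<comment> \<open>Coefficient functions in \<open>is_basis\<close> are \<open>undefined\<close>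
      outside B, so the functionals have to be restricted.\<close>
    proof (rule ex1I[of _ "restrict (\<lambda>b. D b v) B"])
      have "v = (\<Oplus>b\<in>B. restrict (\<lambda>b. D b v) B b \<odot> b)"
        by (subst span[OF v]) (use fin in \<open>auto intro!: finsum_cong'\<close>)
      then show "restrict (\<lambda>b. D b v) B \<in> B \<rightarrow>\<^sub>E UNIV \<and> v = (\<Oplus>b\<in>B. restrict (\<lambda>b. D b v) B b \<odot> b)"
        by auto
    next
      fix a assume "a \<in> B \<rightarrow>\<^sub>E UNIV \<and> v = (\<Oplus>b\<in>B. a b \<odot> b)"
      then show "a = restrict (\<lambda>b. D b v) B"
        using uniq by (auto simp: PiE_def extensional_def fun_eq_iff)
    qed
  qed
  show "coords M B v b = D b v" if "v \<in> carrier M" "b \<in> B"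
    by (rule coords_eqI[OF basis that(1) span[OF that(1)] that(2)])
qed

text \<open>Meant for a module N known only through an isomorphism from M: the image of a basis of
  M, with the coordinates of M pulled back as dual functionals, is a basis of N.\<close>

lemma lin_trace_transport:
  assumes N: "module complex_ring N" and bij: "bij_betw \<psi> (carrier M) (carrier N)" and \<psi>: "module_map M N \<psi>"
    and B: "is_basis M B" and f: "module_map M M f" and g: "module_map N N g"
    and comm: "\<And>x. x \<in> carrier M \<Longrightarrow> \<psi> (f x) = g (\<psi> x)"
  shows "lin_trace N g = lin_trace M f"
proof -
  interpret N: complex_module N using N by (simp add: complex_module_def)
  have M: "module complex_ring M" by unfold_locales
  define \<phi> where "\<phi> = inv_into (carrier M) \<psi>"
  have \<phi>\<psi>: "\<phi> (\<psi> x) = x" if "x \<in> carrier M" for x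
    using bij that by (simp add: \<phi>_def bij_betw_def)
  have surj: "\<exists>x\<in>carrier M. y = \<psi> x" if "y \<in> carrier N" for y
    using bij that by (auto simp: bij_betw_def)
  have \<psi>c: "\<psi> x \<in> carrier N" if "x \<in> carrier M" for x
    using \<psi> that by (auto simp: module_map_def)
  note subs = basis_subset[OF B] and fin = basis_finite[OF B]
  \<comment> \<open>Functionals are indexed by the basis vectors \<open>c\<close> of N themselves,
    so the label in B is recovered as \<open>\<phi> c\<close>.\<close>
  define D where "D = (\<lambda>c w. coords M B (\<phi> w) (\<phi> c))"
  have inj: "inj_on \<psi> B" using bij subs by (auto simp: bij_betw_def intro: inj_on_subset)
  have D_fun: "functional N (D c)" if c: "c \<in> \<psi> ` B" for c
    unfolding functional_def
  proof (intro conjI ballI allI)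
    obtain b where b: "b \<in> B" "c = \<psi> b" using c by auto
    have \<phi>c: "\<phi> c \<in> B" using b \<phi>\<psi> subs by auto
    note F = functional_coords[OF B \<phi>c, unfolded functional_def]
    show "D c (x \<oplus>\<^bsub>N\<^esub> y) = D c x + D c y" if x: "x \<in> carrier N" and y: "y \<in> carrier N" for x y
    proof -
      obtain x' where x': "x' \<in> carrier M" "x = \<psi> x'" using surj[OF x] by blast
      obtain y' where y': "y' \<in> carrier M" "y = \<psi> y'" using surj[OF y] by blast
      have "x \<oplus>\<^bsub>N\<^esub> y = \<psi> (x' \<oplus> y')" using \<psi> x' y' by (simp add: module_map_def)
      then show ?thesis using F x' y' by (simp add: D_def \<phi>\<psi>)
    qed
    show "D c (a \<odot>\<^bsub>N\<^esub> x) = a * D c x" if x: "x \<in> carrier N" for a x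
    proof -
      obtain x' where x': "x' \<in> carrier M" "x = \<psi> x'" using surj[OF x] by blast
      have "a \<odot>\<^bsub>N\<^esub> x = \<psi> (a \<odot> x')" using \<psi> x' by (simp add: module_map_def)
      then show ?thesis using F x' by (simp add: D_def \<phi>\<psi>)
    qed
  qed
  have D_\<psi>: "D (\<psi> b) (\<psi> v) = coords M B v b" if "b \<in> B" "v \<in> carrier M" for b v
    using that subs by (auto simp: D_def \<phi>\<psi>)
  have delta: "coords M B b' b = (if b = b' then 1 else 0)" if "b \<in> B" "b' \<in> B" for b b'
  proof (rule coords_eqI[OF B _ _ that(1)])
    show "b' \<in> carrier M" using that subs by auto
    have "(\<Oplus>b\<in>B. (if b = b' then 1 else 0) \<odot> b) = (\<Oplus>b\<in>B. if b' = b then b else \<zero>)"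
      using subs by (intro finsum_cong') (auto simp: smult_l_null[simplified] smult_one[simplified])
    also have "\<dots> = b'"
      by (rule finsum_singleton[OF that(2) fin]) (use subs in auto)
    finally show "b' = (\<Oplus>b\<in>B. (if b = b' then 1 else 0) \<odot> b)" by simp
  qed
  have span: "w = (\<Oplus>\<^bsub>N\<^esub>c\<in>\<psi> ` B. D c w \<odot>\<^bsub>N\<^esub> c)" if w: "w \<in> carrier N" for w
  proof -
    obtain v where v: "v \<in> carrier M" "w = \<psi> v" using surj[OF w] by blast
    have "(\<Oplus>\<^bsub>N\<^esub>c\<in>\<psi> ` B. D c w \<odot>\<^bsub>N\<^esub> c) = (\<Oplus>\<^bsub>N\<^esub>b\<in>B. D (\<psi> b) w \<odot>\<^bsub>N\<^esub> \<psi> b)"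
      using inj subs \<psi>c by (intro N.finsum_reindex) auto
    also have "\<dots> = (\<Oplus>\<^bsub>N\<^esub>b\<in>B. coords M B v b \<odot>\<^bsub>N\<^esub> \<psi> b)"
      using subs \<psi>c by (intro N.finsum_cong') (auto simp: v D_\<psi>)
    also have "\<dots> = \<psi> (\<Oplus>b\<in>B. coords M B v b \<odot> b)"
      by (rule module_map_comb[OF N \<psi> fin, symmetric]) (use subs in auto)
    finally show ?thesis using coords_props(2)[OF B v(1)] v(2) by simp
  qed
  note basis = N.dual_functionals_basis[where B = "\<psi> ` B" and D = D, OF _ _ D_fun _ span]
  have prems: "finite (\<psi> ` B)" "\<psi> ` B \<subseteq> carrier N"
      "\<And>b b'. b \<in> \<psi> ` B \<Longrightarrow> b' \<in> \<psi> ` B \<Longrightarrow> D b b' = (if b = b' then 1 else 0)"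
    using fin subs \<psi>c inj by (auto simp: D_\<psi> delta subset_iff inj_on_eq_iff)
  have "lin_trace N g = (\<Sum>c\<in>\<psi> ` B. coords N (\<psi> ` B) (g c) c)"
    by (rule N.lin_trace_eq[OF basis(1) g]) (use prems in auto)
  also have "\<dots> = (\<Sum>c\<in>\<psi> ` B. D c (g c))"
    using prems g by (intro sum.cong refl basis(2)) (auto simp: module_map_def)
  also have "\<dots> = (\<Sum>b\<in>B. coords M B (f b) b)"
    using inj subs f by (simp add: sum.reindex, intro sum.cong)
      (auto simp: comm[symmetric] D_\<psi> module_map_def Pi_iff)
  also have "\<dots> = lin_trace M f" by (rule lin_trace_eq[OF B f, symmetric])
  finally show ?thesis .
qed

end


section \<open>Quotient modules and free modules\<close>

locale complex_submodule = complex_module + fixes N assumes submod: "submodule N complex_ring M"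
begin

sublocale sub: abelian_subgroup N M
proof (rule abelian_subgroupI3)
  show "additive_subgroup N M"
    using submodule.axioms(1)[OF submod] by (rule additive_subgroup.intro)
qed unfold_locales

lemma sub_smult: "x \<in> N \<Longrightarrow> a \<odot> x \<in> N"
  using submodule.smult_closed[OF submod] by simp

lemma quot_simps:
  "carrier (quot_module M N) = (\<lambda>x. N +> x) ` carrier M"
  "\<zero>\<^bsub>quot_module M N\<^esub> = N"
  by (auto simp: quot_module_def ring.defs module.defs FactRing_def A_RCOSETS_def' image_def)

lemma quot_add:
  "x \<in> carrier M \<Longrightarrow> y \<in> carrier M \<Longrightarrow> (N +> x) \<oplus>\<^bsub>quot_module M N\<^esub> (N +> y) = N +> (x \<oplus> y)"
  by (simp add: quot_module_def ring.defs module.defs FactRing_def sub.a_rcos_sum)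

lemma coset_eq_iff:
  assumes "x \<in> carrier M" "y \<in> carrier M"
  shows "N +> x = N +> y \<longleftrightarrow> x \<ominus> y \<in> N"
  using assms sub.a_rcos_module[of y x] sub.a_repr_independence'[of x y] sub.a_rcos_self[of x]
  by (metis a_minus_def)

text \<open>The scalar multiple in \<open>quot_module\<close> is a union over all representatives.
  Two representatives differ by an element of N, so all members of the union agree, and the union is
  not empty because x represents its own coset.\<close>

lemma quot_smult:
  assumes x: "x \<in> carrier M"
  shows "a \<odot>\<^bsub>quot_module M N\<^esub> (N +> x) = N +> (a \<odot> x)"
proof -
  have "N +> (a \<odot> y) = N +> (a \<odot> x)" if y: "y \<in> N +> x" for y
  proof -
    obtain n where n: "n \<in> N" "y = n \<oplus> x" using y by (auto simp: a_r_coset_def')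
    have nc: "n \<in> carrier M" using n sub.a_subset by auto
    have "a \<odot> y \<ominus> a \<odot> x = a \<odot> n"
      using nc x smult_r_distr by (simp add: n(2) a_minus_def a_assoc r_neg)
    then show ?thesis
      using n nc x sub_smult by (simp add: coset_eq_iff)
  qed
  then have "(\<Union>y\<in>N +> x. N +> (a \<odot> y)) = (\<Union>y\<in>N +> x. N +> (a \<odot> x))"
    by (rule SUP_cong[OF refl])
  moreover have "x \<in> N +> x" using x by (rule sub.a_rcos_self)
  ultimately have "(\<Union>y\<in>N +> x. N +> (a \<odot> y)) = N +> (a \<odot> x)"
    by (metis SUP_const empty_iff)
  then show ?thesis
    by (simp add: quot_module_def ring.defs module.defs)
qed

lemma module_quot_module: "module complex_ring (quot_module M N)"
proof (rule moduleI)
  let ?Q = "quot_module M N"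
  have zero: "N +> \<zero> = N" using sub.a_subset by (simp add: a_coset_add_zero)
  show "abelian_group ?Q"
  proof (rule abelian_groupI)
    fix C assume "C \<in> carrier ?Q"
    then obtain x where x: "x \<in> carrier M" "C = N +> x" by (auto simp: quot_simps)
    then show "\<exists>D\<in>carrier ?Q. D \<oplus>\<^bsub>?Q\<^esub> C = \<zero>\<^bsub>?Q\<^esub>"
      by (intro bexI[of _ "N +> (\<ominus> x)"]) (auto simp: quot_simps quot_add l_neg zero)
    show "\<zero>\<^bsub>?Q\<^esub> \<oplus>\<^bsub>?Q\<^esub> C = C"
      using x quot_add[of \<zero> x] by (simp add: quot_simps zero)
  next
    show "\<zero>\<^bsub>?Q\<^esub> \<in> carrier ?Q"
      unfolding quot_simps using zero by (metis zero_closed imageI)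
  qed (auto simp: quot_simps(1) quot_add a_assoc a_comm a_lcomm)
  show "cring complex_ring" by (rule cring_complex_ring)
qed (use smult_l_distr smult_r_distr smult_assoc1 smult_one in \<open>auto simp: quot_simps(1) quot_add quot_smult\<close>)

lemma module_map_proj: "module_map M (quot_module M N) (\<lambda>x. N +> x)"
  by (auto simp: module_map_def quot_simps quot_add quot_smult)

lemma coset_image:
  assumes f: "module_map M M f" and sur: "f ` N = N" and x: "x \<in> carrier M"
  shows "f ` (N +> x) = N +> f x"
proof -
  have "f (n \<oplus> x) = f n \<oplus> f x" if "n \<in> N" for n
    using f x that sub.a_subset by (auto simp: module_map_def)
  then have "f ` (N +> x) = (\<lambda>n. n \<oplus> f x) ` (f ` N)"
    by (auto simp: a_r_coset_def' image_iff)
  then show ?thesis unfolding sur by (auto simp: a_r_coset_def')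
qed

lemma module_map_image:
  assumes f: "module_map M M f" and sur: "f ` N = N"
  shows "module_map (quot_module M N) (quot_module M N) (\<lambda>C. f ` C)"
proof -
  note im = coset_image[OF f sur]
  have fc: "f x \<in> carrier M" if "x \<in> carrier M" for x
    using f that by (auto simp: module_map_def)
  have add: "f (x \<oplus> y) = f x \<oplus> f y" if "x \<in> carrier M" "y \<in> carrier M" for x y
    using f that by (auto simp: module_map_def)
  have smult: "f (a \<odot> x) = a \<odot> f x" if "x \<in> carrier M" for a x
    using f that by (auto simp: module_map_def)
  show ?thesis
    unfolding module_map_def
  proof (intro conjI ballI allI)
    show "(\<lambda>C. f ` C) \<in> carrier (quot_module M N) \<rightarrow> carrier (quot_module M N)"
    proof
      fix C assume "C \<in> carrier (quot_module M N)"
      then obtain x where "x \<in> carrier M" "C = N +> x" unfolding quot_simps by blast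
      then show "f ` C \<in> carrier (quot_module M N)"
        unfolding quot_simps by (simp add: im fc)
    qed
  next
    fix C D assume "C \<in> carrier (quot_module M N)" "D \<in> carrier (quot_module M N)"
    then obtain x y where "x \<in> carrier M" "C = N +> x" "y \<in> carrier M" "D = N +> y"
      unfolding quot_simps by blast
    then show "f ` (C \<oplus>\<^bsub>quot_module M N\<^esub> D) = f ` C \<oplus>\<^bsub>quot_module M N\<^esub> f ` D"
      by (simp add: quot_add im fc add)
  next
    fix a C assume "C \<in> carrier (quot_module M N)"
    then obtain x where "x \<in> carrier M" "C = N +> x" unfolding quot_simps by blast
    then show "f ` (a \<odot>\<^bsub>quot_module M N\<^esub> C) = a \<odot>\<^bsub>quot_module M N\<^esub> f ` C"
      by (simp add: quot_smult im fc smult)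
  qed
qed

end

text \<open>The family must be nonempty: the empty intersection is \<open>UNIV\<close>, which may
  exceed the carrier.\<close>

lemma submodule_Inter:
  fixes M :: "(complex, 'b) module"
  assumes "module complex_ring M" "\<And>N. N \<in> \<N> \<Longrightarrow> submodule N complex_ring M" "\<N> \<noteq> {}"
  shows "submodule (\<Inter>\<N>) complex_ring M"
proof -
  interpret complex_module M using assms by (simp add: complex_module_def)
  note E = submoduleE[OF assms(2)]
  show ?thesis
  proof (rule submoduleI)
    show "\<zero>\<^bsub>M\<^esub> \<in> \<Inter>\<N>"
      using subgroup.one_closed[OF submodule.axioms(1)[OF assms(2)]] by auto
    show "\<Inter>\<N> \<subseteq> carrier M" using E(1) assms(3) by blast
  qed (use E in auto)
qed

section \<open>Free modules and their bases\<close>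

lemma free_module_simps [simp]:
  "x \<oplus>\<^bsub>free_module X\<^esub> y = (\<lambda>i. x i + y i)" "\<zero>\<^bsub>free_module X\<^esub> = (\<lambda>_. 0)"
  "a \<odot>\<^bsub>free_module X\<^esub> x = (\<lambda>i. a * x i)"
  by (simp_all add: free_module_def)

lemma free_module_carrier:
  "f \<in> carrier (free_module X) \<longleftrightarrow> finite {x. f x \<noteq> 0} \<and> {x. f x \<noteq> 0} \<subseteq> X"
  by (auto simp: free_module_def)

lemma delta_carrier: "x \<in> X \<Longrightarrow> delta x \<in> carrier (free_module X)"
  by (auto simp: free_module_carrier delta_def)

lemma delta_inj [simp]: "delta x = delta y \<longleftrightarrow> x = y"
  by (auto simp: delta_def fun_eq_iff split: if_splits)

lemma complex_module_free_module: "complex_module (free_module X)"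
  by (simp add: complex_module_def module_free_module)

lemma free_module_finsum:
  assumes "finite A" "g \<in> A \<rightarrow> carrier (free_module X)"
  shows "(\<Oplus>\<^bsub>free_module X\<^esub>a\<in>A. g a) = (\<lambda>y. \<Sum>a\<in>A. g a y)"
  using assms
proof induction
  case empty
  interpret complex_module "free_module X" by (rule complex_module_free_module)
  show ?case by simp
next
  case (insert x A)
  interpret complex_module "free_module X" by (rule complex_module_free_module)
  show ?case using insert by (simp add: Pi_iff)
qed

lemma free_module_expand:
  assumes "f \<in> carrier (free_module X)"
  shows "f = (\<Oplus>\<^bsub>free_module X\<^esub>x\<in>{x. f x \<noteq> 0}. f x \<odot>\<^bsub>free_module X\<^esub> delta x)"
proof -
  interpret complex_module "free_module X" by (rule complex_module_free_module)
  have fin: "finite {x. f x \<noteq> 0}" and sub: "{x. f x \<noteq> 0} \<subseteq> X"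
    using assms by (auto simp: free_module_carrier)
  have "(\<Oplus>\<^bsub>free_module X\<^esub>x\<in>{x. f x \<noteq> 0}. f x \<odot>\<^bsub>free_module X\<^esub> delta x) =
      (\<lambda>y. \<Sum>x\<in>{x. f x \<noteq> 0}. (f x \<odot>\<^bsub>free_module X\<^esub> delta x) y)"
    using sub by (intro free_module_finsum[OF fin]) (auto intro!: delta_carrier smult_closed simp del: free_module_simps)
  also have "\<dots> = f"
    using fin by (auto simp: fun_eq_iff delta_def if_distrib cong: if_cong)
  finally show ?thesis by simp
qed

text \<open>The index set in \<open>free_map\<close> depends on f. Summing over a common finite A
  makes the values at several functions comparable, which is how additivity is proved.\<close>

lemma free_map_expand:
  assumes "finite A" "{x. f x \<noteq> 0} \<subseteq> A"
  shows "free_map g f = (\<lambda>y. \<Sum>x\<in>A. f x * delta (g x) y)"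
proof
  fix y
  have "free_map g f y = (\<Sum>x\<in>A. if f x \<noteq> 0 \<and> g x = y then f x else 0)"
    unfolding free_map_def using assms by (subst sum.inter_filter[symmetric]) (auto intro!: sum.cong)
  also have "\<dots> = (\<Sum>x\<in>A. f x * delta (g x) y)"
    by (intro sum.cong) (auto simp: delta_def)
  finally show "free_map g f y = (\<Sum>x\<in>A. f x * delta (g x) y)" .
qed

lemma free_map_delta: "free_map g (delta x) = delta (g x)"
proof -
  have "free_map g (delta x) = (\<lambda>y. \<Sum>z\<in>{x}. delta x z * delta (g z) y)"
    by (rule free_map_expand) (auto simp: delta_def)
  then show ?thesis by (simp add: delta_def fun_eq_iff)
qed

lemma module_map_free_map:
  assumes "g \<in> X \<rightarrow> Y"
  shows "module_map (free_module X) (free_module Y) (free_map g)"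
  unfolding module_map_def
proof (intro conjI ballI allI)
  show "free_map g \<in> carrier (free_module X) \<rightarrow> carrier (free_module Y)"
  proof
    fix f assume f: "f \<in> carrier (free_module X)"
    have "{y. free_map g f y \<noteq> 0} \<subseteq> g ` {x. f x \<noteq> 0}"
    proof
      fix y assume "y \<in> {y. free_map g f y \<noteq> 0}"
      then obtain x where "x \<in> {x. f x \<noteq> 0 \<and> g x = y}"
        unfolding free_map_def by (metis (mono_tags, lifting) mem_Collect_eq sum.not_neutral_contains_not_neutral)
      then show "y \<in> g ` {x. f x \<noteq> 0}" by auto
    qed
    moreover have "finite (g ` {x. f x \<noteq> 0})" "g ` {x. f x \<noteq> 0} \<subseteq> Y"
      using f assms by (auto simp: free_module_carrier)
    ultimately show "free_map g f \<in> carrier (free_module Y)"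
      unfolding free_module_carrier by (meson finite_subset subset_trans)
  qed
next
  fix e f assume "e \<in> carrier (free_module X)" "f \<in> carrier (free_module X)"
  then have fin: "finite ({x. e x \<noteq> 0} \<union> {x. f x \<noteq> 0})" (is "finite ?A") by (auto simp: free_module_carrier)
  have "free_map g (\<lambda>x. e x + f x) = (\<lambda>y. \<Sum>x\<in>?A. (e x + f x) * delta (g x) y)"
    "free_map g e = (\<lambda>y. \<Sum>x\<in>?A. e x * delta (g x) y)" "free_map g f = (\<lambda>y. \<Sum>x\<in>?A. f x * delta (g x) y)"
    by (rule free_map_expand[OF fin]; auto)+
  then show "free_map g (e \<oplus>\<^bsub>free_module X\<^esub> f) = free_map g e \<oplus>\<^bsub>free_module Y\<^esub> free_map g f"
    by (simp add: sum.distrib distrib_right)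
next
  fix a f assume "f \<in> carrier (free_module X)"
  then have fin: "finite {x. f x \<noteq> 0}" (is "finite ?A") by (auto simp: free_module_carrier)
  have "free_map g (\<lambda>x. a * f x) = (\<lambda>y. \<Sum>x\<in>?A. (a * f x) * delta (g x) y)"
    "free_map g f = (\<lambda>y. \<Sum>x\<in>?A. f x * delta (g x) y)"
    by (rule free_map_expand[OF fin]; auto)+
  then show "free_map g (a \<odot>\<^bsub>free_module X\<^esub> f) = a \<odot>\<^bsub>free_module Y\<^esub> free_map g f"
    by (simp add: sum_distrib_left mult.assoc)
qed

lemma free_module_basis:
  assumes X: "finite X"
  shows "is_basis (free_module X) (delta ` X)"
    and "f \<in> carrier (free_module X) \<Longrightarrow> x \<in> X \<Longrightarrow> coords (free_module X) (delta ` X) f (delta x) = f x"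
proof -
  interpret complex_module "free_module X" by (rule complex_module_free_module)
  \<comment> \<open>The functional at the basis vector \<open>delta x\<close> is evaluation at x;
    THE recovers x by injectivity of \<open>delta\<close>.\<close>
  define D where "D = (\<lambda>b (f :: 'a \<Rightarrow> complex). f (THE x. b = delta x))"
  have D: "D (delta x) f = f x" for x f by (simp add: D_def)
  have 1: "delta ` X \<subseteq> carrier (free_module X)" by (auto intro: delta_carrier)
  have 2: "functional (free_module X) (D b)" if "b \<in> delta ` X" for b
    by (simp add: functional_def D_def)
  have 3: "D b b' = (if b = b' then 1 else 0)" if "b \<in> delta ` X" "b' \<in> delta ` X" for b b'
    using that by (auto simp: D) (auto simp: delta_def)
  have 4: "f = (\<Oplus>\<^bsub>free_module X\<^esub>b\<in>delta ` X. D b f \<odot>\<^bsub>free_module X\<^esub> b)"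
    if f: "f \<in> carrier (free_module X)" for f
  proof -
    have "(\<Oplus>\<^bsub>free_module X\<^esub>b\<in>delta ` X. D b f \<odot>\<^bsub>free_module X\<^esub> b) = (\<lambda>y. \<Sum>b\<in>delta ` X. (D b f \<odot>\<^bsub>free_module X\<^esub> b) y)"
      using 1 X by (intro free_module_finsum) (auto intro!: smult_closed simp del: free_module_simps)
    also have "\<dots> = (\<lambda>y. \<Sum>x\<in>X. f x * delta x y)"
      by (subst sum.reindex) (auto simp: inj_on_def D)
    also have "\<dots> = f"
      using f X by (auto simp: fun_eq_iff delta_def if_distrib free_module_carrier cong: if_cong)
    finally show ?thesis by simp
  qed
  note basis = dual_functionals_basis[OF finite_imageI[OF X] 1 2 3 4]
  show "is_basis (free_module X) (delta ` X)" by (rule basis(1))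
  show "coords (free_module X) (delta ` X) f (delta x) = f x"
    if "f \<in> carrier (free_module X)" "x \<in> X"
    using basis(2)[of f "delta x"] that by (simp add: D)
qed

lemma lin_trace_permutation:
  assumes X: "finite X" and g: "g \<in> X \<rightarrow> X"
  shows "lin_trace (free_module X) (free_map g) = of_nat (card {x\<in>X. g x = x})"
proof -
  interpret complex_module "free_module X" by (rule complex_module_free_module)
  have "lin_trace (free_module X) (free_map g) =
      (\<Sum>b\<in>delta ` X. coords (free_module X) (delta ` X) (free_map g b) b)"
    by (rule lin_trace_eq[OF free_module_basis(1)[OF X] module_map_free_map[OF g]])
  also have "\<dots> = (\<Sum>x\<in>X. delta (g x) x)"
    by (subst sum.reindex) (use g in \<open>auto simp: inj_on_def free_map_delta free_module_basis(2)[OF X] delta_carrier Pi_iff intro!: sum.cong\<close>)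
  also have "\<dots> = (\<Sum>x\<in>X. if g x = x then 1 else 0)"
    by (intro sum.cong) (auto simp: delta_def)
  also have "\<dots> = of_nat (card {x\<in>X. g x = x})"
    using X by (simp add: sum.inter_filter[symmetric])
  finally show ?thesis .
qed

section \<open>Submodules defined by functionals and linear maps\<close>

context complex_module
begin

lemma a_inv_smult: "x \<in> carrier M \<Longrightarrow> \<ominus> x = (-1) \<odot> x"
  using smult_l_distr[of "-1" 1 x] smult_l_null[of x] smult_one[of x] by (intro minus_equality) auto

text \<open>Kernels, and the preimages of the next lemma, are the submodules to which minimality of
  \<open>ext_relations\<close> is applied: vanishing or invariance then needs checking on the
  relators only.\<close>

lemma functional_kernel_submodule:
  assumes D: "functional M D"
  shows "submodule {x \<in> carrier M. D x = 0} complex_ring M"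
proof (rule submoduleI)
  have scale: "D (a \<odot> x) = a * D x" if "x \<in> carrier M" for a x
    using D that by (simp add: functional_def)
  show "\<zero> \<in> {x \<in> carrier M. D x = 0}"
    using scale[OF zero_closed, of 0] by (simp add: zero_smult)
  show "\<ominus> a \<in> {x \<in> carrier M. D x = 0}" if "a \<in> {x \<in> carrier M. D x = 0}" for a
  proof -
    have "D (a \<oplus> \<ominus> a) = D a + D (\<ominus> a)" using D that by (simp add: functional_def)
    then show ?thesis using that scale[OF zero_closed, of 0] by (simp add: zero_smult r_neg)
  qed
qed (use D in \<open>auto simp: functional_def\<close>)

lemma preimage_submodule:
  assumes f: "module_map M M f" and N: "submodule N complex_ring M"
  shows "submodule {x \<in> carrier M. f x \<in> N} complex_ring M"
proof (rule submoduleI)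
  note E = submoduleE[OF N]
  have fc: "f x \<in> carrier M" if "x \<in> carrier M" for x using f that by (auto simp: module_map_def)
  have scale: "f (a \<odot> x) = a \<odot> f x" if "x \<in> carrier M" for a x
    using f that by (simp add: module_map_def)
  show "\<zero> \<in> {x \<in> carrier M. f x \<in> N}"
    using scale[OF zero_closed, of 0] subgroup.one_closed[OF submodule.axioms(1)[OF N]] fc[OF zero_closed]
      smult_l_null[of "f \<zero>"]
    by (simp add: zero_smult)
  show "\<ominus> a \<in> {x \<in> carrier M. f x \<in> N}" if a: "a \<in> {x \<in> carrier M. f x \<in> N}" for a
  proof -
    show ?thesis using a scale E(4) by (simp add: a_inv_smult)
  qed
qed (use f submoduleE[OF N] in \<open>auto simp: module_map_def\<close>)

lemma submodule_comb:
  assumes H: "submodule H complex_ring M" and "finite A" "g \<in> A \<rightarrow> H"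
  shows "(\<Oplus>a\<in>A. c a \<odot> g a) \<in> H"
  using assms(2,3)
proof induction
  case empty
  then show ?case using subgroup.one_closed[OF submodule.axioms(1)[OF H]] by simp
next
  case (insert x A)
  note E = submoduleE[OF H]
  have "g a \<in> carrier M" if "a \<in> insert x A" for a using E(1) insert that by auto
  then have "(\<Oplus>a\<in>insert x A. c a \<odot> g a) = c x \<odot> g x \<oplus> (\<Oplus>a\<in>A. c a \<odot> g a)"
    using insert by (subst finsum_insert) (auto simp: Pi_iff)
  then show ?case using insert E by (simp add: Pi_iff)
qed

text \<open>Being equal to one's own expansion is preserved by linear combinations, so spanning can
  be checked on generators.\<close>

lemma expansion_submodule:
  assumes fin: "finite B" "B \<subseteq> carrier M" and D: "\<And>b. b \<in> B \<Longrightarrow> functional M (D b)"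
  shows "submodule {v \<in> carrier M. v = (\<Oplus>b\<in>B. D b v \<odot> b)} complex_ring M" (is "submodule ?H _ _")
proof (rule submoduleI)
  have scale: "a \<odot> v \<in> ?H" if "v \<in> ?H" for a v
  proof -
    have "a \<odot> (\<Oplus>b\<in>B. D b v \<odot> b) = (\<Oplus>b\<in>B. a \<odot> (D b v \<odot> b))"
      using fin by (intro finsum_smult_ldistr) auto
    also have "\<dots> = (\<Oplus>b\<in>B. D b (a \<odot> v) \<odot> b)"
    proof (rule finsum_cong')
      fix b assume b: "b \<in> B"
      then have "D b (a \<odot> v) = a * D b v" using D that by (simp add: functional_def)
      then show "a \<odot> (D b v \<odot> b) = D b (a \<odot> v) \<odot> b"
        using smult_assoc1[of a "D b v" b] b fin by auto
    qed (use fin in auto)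
    finally have "a \<odot> (\<Oplus>b\<in>B. D b v \<odot> b) = (\<Oplus>b\<in>B. D b (a \<odot> v) \<odot> b)" .
    then show ?thesis using that by auto
  qed
  show "a \<odot> v \<in> ?H" if "v \<in> ?H" for a v using scale[OF that] .
  have D0: "D b \<zero> = 0" if "b \<in> B" for b
    using functional_finsum[OF D[OF that], of "{}" "\<lambda>x. x"] by simp
  have "(\<Oplus>b\<in>B. D b \<zero> \<odot> b) = (\<Oplus>b\<in>B. \<zero>)"
    using fin smult_l_null by (intro finsum_cong') (auto simp: D0)
  then show "\<zero> \<in> ?H" by simp
  show "\<ominus> a \<in> ?H" if "a \<in> ?H" for a
  proof -
    have "\<ominus> a = (-1) \<odot> a"
      using that by (simp add: a_inv_smult)
    then show ?thesis using scale[OF that, of "-1"] by simp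
  qed
  show "u \<oplus> v \<in> ?H" if "u \<in> ?H" "v \<in> ?H" for u v
  proof -
    have "(\<Oplus>b\<in>B. D b u \<odot> b) \<oplus> (\<Oplus>b\<in>B. D b v \<odot> b) = (\<Oplus>b\<in>B. (D b u \<odot> b) \<oplus> (D b v \<odot> b))"
      using fin by (intro finsum_addf[symmetric]) auto
    also have "\<dots> = (\<Oplus>b\<in>B. D b (u \<oplus> v) \<odot> b)"
    proof (rule finsum_cong')
      fix b assume b: "b \<in> B"
      then have "D b (u \<oplus> v) = D b u + D b v" using D that by (simp add: functional_def)
      then show "(D b u \<odot> b) \<oplus> (D b v \<odot> b) = D b (u \<oplus> v) \<odot> b"
        using smult_l_distr[of "D b u" "D b v" b] b fin by auto
    qed (use fin in auto)
    finally have "(\<Oplus>b\<in>B. D b u \<odot> b) \<oplus> (\<Oplus>b\<in>B. D b v \<odot> b) = (\<Oplus>b\<in>B. D b (u \<oplus> v) \<odot> b)" .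
    then show ?thesis using that by auto
  qed
qed auto

end

text \<open>The induced functional evaluates D at a representative chosen by SOME; as D vanishes on
  N, the choice does not affect the value.\<close>

lemma (in complex_submodule) functional_quot:
  assumes D: "functional M D" and N0: "\<And>n. n \<in> N \<Longrightarrow> D n = 0"
  obtains D' where "functional (quot_module M N) D'" "\<And>x. x \<in> carrier M \<Longrightarrow> D' (N +> x) = D x"
proof -
  define D' where "D' = (\<lambda>C. D (SOME x. x \<in> C))"
  have D': "D' (N +> x) = D x" if x: "x \<in> carrier M" for x
  proof -
    have "(SOME y. y \<in> N +> x) \<in> N +> x" using sub.a_rcos_self[OF x] by (rule someI)
    then obtain n where "n \<in> N" "(SOME y. y \<in> N +> x) = n \<oplus> x" by (auto simp: a_r_coset_def')
    moreover then have "n \<in> carrier M" using sub.a_subset by auto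
    ultimately show ?thesis using D x N0 by (simp add: D'_def functional_def)
  qed
  show ?thesis
  proof (rule that[OF _ D'])
    show "functional (quot_module M N) D'"
      unfolding functional_def
    proof (intro conjI ballI allI)
      fix C E assume "C \<in> carrier (quot_module M N)" "E \<in> carrier (quot_module M N)"
      then obtain x y where "x \<in> carrier M" "C = N +> x" "y \<in> carrier M" "E = N +> y"
        unfolding quot_simps by blast
      then show "D' (C \<oplus>\<^bsub>quot_module M N\<^esub> E) = D' C + D' E"
        using D by (simp add: quot_add D' functional_def)
    next
      fix a C assume "C \<in> carrier (quot_module M N)"
      then obtain x where "x \<in> carrier M" "C = N +> x" unfolding quot_simps by blast
      then show "D' (a \<odot>\<^bsub>quot_module M N\<^esub> C) = a * D' C"
        using D by (simp add: quot_smult D' functional_def)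
    qed
  qed
qed

text \<open>The linear extension of a function m on the generators. It turns the minors into
  functionals on lists of vectors.\<close>

lemma functional_free_module:
  "functional (free_module X) (\<lambda>f. \<Sum>x | f x \<noteq> 0. f x * m x)" (is "functional _ ?D")
proof -
  have D: "?D f = (\<Sum>x\<in>A. f x * m x)" if "finite A" "{x. f x \<noteq> 0} \<subseteq> A" for A f
    using that by (intro sum.mono_neutral_left) auto
  show ?thesis
    unfolding functional_def
  proof (intro conjI ballI allI)
    fix e f assume "e \<in> carrier (free_module X)" "f \<in> carrier (free_module X)"
    then have fin: "finite ({x. e x \<noteq> 0} \<union> {x. f x \<noteq> 0})" (is "finite ?A") by (auto simp: free_module_carrier)
    have "?D (\<lambda>x. e x + f x) = (\<Sum>x\<in>?A. (e x + f x) * m x)" "?D e = (\<Sum>x\<in>?A. e x * m x)"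
      "?D f = (\<Sum>x\<in>?A. f x * m x)"
      by (rule D[OF fin]; auto)+
    then show "?D (e \<oplus>\<^bsub>free_module X\<^esub> f) = ?D e + ?D f"
      by (simp add: sum.distrib distrib_right)
  next
    fix a f assume "f \<in> carrier (free_module X)"
    then have fin: "finite {x. f x \<noteq> 0}" by (auto simp: free_module_carrier)
    have "?D (\<lambda>x. a * f x) = (\<Sum>x\<in>{x. f x \<noteq> 0}. (a * f x) * m x)"
      by (rule D[OF fin]) auto
    then show "?D (a \<odot>\<^bsub>free_module X\<^esub> f) = a * ?D f"
      by (simp add: sum_distrib_left mult.assoc)
  qed
qed

lemma free_map_inverse:
  assumes g: "g \<in> X \<rightarrow> X" and h: "h \<in> X \<rightarrow> X" and gh: "\<And>x. x \<in> X \<Longrightarrow> g (h x) = x"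
    and f: "f \<in> carrier (free_module X)"
  shows "free_map g (free_map h f) = f"
proof -
  let ?F = "free_module X" and ?A = "{x. f x \<noteq> 0}"
  interpret complex_module ?F by (rule complex_module_free_module)
  have A: "finite ?A" "?A \<subseteq> X" using f by (auto simp: free_module_carrier)
  have M: "module complex_ring ?F" by (rule module_free_module)
  have "free_map h f = free_map h (\<Oplus>\<^bsub>?F\<^esub>x\<in>?A. f x \<odot>\<^bsub>?F\<^esub> delta x)"
    using free_module_expand[OF f] by simp
  also have "\<dots> = (\<Oplus>\<^bsub>?F\<^esub>x\<in>?A. f x \<odot>\<^bsub>?F\<^esub> free_map h (delta x))"
    by (rule module_map_comb[OF M module_map_free_map[OF h] A(1)]) (use A in \<open>auto intro: delta_carrier\<close>)
  finally have "free_map g (free_map h f) = free_map g (\<Oplus>\<^bsub>?F\<^esub>x\<in>?A. f x \<odot>\<^bsub>?F\<^esub> delta (h x))"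
    by (simp only: free_map_delta)
  also have "\<dots> = (\<Oplus>\<^bsub>?F\<^esub>x\<in>?A. f x \<odot>\<^bsub>?F\<^esub> free_map g (delta (h x)))"
    by (rule module_map_comb[OF M module_map_free_map[OF g] A(1)]) (use A h in \<open>auto intro: delta_carrier\<close>)
  also have "\<dots> = (\<Oplus>\<^bsub>?F\<^esub>x\<in>?A. f x \<odot>\<^bsub>?F\<^esub> delta x)"
    using A gh by (intro finsum_cong') (auto simp: free_map_delta delta_carrier subset_iff simp del: free_module_simps)
  also have "\<dots> = f" using free_module_expand[OF f] by simp
  finally show ?thesis .
qed


section \<open>Characters of exterior powers\<close>

text \<open>Each index set S receives one fixed but arbitrary enumeration. The order affects only a
  sign, which cancels because the basis vector and the minor belonging to S use the same
  enumeration.\<close>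

definition position :: "'a set \<Rightarrow> 'a \<Rightarrow> nat" where
  "position S = (SOME g. bij_betw g S {..<card S})"

lemma position:
  assumes "finite S" shows "bij_betw (position S) S {..<card S}"
proof -
  obtain g where "bij_betw g S {0..<card S}"
    using ex_bij_betw_finite_nat[OF assms] by blast
  then have "bij_betw g S {..<card S}" by (simp add: atLeast0LessThan)
  then show ?thesis unfolding position_def by (rule someI[of "\<lambda>g. bij_betw g S {..<card S}"])
qed

definition position_list :: "'a set \<Rightarrow> 'a list" where
  "position_list S = map (inv_into S (position S)) [0..<card S]"

lemma length_position_list [simp]: "length (position_list S) = card S"
  by (simp add: position_list_def)

lemma position_list_nth:
  assumes "finite S" "i \<in> S"
  shows "position S i < card S" "position_list S ! position S i = i"
proof -
  have bij: "bij_betw (position S) S {..<card S}" by (rule position[OF assms(1)])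
  then show "position S i < card S" using assms(2) by (auto simp: bij_betw_def)
  then show "position_list S ! position S i = i"
    using bij assms(2) by (simp add: position_list_def bij_betw_inv_into_left)
qed

lemma set_position_list: assumes "finite S" shows "set (position_list S) = S"
  using bij_betw_imp_surj_on[OF bij_betw_inv_into[OF position[OF assms]]]
  by (simp add: position_list_def atLeast0LessThan[symmetric])

lemma distinct_position_list: "finite S \<Longrightarrow> distinct (position_list S)"
  by (simp add: card_distinct set_position_list)

text \<open>The coefficient of \<open>v\<^sub>1 \<and> \<dots> \<and> v\<^sub>k\<close> at the basis vector indexed by the \<open>k\<close>-set
  \<open>S\<close>.  Filling up with unit rows turns the \<open>k \<times> k\<close> minor into a determinant of the
  fixed size \<open>n\<close>; \<open>position S\<close> tells which vector of the list goes into which row.\<close>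

definition minor :: "'n set \<Rightarrow> (complex^'n) list \<Rightarrow> complex" where
  "minor S l = det (\<chi> i. if i \<in> S then l ! position S i else axis i 1)"

abbreviation axes :: "'n list \<Rightarrow> (complex^'n) list" where
  "axes T \<equiv> map (\<lambda>i. axis i 1) T"

text \<open>Exactly one row of the minor reads the entry after \<open>xs\<close>. The placeholder 0
  makes the remaining rows visibly independent of u, as the row lemmas for determinants
  require.\<close>

lemma minor_slot:
  fixes S :: "'n::finite set"
  assumes "length xs + length ys + 1 = card S"
  obtains i0 where "i0 \<in> S" "position S i0 = length xs"
    "\<And>u. minor S (xs @ [u] @ ys) = det (\<chi> i. if i = i0 then u else if i \<in> S then (xs @ [0] @ ys) ! position S i else axis i 1)"
proof -
  have bij: "bij_betw (position S) S {..<card S}" by (rule position) simp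
  then obtain i0 where i0: "i0 \<in> S" "position S i0 = length xs"
    using assms by (metis bij_betw_iff_bijections less_add_one lessThan_iff add.assoc add.commute less_add_Suc1 Suc_eq_plus1 trans_less_add1)
  have "position S i \<noteq> length xs" if "i \<in> S" "i \<noteq> i0" for i
    using bij that i0 by (metis bij_betw_imp_inj_on inj_on_eq_iff)
  then have "(\<chi> i. if i \<in> S then (xs @ [u] @ ys) ! position S i else axis i 1)
     = (\<chi> i. if i = i0 then u else if i \<in> S then (xs @ [0] @ ys) ! position S i else axis i 1)" for u :: "complex^'n"
    using i0 by (auto simp: vec_eq_iff nth_append nth_Cons')
  then show ?thesis by (intro that[OF i0]) (simp only: minor_def)
qed

lemma minor_linear:
  fixes S :: "'n::finite set"
  assumes "length xs + length ys + 1 = card S"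
  shows "minor S (xs @ [a *s u + v] @ ys) = a * minor S (xs @ [u] @ ys) + minor S (xs @ [v] @ ys)"
proof -
  obtain i0 where eq: "\<And>u. minor S (xs @ [u] @ ys) =
      det (\<chi> i. if i = i0 then u else if i \<in> S then (xs @ [0] @ ys) ! position S i else axis i 1)"
    using minor_slot[OF assms] by blast
  let ?c = "\<lambda>i. if i \<in> S then (xs @ [0] @ ys) ! position S i else axis i 1"
  show ?thesis
    unfolding eq det_row_add[of i0 "\<lambda>_. a *s u" "\<lambda>_. v" ?c] det_row_mul[of i0 a "\<lambda>_. u" ?c] ..
qed

lemma minor_alternating:
  fixes S :: "'n::finite set"
  assumes "length xs + length ys + length zs + 2 = card S"
  shows "minor S (xs @ [u] @ ys @ [u] @ zs) = 0"
proof -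
  have bij: "bij_betw (position S) S {..<card S}" by (rule position) simp
  have "length xs \<in> position S ` S" "length xs + 1 + length ys \<in> position S ` S"
    using bij assms by (auto simp: bij_betw_def)
  then obtain i j where ij: "i \<in> S" "position S i = length xs" "j \<in> S" "position S j = length xs + 1 + length ys"
    by auto
  then have "i \<noteq> j" by auto
  then show ?thesis
    unfolding minor_def
    by (rule det_identical_rows) (use ij in \<open>simp add: row_def nth_append\<close>)
qed

text \<open>For S = T the rows form the identity matrix. Otherwise some a lies in T but not in S;
  its axis vector occurs as the padding row a and again in the row of S that reads the entry a of
  T.\<close>

lemma minor_axes:
  fixes S T :: "'n::finite set"
  assumes "card T = card S"
  shows "minor S (axes (position_list T)) = (if S = T then 1 else 0)"
proof (cases "S = T")
  case True
  have "(\<chi> i. if i \<in> S then axes (position_list S) ! position S i else axis i 1) = (mat 1 :: complex^'n^'n)"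
    using position_list_nth[of S] by (auto simp: vec_eq_iff mat_def axis_def)
  then have "minor S (axes (position_list S)) = 1" by (simp only: minor_def det_I)
  then show ?thesis using True by simp
next
  case False
  then obtain a where a: "a \<in> T" "a \<notin> S"
    using assms by (metis card_subset_eq finite_class.finite subsetI)
  have bij: "bij_betw (position S) S {..<card S}" by (rule position) simp
  have "position T a \<in> position S ` S"
    using position_list_nth[of T a] a assms bij by (auto simp: bij_betw_def)
  then obtain b where b: "b \<in> S" "position S b = position T a" by auto
  then have "a \<noteq> b" using a by auto
  then have "minor S (axes (position_list T)) = 0"
    unfolding minor_def
    by (rule det_identical_rows) (use a b assms position_list_nth[of T a] in \<open>simp add: row_def\<close>)
  then show ?thesis using False by simp
qed

text \<open>The fact that the wedges of axis vectors, one for each k-subset, span the exterior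
  power, cast as an induction rule so that it applies to any predicate closed under the multilinear
  and alternating relations.\<close>

lemma alternating_induct:
  fixes Q :: "(complex^'n) list \<Rightarrow> bool"
  assumes lin: "\<And>xs ys a u v. length xs + length ys + 1 = k \<Longrightarrow> Q (xs @ [u] @ ys) \<Longrightarrow> Q (xs @ [v] @ ys)
      \<Longrightarrow> Q (xs @ [a *s u + v] @ ys)"
    and alt: "\<And>xs ys zs u. length xs + length ys + length zs + 2 = k \<Longrightarrow> Q (xs @ [u] @ ys @ [u] @ zs)"
    and base: "\<And>S. card S = k \<Longrightarrow> Q (axes (position_list S))"
    and l: "length l = k"
  shows "Q l"
proof -
  \<comment> \<open>Polarization with closure rules in place of equations: go from (u, v) to (u + v,
    v), then to (u + v, u), then to (v, u). Each step adds a pair with equal entries, which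
    satisfies Q by \<open>alt\<close>.\<close>
  have swap: "Q (xs @ [v] @ ys @ [u] @ zs)"
    if len: "length xs + length ys + length zs + 2 = k" and Q: "Q (xs @ [u] @ ys @ [v] @ zs)" for xs ys zs u v
  proof -
    have lin1: "Q (xs @ [a *s p + q] @ ys @ [r] @ zs)"
      if "Q (xs @ [p] @ ys @ [r] @ zs)" "Q (xs @ [q] @ ys @ [r] @ zs)" for a p q r
      using lin[of xs "ys @ [r] @ zs" p q a] that len by simp
    have lin2: "Q (xs @ [r] @ ys @ [a *s p + q] @ zs)"
      if "Q (xs @ [r] @ ys @ [p] @ zs)" "Q (xs @ [r] @ ys @ [q] @ zs)" for a p q r
      using lin[of "xs @ [r] @ ys" zs p q a] that len by simp
    note alt' = alt[OF len]
    have "Q (xs @ [u + v] @ ys @ [v] @ zs)"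
      using lin1[OF Q alt', of 1] by simp
    then have "Q (xs @ [u + v] @ ys @ [u] @ zs)"
      using lin2[OF _ alt', of "u + v" v "-1"] by simp
    then show ?thesis
      using lin1[where a = "-1" and p = u and q = "u + v" and r = u, OF alt'] by simp
  qed
  \<comment> \<open>One swap brings the wanted head to the front; it then joins the prefix
    \<open>pre\<close> and the tails are treated recursively.\<close>
  have perm: "Q (pre @ xs)" if "mset xs = mset ys" "length (pre @ xs) = k" "Q (pre @ ys)" for pre xs ys
    using that
  proof (induction xs arbitrary: pre ys)
    case Nil
    then show ?case by simp
  next
    case (Cons x xs)
    then have "x \<in> set ys" by (metis list.set_intros(1) mset_eq_setD)
    then obtain a b where ab: "ys = a @ x # b" by (meson split_list)
    show ?case
    proof (cases a)
      case Nil
      then show ?thesis using Cons.IH[of b "pre @ [x]"] Cons.prems ab by simp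
    next
      case (Cons y a')
      have len: "length pre + length a' + length b + 2 = k"
        using \<open>mset (x # xs) = mset ys\<close> \<open>length (pre @ x # xs) = k\<close> ab Cons mset_eq_length by fastforce
      have "Q (pre @ [x] @ a' @ [y] @ b)"
        using swap[OF len, of y x] Cons.prems ab Cons by simp
      moreover have "mset xs = mset (a' @ y # b)"
        using Cons.prems(1) ab Cons by simp
      ultimately show ?thesis
        using Cons.IH[of "a' @ y # b" "pre @ [x]"] Cons.prems by simp
    qed
  qed
  have Q_axes: "Q (axes T)" if "length T = k" for T
  proof (cases "distinct T")
    case True
    then have "mset T = mset (position_list (set T))"
      by (metis List.finite_set distinct_position_list set_position_list set_eq_iff_mset_eq_distinct)
    then have "mset (axes T) = mset (axes (position_list (set T)))" by simp
    moreover have "Q (axes (position_list (set T)))"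
      using base[of "set T"] True that by (simp add: distinct_card)
    ultimately show ?thesis
      using perm[of "axes T" "axes (position_list (set T))" "[]"] that by simp
  next
    case False
    then obtain xs ys zs y where T: "T = xs @ [y] @ ys @ [y] @ zs"
      using not_distinct_decomp by blast
    then show ?thesis using alt[of "axes xs" "axes ys" "axes zs" "axis y 1"] that by simp
  qed
  \<comment> \<open>The arbitrary vectors are those in \<open>xs\<close>. The last of them is
    expanded into axis vectors, each of which joins the block of axes to its right.\<close>
  have "Q (xs @ axes T)" if "length xs + length T = k" for xs T
    using that
  proof (induction xs arbitrary: T rule: rev_induct)
    case Nil
    then show ?case using Q_axes by simp
  next
    case (snoc u xs)
    have ax: "Q (xs @ [axis i 1] @ axes T)" for i
      using snoc.IH[of "i # T"] snoc.prems by simp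
    have lin': "Q (xs @ [a *s p + q] @ axes T)" if "Q (xs @ [p] @ axes T)" "Q (xs @ [q] @ axes T)" for a p q
      using lin[of xs "axes T"] that snoc.prems by simp
    have "Q (xs @ [\<Sum>i\<in>A. u $ i *s axis i 1] @ axes T)" for A
    proof -
      have "finite A" by simp
      then show ?thesis
      proof induction
        case empty
        fix j :: 'n
        \<comment> \<open>The empty sum is the zero vector, reached by the two-term rule as - e_j +
          e_j for an arbitrary index j.\<close>
        show ?case using lin'[OF ax[of j] ax[of j], of "-1"] by simp
      next
        case (insert x A)
        then show ?case using lin'[OF ax, of _ "u $ x" x] by simp
      qed
    qed
    from this[of UNIV] show ?case by (simp add: basis_expansion)
  qed
  from this[of l "[]"] show ?thesis using l by simp
qed

section \<open>The relations of an exterior power\<close>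

lemma ext_relators_carrier: "ext_relators k \<subseteq> carrier (free_module {l. length l = k})"
proof
  fix r :: "(complex^'n) list \<Rightarrow> complex" assume "r \<in> ext_relators k"
  then consider (lin) xs ys a u v where "length xs + length ys + 1 = k"
      "r = (\<lambda>l. delta (xs @ [a *s u + v] @ ys) l - a * delta (xs @ [u] @ ys) l - delta (xs @ [v] @ ys) l)"
    | (alt) xs ys zs u where "length xs + length ys + length zs + 2 = k" "r = delta (xs @ [u] @ ys @ [u] @ zs)"
    unfolding ext_relators_def by blast
  then show "r \<in> carrier (free_module {l. length l = k})"
  proof cases
    case lin
    then have "{l. r l \<noteq> 0} \<subseteq> {xs @ [a *s u + v] @ ys, xs @ [u] @ ys, xs @ [v] @ ys}"
      by (auto simp: delta_def split: if_splits)
    moreover have "{xs @ [a *s u + v] @ ys, xs @ [u] @ ys, xs @ [v] @ ys} \<subseteq> {l. length l = k}"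
      using lin(1) by auto
    ultimately show ?thesis
      unfolding free_module_carrier by (meson finite.emptyI finite.insertI finite_subset subset_trans)
  next
    case alt
    then show ?thesis by (auto intro!: delta_carrier)
  qed
qed

lemma ext_relations_submodule: "submodule (ext_relations k) complex_ring (free_module {l. length l = k})"
  unfolding ext_relations_def
proof (rule submodule_Inter[OF module_free_module])
  have "carrier (free_module {l. length l = k}) \<in>
      {N. submodule N complex_ring (free_module {l. length l = k}) \<and> ext_relators k \<subseteq> N}"
    using ext_relators_carrier module.carrier_is_submodule[OF module_free_module] by blast
  then show "{N. submodule N complex_ring (free_module {l. length l = k}) \<and> ext_relators k \<subseteq> N} \<noteq> {}"
    by blast
qed auto

lemma ext_relations_least:
  "submodule N complex_ring (free_module {l. length l = k}) \<Longrightarrow> ext_relators k \<subseteq> N \<Longrightarrow> ext_relations k \<subseteq> N"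
  unfolding ext_relations_def by blast

lemma ext_relators_sub: "ext_relators k \<subseteq> ext_relations k"
  unfolding ext_relations_def by blast

lemma ext_relator_linear:
  "length xs + length ys + 1 = k \<Longrightarrow>
    (\<lambda>l. delta (xs @ [a *s u + v] @ ys) l - a * delta (xs @ [u] @ ys) l - delta (xs @ [v] @ ys) l) \<in> ext_relators k"
  unfolding ext_relators_def by blast

lemma ext_relator_alternating:
  "length xs + length ys + length zs + 2 = k \<Longrightarrow> delta (xs @ [u] @ ys @ [u] @ zs) \<in> ext_relators k"
  unfolding ext_relators_def by blast

text \<open>A linear map carries relators to relators, hence relations to relations. The second
  inclusion uses the inverse matrix; together they give the equality needed for images of
  cosets.\<close>

lemma ext_relations_invariant:
  fixes A A' :: "complex^'n^'n"
  assumes AA': "A ** A' = mat 1"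
  shows "free_map (map ((*v) A)) ` ext_relations k \<subseteq> ext_relations k"
    and "A' ** A = mat 1 \<Longrightarrow> ext_relations k \<subseteq> free_map (map ((*v) A)) ` ext_relations k"
proof -
  let ?X = "{l :: (complex^'n) list. length l = k}" and ?N = "ext_relations k :: ((complex^'n) list \<Rightarrow> complex) set"
  interpret complex_module "free_module ?X" by (rule complex_module_free_module)
  \<comment> \<open>Proved for every matrix, since the reverse inclusion applies it to
    \<open>A'\<close>.\<close>
  have inv: "free_map (map ((*v) A)) ` ?N \<subseteq> ?N" for A :: "complex^'n^'n"
  proof -
    let ?f = "free_map (map ((*v) A))"
    have f: "module_map (free_module ?X) (free_module ?X) ?f"
      by (rule module_map_free_map) auto
    let ?P = "{x \<in> carrier (free_module ?X). ?f x \<in> ?N}"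
    have "?f r \<in> ?N" if r: "r \<in> ext_relators k" for r
    proof -
      consider (lin) xs ys a u v where "length xs + length ys + 1 = k"
          "r = (\<lambda>l. delta (xs @ [a *s u + v] @ ys) l - a * delta (xs @ [u] @ ys) l - delta (xs @ [v] @ ys) l)"
        | (alt) xs ys zs u where "length xs + length ys + length zs + 2 = k" "r = delta (xs @ [u] @ ys @ [u] @ zs)"
        using r unfolding ext_relators_def by blast
      then have "?f r \<in> ext_relators k"
      proof cases
        case lin
        let ?A = "{xs @ [a *s u + v] @ ys, xs @ [u] @ ys, xs @ [v] @ ys}"
        let ?l = "xs @ [a *s u + v] @ ys" and ?m = "xs @ [u] @ ys" and ?n = "xs @ [v] @ ys"
        have carr: "delta ?l \<in> carrier (free_module ?X)" "delta ?m \<in> carrier (free_module ?X)"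
            "delta ?n \<in> carrier (free_module ?X)"
          using lin(1) by (auto intro: delta_carrier)
        have "r = delta ?l \<oplus>\<^bsub>free_module ?X\<^esub> ((-a) \<odot>\<^bsub>free_module ?X\<^esub> delta ?m
            \<oplus>\<^bsub>free_module ?X\<^esub> (-1) \<odot>\<^bsub>free_module ?X\<^esub> delta ?n)"
          using lin(2) by (simp add: fun_eq_iff)
        then have "?f r = ?f (delta ?l) \<oplus>\<^bsub>free_module ?X\<^esub> ((-a) \<odot>\<^bsub>free_module ?X\<^esub> ?f (delta ?m)
            \<oplus>\<^bsub>free_module ?X\<^esub> (-1) \<odot>\<^bsub>free_module ?X\<^esub> ?f (delta ?n))"
          using f carr smult_closed a_closed by (simp add: module_map_def del: free_module_simps)
        then have "?f r = (\<lambda>l. delta (map ((*v) A) xs @ [a *s (A *v u) + A *v v] @ map ((*v) A) ys) l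
            - a * delta (map ((*v) A) xs @ [A *v u] @ map ((*v) A) ys) l
            - delta (map ((*v) A) xs @ [A *v v] @ map ((*v) A) ys) l)"
          by (simp add: free_map_delta fun_eq_iff matrix_vector_right_distrib vector_scalar_commute)
        then show ?thesis using ext_relator_linear[of "map ((*v) A) xs" "map ((*v) A) ys" k] lin(1) by simp
      next
        case alt
        then show ?thesis
          using ext_relator_alternating[of "map ((*v) A) xs" "map ((*v) A) ys" "map ((*v) A) zs" k]
          by (simp add: free_map_delta)
      qed
      then show ?thesis using ext_relators_sub by blast
    qed
    then have "ext_relators k \<subseteq> ?P" using ext_relators_carrier[of k] by blast
    then have "?N \<subseteq> ?P"
      by (rule ext_relations_least[OF preimage_submodule[OF f ext_relations_submodule]])
    then show ?thesis by blast
  qed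
  show "free_map (map ((*v) A)) ` ?N \<subseteq> ?N" by (rule inv)
  show "?N \<subseteq> free_map (map ((*v) A)) ` ?N"
  proof
    fix x assume x: "x \<in> ?N"
    then have "x \<in> carrier (free_module ?X)"
      using submoduleE(1)[OF ext_relations_submodule] by blast
    then have "x = free_map (map ((*v) A)) (free_map (map ((*v) A')) x)"
      by (intro free_map_inverse[symmetric, of _ ?X])
         (auto simp: matrix_vector_mul_assoc AA' o_def)
    then show "x \<in> free_map (map ((*v) A)) ` ?N" using x inv[of A'] by blast
  qed
qed

lemma matrix_vector_mult_axis: "(A :: 'a::semiring_1^'n^'m) *v axis k 1 = column k A"
  by (simp add: vec_eq_iff matrix_vector_mult_def axis_def column_def if_distrib cong: if_cong)

text \<open>The wedges of axis vectors over the k-subsets S form a basis with the minors as dual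
  functionals. The diagonal entry at S is the minor at S of the images of the axis vectors, that is,
  of columns of A.\<close>

lemma lin_trace_ext_power:
  fixes A A' :: "complex^'n^'n"
  assumes AA': "A ** A' = mat 1"
  shows "lin_trace (quot_module (free_module {l. length l = k}) (ext_relations k))
      (\<lambda>C. free_map (map ((*v) A)) ` C)
    = (\<Sum>S | card S = k. det (\<chi> i. if i \<in> S then column i A else axis i 1))"
proof -
  let ?X = "{l :: (complex^'n) list. length l = k}" and ?N = "ext_relations k :: ((complex^'n) list \<Rightarrow> complex) set"
  let ?E = "free_module ?X" and ?f = "free_map (map ((*v) A))"
  interpret E: complex_submodule ?E ?N
    by (simp add: complex_submodule_def complex_module_free_module complex_submodule_axioms_def ext_relations_submodule)
  let ?Q = "quot_module ?E ?N"
  interpret Q: complex_module ?Q using E.module_quot_module by (simp add: complex_module_def)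
  define wedge where "wedge = (\<lambda>l. ?N +>\<^bsub>?E\<^esub> delta l)"
  define I where "I = {S :: 'n set. card S = k}"
  have fin: "finite I" by simp
  have dc: "delta l \<in> carrier ?E" if "length l = k" for l using that by (auto intro: delta_carrier)
  have wc: "wedge l \<in> carrier ?Q" if "length l = k" for l
    using dc[OF that] by (auto simp: wedge_def E.quot_simps)
  \<comment> \<open>The minor at S, extended linearly to the free module, vanishes on the relators
    by multilinearity and alternation, hence on all relations, and descends to the quotient.\<close>
  have "\<exists>D'. functional ?Q D' \<and> (\<forall>l. length l = k \<longrightarrow> D' (wedge l) = minor S l)" if S: "S \<in> I" for S
  proof -
    let ?D = "\<lambda>f. \<Sum>l | f l \<noteq> 0. f l * minor S l"
    have D: "functional ?E ?D" by (rule functional_free_module)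
    have D_delta: "?D (delta l) = minor S l" for l
    proof -
      have "{x. delta l x \<noteq> 0} = {l}" by (auto simp: delta_def)
      then show ?thesis by (simp add: delta_def)
    qed
    have "?D r = 0" if r: "r \<in> ext_relators k" for r
    proof -
      consider (lin) xs ys a u v where "length xs + length ys + 1 = k"
          "r = (\<lambda>l. delta (xs @ [a *s u + v] @ ys) l - a * delta (xs @ [u] @ ys) l - delta (xs @ [v] @ ys) l)"
        | (alt) xs ys zs u where "length xs + length ys + length zs + 2 = k" "r = delta (xs @ [u] @ ys @ [u] @ zs)"
        using r unfolding ext_relators_def by blast
      then show ?thesis
      proof cases
        case lin
        let ?l = "xs @ [a *s u + v] @ ys" and ?m = "xs @ [u] @ ys" and ?n = "xs @ [v] @ ys"
        have carr: "delta ?l \<in> carrier ?E" "delta ?m \<in> carrier ?E" "delta ?n \<in> carrier ?E"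
          using lin(1) by (auto intro: delta_carrier)
        have "r = delta ?l \<oplus>\<^bsub>?E\<^esub> ((-a) \<odot>\<^bsub>?E\<^esub> delta ?m \<oplus>\<^bsub>?E\<^esub> (-1) \<odot>\<^bsub>?E\<^esub> delta ?n)"
          using lin(2) by (simp add: fun_eq_iff)
        then have "?D r = ?D (delta ?l) + ((-a) * ?D (delta ?m) + (-1) * ?D (delta ?n))"
          using D[unfolded functional_def] carr E.smult_closed E.a_closed by (simp del: free_module_simps)
        then have "?D r = minor S ?l + ((-a) * minor S ?m + (-1) * minor S ?n)"
          by (simp only: D_delta)
        then show ?thesis using minor_linear[of xs ys S a u v] lin(1) S by (simp add: I_def)
      next
        case alt
        then show ?thesis using minor_alternating[of xs ys zs S u] S by (simp only: D_delta I_def mem_Collect_eq)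
      qed
    qed
    then have "ext_relators k \<subseteq> {x \<in> carrier ?E. ?D x = 0}" using ext_relators_carrier[of k] by blast
    then have "?N \<subseteq> {x \<in> carrier ?E. ?D x = 0}"
      by (rule ext_relations_least[OF E.functional_kernel_submodule[OF D]])
    then have N0: "?D n = 0" if "n \<in> ?N" for n using that by blast
    obtain D' where D': "functional ?Q D'" "\<And>x. x \<in> carrier ?E \<Longrightarrow> D' (?N +>\<^bsub>?E\<^esub> x) = ?D x"
      using E.functional_quot[OF D N0] by blast
    then show ?thesis using dc D_delta by (auto simp: wedge_def)
  qed
  then obtain D where D: "\<And>S. S \<in> I \<Longrightarrow> functional ?Q (D S)"
    "\<And>S l. S \<in> I \<Longrightarrow> length l = k \<Longrightarrow> D S (wedge l) = minor S l"
    by metis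
  define b where "b = (\<lambda>S. wedge (axes (position_list S)))"
  have dual: "D S (b T) = (if S = T then 1 else 0)" if "S \<in> I" "T \<in> I" for S T
    using that by (simp add: b_def D(2) I_def minor_axes)
  have inj: "inj_on b I"
    using dual by (metis inj_onI zero_neq_one)
  \<comment> \<open>\<open>is_basis\<close> speaks of a set of vectors, so the functionals are
    relabelled from subsets S to basis vectors.\<close>
  define D' where "D' = (\<lambda>c. D (inv_into I b c))"
  have D'_b: "D' (b S) = D S" if "S \<in> I" for S using inj that by (simp add: D'_def)
  have B: "finite (b ` I)" "b ` I \<subseteq> carrier ?Q"
    using fin wc by (auto simp: b_def I_def)
  have D'_fun: "functional ?Q (D' c)" if "c \<in> b ` I" for c using that D(1) by (auto simp: D'_b)
  have D'_dual: "D' c c' = (if c = c' then 1 else 0)" if "c \<in> b ` I" "c' \<in> b ` I" for c c'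
  proof -
    obtain S T where "S \<in> I" "T \<in> I" "c = b S" "c' = b T" using \<open>c \<in> b ` I\<close> \<open>c' \<in> b ` I\<close> by blast
    then show ?thesis using inj by (simp add: D'_b dual inj_on_eq_iff)
  qed
  \<comment> \<open>H consists of the vectors that the proposed basis represents correctly. It is a
    submodule containing the basis wedges, so \<open>alternating_induct\<close> puts every wedge
    into it.\<close>
  define H where "H = {v \<in> carrier ?Q. v = (\<Oplus>\<^bsub>?Q\<^esub>c\<in>b ` I. D' c v \<odot>\<^bsub>?Q\<^esub> c)}"
  have H: "submodule H complex_ring ?Q"
    unfolding H_def by (rule Q.expansion_submodule[OF B D'_fun])
  note HE = Q.submoduleE[OF H]
  have base: "wedge (axes (position_list S)) \<in> H" if "card S = k" for S
  proof -
    have S: "S \<in> I" using that by (simp add: I_def)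
    have "(\<Oplus>\<^bsub>?Q\<^esub>c\<in>b ` I. D' c (b S) \<odot>\<^bsub>?Q\<^esub> c) = (\<Oplus>\<^bsub>?Q\<^esub>c\<in>b ` I. if b S = c then c else \<zero>\<^bsub>?Q\<^esub>)"
    proof (rule Q.finsum_cong')
      fix c assume c: "c \<in> b ` I"
      have cc: "c \<in> carrier ?Q" using c B(2) by blast
      have "D' c (b S) = (if c = b S then 1 else 0)" using c S by (intro D'_dual) auto
      then show "D' c (b S) \<odot>\<^bsub>?Q\<^esub> c = (if b S = c then c else \<zero>\<^bsub>?Q\<^esub>)"
        using cc Q.smult_l_null[of c] Q.smult_one[of c] by auto
    qed (use B(2) in auto)
    also have "\<dots> = b S"
      by (rule Q.finsum_singleton) (use S B in auto)
    finally show ?thesis using B(2) S by (auto simp: H_def b_def)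
  qed
  have wH: "wedge l \<in> H" if "length l = k" for l
  proof (rule alternating_induct[of k "\<lambda>l. wedge l \<in> H", OF _ _ base that])
    fix xs ys :: "(complex^'n) list" and a u v
    assume len: "length xs + length ys + 1 = k"
      and u: "wedge (xs @ [u] @ ys) \<in> H" and v: "wedge (xs @ [v] @ ys) \<in> H"
    let ?l = "xs @ [a *s u + v] @ ys" and ?m = "xs @ [u] @ ys" and ?n = "xs @ [v] @ ys"
    have carr: "delta ?l \<in> carrier ?E" "delta ?m \<in> carrier ?E" "delta ?n \<in> carrier ?E"
      using len by (auto intro: delta_carrier)
    have s: "a \<odot>\<^bsub>?E\<^esub> delta ?m \<in> carrier ?E" using E.smult_closed carr by simp
    let ?y = "a \<odot>\<^bsub>?E\<^esub> delta ?m \<oplus>\<^bsub>?E\<^esub> delta ?n"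
    have y: "?y \<in> carrier ?E" using E.a_closed s carr by simp
    have "delta ?l \<ominus>\<^bsub>?E\<^esub> ?y = (\<lambda>l. delta ?l l - a * delta ?m l - delta ?n l)"
      using E.a_inv_smult[OF y] by (simp add: a_minus_def fun_eq_iff)
    also have "\<dots> \<in> ?N" using ext_relator_linear[OF len] ext_relators_sub by blast
    finally have "wedge ?l = ?N +>\<^bsub>?E\<^esub> ?y"
      unfolding wedge_def using E.coset_eq_iff[OF carr(1) y] by simp
    also have "\<dots> = a \<odot>\<^bsub>?Q\<^esub> wedge ?m \<oplus>\<^bsub>?Q\<^esub> wedge ?n"
      unfolding wedge_def using carr s by (simp only: E.quot_add E.quot_smult)
    finally show "wedge ?l \<in> H" using HE(4,5) u v by simp
  next
    fix xs ys zs :: "(complex^'n) list" and u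
    assume len: "length xs + length ys + length zs + 2 = k"
    let ?l = "xs @ [u] @ ys @ [u] @ zs"
    have "delta ?l \<in> ?N" using ext_relator_alternating[OF len] ext_relators_sub by blast
    then have "wedge ?l = \<zero>\<^bsub>?Q\<^esub>"
      unfolding wedge_def E.quot_simps(2) by (rule E.sub.a_rcos_const)
    then show "wedge ?l \<in> H"
      using subgroup.one_closed[OF submodule.axioms(1)[OF H]] by simp
  qed
  have span: "v = (\<Oplus>\<^bsub>?Q\<^esub>c\<in>b ` I. D' c v \<odot>\<^bsub>?Q\<^esub> c)" if v: "v \<in> carrier ?Q" for v
  proof -
    obtain x where x: "x \<in> carrier ?E" "v = ?N +>\<^bsub>?E\<^esub> x" using v unfolding E.quot_simps by blast
    have fx: "finite {l. x l \<noteq> 0}" "{l. x l \<noteq> 0} \<subseteq> ?X" using x(1) by (auto simp: free_module_carrier)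
    have "v = ?N +>\<^bsub>?E\<^esub> (\<Oplus>\<^bsub>?E\<^esub>l\<in>{l. x l \<noteq> 0}. x l \<odot>\<^bsub>?E\<^esub> delta l)"
      using x(2) free_module_expand[OF x(1)] by simp
    also have "\<dots> = (\<Oplus>\<^bsub>?Q\<^esub>l\<in>{l. x l \<noteq> 0}. x l \<odot>\<^bsub>?Q\<^esub> wedge l)"
      unfolding wedge_def
      by (rule E.module_map_comb[OF E.module_quot_module E.module_map_proj fx(1)]) (use fx dc in auto)
    also have "\<dots> \<in> H"
      by (rule Q.submodule_comb[OF H fx(1)]) (use fx wH in auto)
    finally show ?thesis by (simp add: H_def)
  qed
  note basis = Q.dual_functionals_basis[OF B D'_fun D'_dual span]
  have f: "module_map ?E ?E ?f" by (rule module_map_free_map) auto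
  have sur: "?f ` ?N = ?N"
    using ext_relations_invariant[OF AA'] AA' by (metis matrix_left_right_inverse subset_antisym)
  have "lin_trace ?Q (\<lambda>C. ?f ` C) = (\<Sum>c\<in>b ` I. coords ?Q (b ` I) (?f ` c) c)"
    by (rule Q.lin_trace_eq[OF basis(1) E.module_map_image[OF f sur]])
  also have "\<dots> = (\<Sum>S\<in>I. coords ?Q (b ` I) (?f ` b S) (b S))"
    using inj by (simp add: sum.reindex)
  also have "\<dots> = (\<Sum>S\<in>I. det (\<chi> i. if i \<in> S then column i A else axis i 1))"
  proof (rule sum.cong[OF refl])
    fix S assume S: "S \<in> I"
    let ?l = "axes (position_list S)"
    have len: "length ?l = k" using S by (simp add: I_def)
    have im: "?f ` b S = wedge (map ((*v) A) ?l)"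
      unfolding b_def wedge_def using E.coset_image[OF f sur dc[OF len]] by (simp only: free_map_delta)
    have "coords ?Q (b ` I) (?f ` b S) (b S) = D' (b S) (?f ` b S)"
      using S len wc by (intro basis(2)) (auto simp: im)
    also have "\<dots> = minor S (map ((*v) A) ?l)"
      using S len by (simp add: D'_b im D(2) del: map_map)
    also have "\<dots> = det (\<chi> i. if i \<in> S then column i A else axis i 1)"
      unfolding minor_def using position_list_nth[of S]
      by (intro arg_cong[where f = det]) (auto simp: vec_eq_iff matrix_vector_mult_axis)
    finally show "coords ?Q (b ` I) (?f ` b S) (b S) = det (\<chi> i. if i \<in> S then column i A else axis i 1)" .
  qed
  finally show ?thesis by (simp add: I_def)
qed

lemma complexify_simps:
  "complexify (A ** B) = complexify A ** complexify B" "complexify (mat 1) = mat 1"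
  by (simp_all add: complexify_def map_matrix_def vec_eq_iff matrix_matrix_mult_def mat_def)

lemma det_complexify: "det (complexify A) = complex_of_real (det A)"
  by (simp add: det_def complexify_def map_matrix_def)

lemma character_ext_power:
  assumes "orthogonal_matrix w"
  shows "character (ext_power k) w =
    complex_of_real (\<Sum>S | card S = k. det (\<chi> i. if i \<in> S then column i w else axis i 1))"
proof -
  have "complexify w ** complexify (transpose w) = mat 1"
    using assms by (simp add: orthogonal_matrix_def flip: complexify_simps)
  then have "character (ext_power k) w =
      (\<Sum>S | card S = k. det (\<chi> i. if i \<in> S then column i (complexify w) else axis i 1))"
    unfolding character_def ext_power_def fst_conv snd_conv by (rule lin_trace_ext_power)
  also have "\<dots> = (\<Sum>S | card S = k. det (complexify (\<chi> i. if i \<in> S then column i w else axis i 1)))"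
    by (intro sum.cong arg_cong[where f = det])
       (auto simp: complexify_def map_matrix_def vec_eq_iff column_def axis_def)
  finally show ?thesis by (simp add: det_complexify)
qed


section \<open>The algebraic parking space\<close>

lemma poly_funs_monom:
  assumes "e \<in> M" shows "(\<lambda>v. a * (\<Prod>i\<in>UNIV. (v $ i) ^ e i)) \<in> poly_funs M"
  unfolding poly_funs_def using assms by (intro CollectI exI[of _ "{e}"] exI[of _ "\<lambda>_. a"]) auto

lemma poly_funs_add:
  assumes "f \<in> poly_funs M" "g \<in> poly_funs M"
  shows "(\<lambda>v. f v + g v) \<in> poly_funs M"
proof -
  obtain E a where f: "f = (\<lambda>v. \<Sum>e\<in>E. a e * (\<Prod>i\<in>UNIV. (v $ i) ^ e i))" "finite E" "E \<subseteq> M"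
    using assms(1) unfolding poly_funs_def by blast
  obtain F b where g: "g = (\<lambda>v. \<Sum>e\<in>F. b e * (\<Prod>i\<in>UNIV. (v $ i) ^ e i))" "finite F" "F \<subseteq> M"
    using assms(2) unfolding poly_funs_def by blast
  \<comment> \<open>Extending both coefficient families by zero allows a common index set; the
    original values off E and F are arbitrary.\<close>
  define a' where "a' = (\<lambda>e. if e \<in> E then a e else 0)"
  define b' where "b' = (\<lambda>e. if e \<in> F then b e else 0)"
  have "f v = (\<Sum>e\<in>E \<union> F. a' e * (\<Prod>i\<in>UNIV. (v $ i) ^ e i))" for v
    unfolding f(1) using f(2) g(2) by (intro sum.mono_neutral_cong_left) (auto simp: a'_def)
  moreover have "g v = (\<Sum>e\<in>E \<union> F. b' e * (\<Prod>i\<in>UNIV. (v $ i) ^ e i))" for v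
    unfolding g(1) using f(2) g(2) by (intro sum.mono_neutral_cong_left) (auto simp: b'_def)
  ultimately have "(\<lambda>v. f v + g v) = (\<lambda>v. \<Sum>e\<in>E \<union> F. (a' e + b' e) * (\<Prod>i\<in>UNIV. (v $ i) ^ e i))"
    by (simp add: sum.distrib distrib_right)
  then show ?thesis
    unfolding poly_funs_def using f(2,3) g(2,3) by (intro CollectI exI[of _ "E \<union> F"] exI) auto
qed

lemma poly_funs_scale:
  assumes "f \<in> poly_funs M" shows "(\<lambda>v. c * f v) \<in> poly_funs M"
proof -
  obtain E a where f: "f = (\<lambda>v. \<Sum>e\<in>E. a e * (\<Prod>i\<in>UNIV. (v $ i) ^ e i))" "finite E" "E \<subseteq> M"
    using assms unfolding poly_funs_def by blast
  then have "(\<lambda>v. c * f v) = (\<lambda>v. \<Sum>e\<in>E. (c * a e) * (\<Prod>i\<in>UNIV. (v $ i) ^ e i))"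
    by (simp add: sum_distrib_left mult.assoc)
  then show ?thesis
    unfolding poly_funs_def using f(2,3) by (intro CollectI exI[of _ E] exI[of _ "\<lambda>e. c * a e"]) auto
qed

lemma poly_funs_0: "(\<lambda>v. 0) \<in> poly_funs M"
  unfolding poly_funs_def by (intro CollectI exI[of _ "{}"]) auto

lemma poly_funs_sum:
  assumes "\<And>x. x \<in> A \<Longrightarrow> f x \<in> poly_funs M"
  shows "(\<lambda>v. \<Sum>x\<in>A. f x v) \<in> poly_funs M"
  using assms by (induction A rule: infinite_finite_induct) (auto intro: poly_funs_add poly_funs_0)

lemma poly_funs_mono: "M \<subseteq> M' \<Longrightarrow> poly_funs M \<subseteq> poly_funs M'"
  unfolding poly_funs_def by blast

lemma poly_funs_const: "(\<lambda>v. c) \<in> poly_funs UNIV"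
  using poly_funs_monom[of "\<lambda>_. 0" UNIV c] by simp

text \<open>Different pairs of exponents may have the same sum, so the product is recognized through
  closure under sums instead of collecting its coefficients.\<close>

lemma poly_funs_mult:
  assumes "f \<in> poly_funs UNIV" "g \<in> poly_funs UNIV"
  shows "(\<lambda>v. f v * g v) \<in> poly_funs UNIV"
proof -
  obtain E a where f: "f = (\<lambda>v. \<Sum>e\<in>E. a e * (\<Prod>i\<in>UNIV. (v $ i) ^ e i))"
    using assms(1) unfolding poly_funs_def by blast
  obtain F b where g: "g = (\<lambda>v. \<Sum>e\<in>F. b e * (\<Prod>i\<in>UNIV. (v $ i) ^ e i))"
    using assms(2) unfolding poly_funs_def by blast
  have "(\<lambda>v. f v * g v) = (\<lambda>v. \<Sum>e\<in>E. \<Sum>e'\<in>F. (a e * b e') * (\<Prod>i\<in>UNIV. (v $ i) ^ (e i + e' i)))"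
    by (simp add: f g sum_product power_add prod.distrib mult_ac)
  then show ?thesis
    by (simp only: poly_funs_sum poly_funs_monom UNIV_I)
qed

lemma poly_funs_power: "f \<in> poly_funs UNIV \<Longrightarrow> (\<lambda>v. f v ^ n) \<in> poly_funs UNIV"
  by (induction n) (auto intro: poly_funs_mult poly_funs_const)

lemma poly_funs_prod:
  assumes "\<And>x. x \<in> A \<Longrightarrow> f x \<in> poly_funs UNIV"
  shows "(\<lambda>v. \<Prod>x\<in>A. f x v) \<in> poly_funs UNIV"
  using assms by (induction A rule: infinite_finite_induct) (auto intro: poly_funs_mult poly_funs_const)

lemma coordinate_homogeneous: "(\<lambda>v :: complex^'n. v $ i) \<in> homogeneous 1"
proof -
  have "(\<Prod>j\<in>UNIV. (v $ j) ^ (if j = i then 1 else 0)) = v $ i" for v :: "complex^'n"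
    by (simp add: if_distrib cong: if_cong)
  moreover have "(\<lambda>j. if j = i then 1 else 0) \<in> {e :: 'n \<Rightarrow> nat. sum e UNIV = 1}" by simp
  ultimately show ?thesis
    unfolding homogeneous_def using poly_funs_monom[of "\<lambda>j. if j = i then 1 else 0" "{e. sum e UNIV = 1}" 1] by simp
qed

lemma homogeneous_poly_funs: "homogeneous d \<subseteq> poly_funs UNIV"
  unfolding homogeneous_def by (rule poly_funs_mono) simp

lemma linear_form_homogeneous: "(\<lambda>v. ((A :: complex^'n^'n) *v v) $ i) \<in> homogeneous 1"
  unfolding matrix_vector_mult_def homogeneous_def
  by (simp, intro poly_funs_sum poly_funs_scale) (use coordinate_homogeneous in \<open>simp add: homogeneous_def\<close>)

lemma poly_funs_subst:
  fixes A :: "complex^'n^'n"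
  assumes "f \<in> poly_funs UNIV" shows "(\<lambda>v. f (A *v v)) \<in> poly_funs UNIV"
proof -
  obtain E a where f: "f = (\<lambda>v. \<Sum>e\<in>E. a e * (\<Prod>i\<in>UNIV. (v $ i) ^ e i))"
    using assms unfolding poly_funs_def by blast
  have "(\<lambda>v. (A *v v) $ i) \<in> poly_funs UNIV" for i
    using linear_form_homogeneous[of A i] homogeneous_poly_funs by blast
  then show ?thesis
    unfolding f by (intro poly_funs_sum poly_funs_scale poly_funs_prod poly_funs_power)
qed

text \<open>An exponent vector of total degree 1 has a single entry 1, so each monomial is a
  coordinate, and substituting a matrix turns it into a linear form.\<close>

lemma homogeneous_1_subst:
  fixes A :: "complex^'n^'n"
  assumes "f \<in> homogeneous 1" shows "(\<lambda>v. f (A *v v)) \<in> homogeneous 1"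
proof -
  obtain E a where f: "f = (\<lambda>v. \<Sum>e\<in>E. a e * (\<Prod>i\<in>UNIV. (v $ i) ^ e i))" "E \<subseteq> {e. sum e UNIV = 1}"
    using assms unfolding homogeneous_def poly_funs_def by blast
  have "(\<lambda>v. \<Prod>i\<in>UNIV. ((A *v v) $ i) ^ e i) \<in> homogeneous 1" if e: "e \<in> E" for e
  proof -
    have "sum e UNIV = 1" using e f(2) by blast
    then have "\<exists>i. e i = 1 \<and> (\<forall>j. j \<noteq> i \<longrightarrow> e j = 0)"
      by (subst (asm) sum_eq_1_iff) auto
    then obtain i where i: "e i = 1" "\<And>j. j \<noteq> i \<Longrightarrow> e j = 0" by blast
    have "(\<Prod>j\<in>UNIV. (v $ j) ^ e j) = v $ i" for v :: "complex^'n"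
      by (subst prod.remove[of _ i]) (auto simp: i intro!: prod.neutral)
    then show ?thesis by (simp only: linear_form_homogeneous)
  qed
  then show ?thesis
    unfolding f homogeneous_def by (intro poly_funs_sum poly_funs_scale)
qed

section \<open>Polynomial functions as a ring and as a complex module\<close>

lemma poly_algebra_simps [simp]:
  "carrier poly_algebra = poly_funs UNIV" "x \<otimes>\<^bsub>poly_algebra\<^esub> y = (\<lambda>v. x v * y v)"
  "x \<oplus>\<^bsub>poly_algebra\<^esub> y = (\<lambda>v. x v + y v)" "\<one>\<^bsub>poly_algebra\<^esub> = (\<lambda>_. 1)" "\<zero>\<^bsub>poly_algebra\<^esub> = (\<lambda>_. 0)"
  "a \<odot>\<^bsub>poly_algebra\<^esub> x = (\<lambda>v. a * x v)"
  by (simp_all add: poly_algebra_def)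

lemma abelian_group_poly_algebra: "abelian_group poly_algebra"
proof (rule abelian_groupI)
  fix f :: "complex^'n \<Rightarrow> complex" assume "f \<in> carrier poly_algebra"
  then show "\<exists>g\<in>carrier poly_algebra. g \<oplus>\<^bsub>poly_algebra\<^esub> f = \<zero>\<^bsub>poly_algebra\<^esub>"
    using poly_funs_scale[of f UNIV "-1"] by (intro bexI[of _ "\<lambda>v. - 1 * f v"]) auto
qed (auto simp: poly_funs_add poly_funs_0 add_ac)

lemma ring_poly_algebra: "ring poly_algebra"
  by (rule ringI[OF abelian_group_poly_algebra])
     (auto simp: poly_funs_const poly_funs_mult distrib_left distrib_right mult_ac intro!: monoidI)

lemma module_poly_algebra: "module complex_ring poly_algebra"
  by (rule moduleI[OF cring_complex_ring abelian_group_poly_algebra])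
     (auto simp: poly_funs_scale distrib_left distrib_right mult_ac)

text \<open>Scalars act as multiplication by constant polynomials, so ideals absorb them.\<close>

lemma ideal_submodule:
  assumes "ideal I poly_algebra" shows "submodule I complex_ring poly_algebra"
proof -
  interpret ideal I poly_algebra by fact
  have "a \<odot>\<^bsub>poly_algebra\<^esub> x \<in> I" if "x \<in> I" for a x
    using I_l_closed[OF that, of "\<lambda>_. a"] by (simp add: poly_funs_const)
  then show ?thesis
    by (intro submodule.intro a_subgroup) (simp add: submodule_axioms_def)
qed

section \<open>The group action on polynomials and on the parking ideal\<close>

lemma poly_act_apply:
  "orthogonal_matrix w \<Longrightarrow> poly_act w f = (\<lambda>v. f (complexify (transpose w) *v v))"
  by (simp add: poly_act_def inv_orth_group)

lemma poly_act_poly_funs: "f \<in> poly_funs UNIV \<Longrightarrow> poly_act w f \<in> poly_funs UNIV"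
  unfolding poly_act_def by (rule poly_funs_subst)

lemma module_map_poly_act: "module_map poly_algebra poly_algebra (poly_act w)"
  by (auto simp: module_map_def poly_act_poly_funs) (auto simp: poly_act_def)

lemma poly_act_transpose:
  assumes "orthogonal_matrix w" shows "poly_act w (poly_act (transpose w) f) = f"
proof -
  have "complexify w *v (complexify (transpose w) *v v) = complexify (w ** transpose w) *v v" for v
    by (simp only: complexify_simps(1) matrix_vector_mul_assoc)
  then have "complexify w *v (complexify (transpose w) *v v) = v" for v
    using assms by (simp add: orthogonal_matrix_def complexify_simps(2) del: transpose_matrix_vector)
  then show ?thesis
    using assms by (simp add: poly_act_apply orthogonal_matrix_transpose fun_eq_iff)
qed

text \<open>The action respects products, so the preimage of the ideal is again an ideal; once it
  contains the generators, it contains the ideal they generate.\<close>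

lemma poly_act_ideal:
  fixes S :: "(complex^'n \<Rightarrow> complex) set"
  assumes S: "S \<subseteq> poly_funs UNIV" and gen: "\<And>s. s \<in> S \<Longrightarrow> poly_act w s \<in> Idl\<^bsub>poly_algebra\<^esub> S"
  shows "poly_act w ` (Idl\<^bsub>poly_algebra\<^esub> S) \<subseteq> Idl\<^bsub>poly_algebra\<^esub> S"
proof -
  let ?I = "Idl\<^bsub>poly_algebra\<^esub> S" and ?P = "{x \<in> carrier poly_algebra. poly_act w x \<in> Idl\<^bsub>poly_algebra\<^esub> S}"
  interpret PR: ring poly_algebra by (rule ring_poly_algebra)
  interpret V: complex_module poly_algebra by (simp add: complex_module_def module_poly_algebra)
  interpret I: ideal ?I poly_algebra by (rule PR.genideal_ideal) (use S in simp)
  have "submodule ?P complex_ring poly_algebra"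
    by (rule V.preimage_submodule[OF module_map_poly_act ideal_submodule]) (rule I.is_ideal)
  then have "subgroup ?P (add_monoid poly_algebra)" by (rule submodule.axioms(1))
  then have "ideal ?P poly_algebra"
  proof (rule idealI[OF ring_poly_algebra])
    fix a x :: "complex^'n \<Rightarrow> complex" assume a: "a \<in> ?P" and x: "x \<in> carrier poly_algebra"
    have "poly_act w x \<otimes>\<^bsub>poly_algebra\<^esub> poly_act w a \<in> ?I"
      by (rule I.I_l_closed) (use a x poly_act_poly_funs in auto)
    moreover have "poly_act w a \<otimes>\<^bsub>poly_algebra\<^esub> poly_act w x \<in> ?I"
      by (rule I.I_r_closed) (use a x poly_act_poly_funs in auto)
    ultimately show "x \<otimes>\<^bsub>poly_algebra\<^esub> a \<in> ?P" "a \<otimes>\<^bsub>poly_algebra\<^esub> x \<in> ?P"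
      using a x by (simp_all add: poly_funs_mult) (simp_all add: poly_act_def)
  qed
  moreover have "S \<subseteq> ?P" using S gen by auto
  ultimately have "?I \<subseteq> ?P" by (rule PR.genideal_minimal)
  then show ?thesis by blast
qed

text \<open>Equivariance makes w act on the \<theta>'s and on the x's with the same coefficients.
  Hence w sends each difference \<open>\<theta> i - x i\<close> to a linear combination of such
  differences, although the two terms have different degrees.\<close>

lemma parking_generators_invariant:
  assumes W: "subgroup W orth_group" and w: "w \<in> W" and x: "dual_basis x" and equi: "equivariant_params W x \<theta>"
    and S: "range (\<lambda>i v. \<theta> i v - x i v) \<subseteq> poly_funs UNIV"
  shows "poly_act w (\<lambda>v. \<theta> i v - x i v) \<in> Idl\<^bsub>poly_algebra\<^esub> (range (\<lambda>i v. \<theta> i v - x i v))"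
proof -
  let ?S = "range (\<lambda>i v. \<theta> i v - x i v)" let ?I = "Idl\<^bsub>poly_algebra\<^esub> ?S"
  interpret PR: ring poly_algebra by (rule ring_poly_algebra)
  interpret V: complex_module poly_algebra by (simp add: complex_module_def module_poly_algebra)
  interpret I: ideal ?I poly_algebra by (rule PR.genideal_ideal) (use S in simp)
  obtain \<phi> where \<phi>: "\<And>a. \<phi> (\<lambda>v. \<Sum>i\<in>UNIV. a i * x i v) = (\<lambda>v. \<Sum>i\<in>UNIV. a i * \<theta> i v)"
    "\<And>f. f \<in> homogeneous 1 \<Longrightarrow> \<phi> (poly_act w f) = poly_act w (\<phi> f)"
    using equi w unfolding equivariant_params_def by blast
  have x1: "x i \<in> homogeneous 1" using x by (simp add: dual_basis_def)
  then have "poly_act w (x i) \<in> homogeneous 1"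
    unfolding poly_act_def by (rule homogeneous_1_subst)
  then obtain a where a: "poly_act w (x i) = (\<lambda>v. \<Sum>j\<in>UNIV. a j * x j v)"
    using x unfolding dual_basis_def by blast
  \<comment> \<open>The i-th unit coefficient vector in the formula for \<phi>.\<close>
  have "\<phi> (x i) = \<theta> i"
    using \<phi>(1)[of "\<lambda>j. if j = i then 1 else 0"] by (simp add: if_distrib[of "\<lambda>c. c * _"] cong: if_cong)
  then have "poly_act w (\<theta> i) = (\<lambda>v. \<Sum>j\<in>UNIV. a j * \<theta> j v)"
    using \<phi>(2)[OF x1] by (simp only: a \<phi>(1))
  then have "poly_act w (\<lambda>v. \<theta> i v - x i v) = (\<lambda>v. \<Sum>j\<in>UNIV. a j * (\<theta> j v - x j v))"
    using a by (simp add: poly_act_def fun_eq_iff right_diff_distrib sum_subtractf)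
  moreover have "(\<lambda>v. \<Sum>j\<in>J. a j * (\<theta> j v - x j v)) \<in> ?I" for J
  proof (induction J rule: infinite_finite_induct)
    case (insert j J)
    have "(\<lambda>v. \<theta> j v - x j v) \<in> ?I" using PR.genideal_self[of ?S] S by auto
    then have "a j \<odot>\<^bsub>poly_algebra\<^esub> (\<lambda>v. \<theta> j v - x j v) \<in> ?I"
      using submodule.smult_closed[OF ideal_submodule[OF I.is_ideal]] by simp
    from I.a_closed[OF this insert.IH] show ?case using insert.hyps by simp
  qed (use I.zero_closed in simp_all)
  ultimately show ?thesis by simp
qed

text \<open>The ideal is mapped onto itself because both w and its inverse preserve it, so w acts on
  cosets. The trace is then transported from the permutation module.\<close>

lemma character_park_alg:
  assumes W: "subgroup W orth_group" and w: "w \<in> W" and params: "parking_params W c x \<theta>"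
    and iso: "rep_iso W (park_alg x \<theta>) (free_module X, \<lambda>w. free_map (g w))"
    and X: "finite X" and g: "g w \<in> X \<rightarrow> X"
  shows "character (park_alg x \<theta>) w = character (free_module X, \<lambda>w. free_map (g w)) w"
proof -
  let ?S = "range (\<lambda>i v. \<theta> i v - x i v)" let ?I = "Idl\<^bsub>poly_algebra\<^esub> ?S"
  let ?Q = "quot_module poly_algebra ?I" and ?F = "free_module X"
  have x: "dual_basis x" and \<theta>: "\<And>i. \<theta> i \<in> poly_funs UNIV" and equi: "equivariant_params W x \<theta>"
    using params homogeneous_poly_funs by (auto simp: parking_params_def hsop_def)
  have "x i \<in> poly_funs UNIV" for i using x homogeneous_poly_funs by (auto simp: dual_basis_def)
  then have S: "?S \<subseteq> poly_funs UNIV"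
    using \<theta> poly_funs_add[of "\<theta> i" UNIV "\<lambda>v. - 1 * x i v" for i] poly_funs_scale[of "x i" UNIV "-1" for i]
    by auto
  interpret PR: ring poly_algebra by (rule ring_poly_algebra)
  have I: "ideal ?I poly_algebra" by (rule PR.genideal_ideal) (use S in simp)
  interpret Q: complex_submodule poly_algebra ?I
    by (simp add: complex_submodule_def complex_module_def complex_submodule_axioms_def module_poly_algebra ideal_submodule[OF I])
  interpret F: complex_module ?F by (rule complex_module_free_module)
  have inv: "poly_act u ` ?I \<subseteq> ?I" if "u \<in> W" for u
    using parking_generators_invariant[OF W that x equi S] by (intro poly_act_ideal[OF S]) auto
  have "?I \<subseteq> poly_act w ` ?I"
  proof
    fix f assume f: "f \<in> ?I"
    show "f \<in> poly_act w ` ?I"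
    proof (rule image_eqI)
      show "f = poly_act w (poly_act (transpose w) f)"
        using poly_act_transpose[OF orth_subgroup_orthogonal[OF W w]] by simp
      show "poly_act (transpose w) f \<in> ?I"
        using inv[OF orth_subgroup_transpose[OF W w]] f by blast
    qed
  qed
  then have sur: "poly_act w ` ?I = ?I" using inv[OF w] by blast
  have gmap: "module_map ?Q ?Q (\<lambda>C. poly_act w ` C)"
    by (rule Q.module_map_image[OF module_map_poly_act sur])
  interpret Q': complex_module ?Q using Q.module_quot_module by (simp add: complex_module_def)
  obtain \<phi> where bij: "bij_betw \<phi> (carrier ?Q) (carrier ?F)"
    and add: "\<And>y z. y \<in> carrier ?Q \<Longrightarrow> z \<in> carrier ?Q \<Longrightarrow> \<phi> (y \<oplus>\<^bsub>?Q\<^esub> z) = \<phi> y \<oplus>\<^bsub>?F\<^esub> \<phi> z"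
    and smult: "\<And>a y. y \<in> carrier ?Q \<Longrightarrow> \<phi> (a \<odot>\<^bsub>?Q\<^esub> y) = a \<odot>\<^bsub>?F\<^esub> \<phi> y"
    and equiv: "\<And>y. y \<in> carrier ?Q \<Longrightarrow> \<phi> (poly_act w ` y) = free_map (g w) (\<phi> y)"
    using iso w unfolding rep_iso_def park_alg_def fst_conv snd_conv by blast
  \<comment> \<open>Transport starts at the module with a known basis, so the given isomorphism is
    inverted.\<close>
  define \<psi> where "\<psi> = inv_into (carrier ?Q) \<phi>"
  have bij': "bij_betw \<psi> (carrier ?F) (carrier ?Q)"
    unfolding \<psi>_def by (rule bij_betw_inv_into[OF bij])
  have \<psi>\<phi>: "\<psi> (\<phi> y) = y" if "y \<in> carrier ?Q" for y
    using bij_betw_inv_into_left[OF bij that] by (simp add: \<psi>_def)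
  have \<phi>\<psi>: "\<phi> (\<psi> y) = y" if "y \<in> carrier ?F" for y
    using bij_betw_inv_into_right[OF bij that] by (simp add: \<psi>_def)
  have \<psi>c: "\<psi> y \<in> carrier ?Q" if "y \<in> carrier ?F" for y
    using bij' that by (auto simp: bij_betw_def)
  have \<psi>map: "module_map ?F ?Q \<psi>"
    unfolding module_map_def
  proof (intro conjI ballI allI)
    fix y z assume yz: "y \<in> carrier ?F" "z \<in> carrier ?F"
    have "\<psi> (\<phi> (\<psi> y \<oplus>\<^bsub>?Q\<^esub> \<psi> z)) = \<psi> y \<oplus>\<^bsub>?Q\<^esub> \<psi> z"
      using yz \<psi>c by (intro \<psi>\<phi> Q'.a_closed)
    then show "\<psi> (y \<oplus>\<^bsub>?F\<^esub> z) = \<psi> y \<oplus>\<^bsub>?Q\<^esub> \<psi> z"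
      using yz \<psi>c add \<phi>\<psi> by (simp del: free_module_simps)
  next
    fix a y assume y: "y \<in> carrier ?F"
    have "\<psi> (\<phi> (a \<odot>\<^bsub>?Q\<^esub> \<psi> y)) = a \<odot>\<^bsub>?Q\<^esub> \<psi> y"
      using y \<psi>c Q'.smult_closed by (intro \<psi>\<phi>) simp
    then show "\<psi> (a \<odot>\<^bsub>?F\<^esub> y) = a \<odot>\<^bsub>?Q\<^esub> \<psi> y"
      using y \<psi>c smult \<phi>\<psi> by (simp del: free_module_simps)
  qed (use \<psi>c in auto)
  have "lin_trace ?Q (\<lambda>C. poly_act w ` C) = lin_trace ?F (free_map (g w))"
  proof (rule F.lin_trace_transport[OF Q.module_quot_module bij' \<psi>map free_module_basis(1)[OF X]
      module_map_free_map[OF g] gmap])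
    fix y assume y: "y \<in> carrier ?F"
    have mem: "poly_act w ` \<psi> y \<in> carrier ?Q"
      using gmap \<psi>c[OF y] by (auto simp: module_map_def)
    have "free_map (g w) y = \<phi> (poly_act w ` \<psi> y)"
      unfolding equiv[OF \<psi>c[OF y]] \<phi>\<psi>[OF y] ..
    then show "\<psi> (free_map (g w) y) = poly_act w ` \<psi> y"
      by (simp only: \<psi>\<phi>[OF mem])
  qed
  then show ?thesis by (simp add: character_def park_alg_def)
qed


section \<open>Counting fixed parking functions\<close>

context
  fixes W :: "(real^'n^'n) set" and c :: "real^'n^'n"
  assumes irred: "irreducible_reflection_group W" and cox: "coxeter_element W c"
begin

section \<open>Parking functions as cosets of stabilizers\<close>

lemmas subgroup_W = irred_subgroup[OF irred] and finite_W = irred_finite[OF irred]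
lemmas W_mult = orth_subgroup_mult[OF subgroup_W] and W_transpose = orth_subgroup_transpose[OF subgroup_W] and W_cancel = orth_subgroup_cancel[OF subgroup_W]

lemma finite_nc_flats: "finite (nc_flats W c)"
  using finite_W by (simp add: nc_flats_def)

lemma stabilizer_sub: "pointwise_stabilizer W X \<subseteq> W"
  by (auto simp: pointwise_stabilizer_def)

lemma stabilizerD: "g \<in> pointwise_stabilizer W X \<Longrightarrow> g \<in> W"
  by (simp add: pointwise_stabilizer_def)

lemma finite_stabilizer: "finite (pointwise_stabilizer W X)"
  using finite_W stabilizer_sub finite_subset by blast

lemma one_stabilizer: "mat 1 \<in> pointwise_stabilizer W X"
  using orth_subgroup_one[OF subgroup_W] by (simp add: pointwise_stabilizer_def)

lemma stabilizer_mult: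
  "u \<in> pointwise_stabilizer W X \<Longrightarrow> v \<in> pointwise_stabilizer W X \<Longrightarrow> u ** v \<in> pointwise_stabilizer W X"
  using W_mult by (auto simp: pointwise_stabilizer_def matrix_vector_mul_assoc[symmetric])

lemma stabilizer_transpose:
  assumes "u \<in> pointwise_stabilizer W X" shows "transpose u \<in> pointwise_stabilizer W X"
proof -
  have u: "u \<in> W" "\<And>v. v \<in> X \<Longrightarrow> u *v v = v" using assms by (auto simp: pointwise_stabilizer_def)
  have "transpose u *v v = v" if "v \<in> X" for v
    using W_cancel(7)[OF u(1), of v] u(2)[OF that] by (simp only:)
  then show ?thesis using W_transpose[OF u(1)] by (simp add: pointwise_stabilizer_def del: transpose_matrix_vector)
qed

lemma coset_eq_iff_stabilizer:
  assumes u: "u \<in> W" and v: "v \<in> W"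
  shows "u <#\<^bsub>orth_group\<^esub> pointwise_stabilizer W X = v <#\<^bsub>orth_group\<^esub> pointwise_stabilizer W X
    \<longleftrightarrow> transpose u ** v \<in> pointwise_stabilizer W X" (is "?C u = ?C v \<longleftrightarrow> _")
proof
  have C: "?C w = (\<lambda>g. w ** g) ` pointwise_stabilizer W X" for w by (auto simp: l_coset_def)
  assume "?C u = ?C v"
  then have "v \<in> ?C u" using one_stabilizer C by force
  then show "transpose u ** v \<in> pointwise_stabilizer W X"
    using W_cancel(3)[OF u] by (auto simp: C)
next
  have C: "?C w = (\<lambda>g. w ** g) ` pointwise_stabilizer W X" for w by (auto simp: l_coset_def)
  assume s: "transpose u ** v \<in> pointwise_stabilizer W X"
  have sub: "?C q \<subseteq> ?C p" if p: "p \<in> W" and pq: "transpose p ** q \<in> pointwise_stabilizer W X" for p q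
  proof -
    have "q ** g = p ** ((transpose p ** q) ** g)" for g :: "real^'n^'n"
      using W_cancel(4)[OF p, of "q ** g"] by (simp add: matrix_mul_assoc)
    then show ?thesis using stabilizer_mult[OF pq] by (auto simp: C)
  qed
  have "transpose v ** u \<in> pointwise_stabilizer W X"
    using stabilizer_transpose[OF s] by (simp add: matrix_transpose_mul)
  then show "?C u = ?C v" using sub[OF u s] sub[OF v] by blast
qed

lemma park_rel_iff:
  "((u, X), (v, Y)) \<in> park_rel W c \<longleftrightarrow>
    u \<in> W \<and> v \<in> W \<and> X \<in> nc_flats W c \<and> X = Y \<and> transpose u ** v \<in> pointwise_stabilizer W X"
  using coset_eq_iff_stabilizer by (auto simp: park_rel_def)

lemma equiv_park_rel: "equiv (W \<times> nc_flats W c) (park_rel W c)"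
proof (rule equivI)
  show "park_rel W c \<subseteq> (W \<times> nc_flats W c) \<times> (W \<times> nc_flats W c)" by (auto simp: park_rel_def)
  show "refl_on (W \<times> nc_flats W c) (park_rel W c)" by (auto simp: park_rel_def refl_on_def)
  show "sym (park_rel W c)" by (auto simp: park_rel_def sym_def)
  show "trans (park_rel W c)" by (auto simp: park_rel_def trans_def)
qed

definition park_move :: "real^'n^'n \<Rightarrow> (real^'n^'n) \<times> (real^'n) set \<Rightarrow> (real^'n^'n) \<times> (real^'n) set" where
  "park_move w p = (w ** fst p, snd p)"

lemma park_class:
  assumes u: "u \<in> W" and X: "X \<in> nc_flats W c"
  shows "park_rel W c `` {(u, X)} = (\<lambda>g. (u ** g, X)) ` pointwise_stabilizer W X"
proof (intro subset_antisym subsetI)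
  fix p assume "p \<in> park_rel W c `` {(u, X)}"
  then obtain v where v: "p = (v, X)" "v \<in> W" "transpose u ** v \<in> pointwise_stabilizer W X"
    by (cases p) (auto simp: park_rel_iff)
  then show "p \<in> (\<lambda>g. (u ** g, X)) ` pointwise_stabilizer W X"
    using W_cancel(4)[OF u, of v] by (intro image_eqI[of _ _ "transpose u ** v"]) simp_all
next
  fix p assume "p \<in> (\<lambda>g. (u ** g, X)) ` pointwise_stabilizer W X"
  then obtain g where g: "p = (u ** g, X)" "g \<in> pointwise_stabilizer W X" by blast
  then show "p \<in> park_rel W c `` {(u, X)}"
    using u X W_mult[OF u stabilizerD[OF g(2)]] W_cancel(3)[OF u] by (simp add: park_rel_iff)
qed

lemma park_move_class:
  assumes w: "w \<in> W" and u: "u \<in> W" and X: "X \<in> nc_flats W c"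
  shows "park_move w ` (park_rel W c `` {(u, X)}) = park_rel W c `` {(w ** u, X)}"
  using u W_mult[OF w u] X by (simp add: park_class image_image park_move_def matrix_mul_assoc)

lemma card_class:
  assumes u: "u \<in> W" and X: "X \<in> nc_flats W c"
  shows "card (park_rel W c `` {(u, X)}) = card (pointwise_stabilizer W X)"
proof -
  have "inj_on (\<lambda>g. (u ** g, X)) (pointwise_stabilizer W X)"
    using W_cancel(3)[OF u] by (metis (no_types, lifting) inj_onI prod.inject)
  then show ?thesis by (simp add: park_class[OF u X] card_image)
qed

lemma park_move_funcset: "w \<in> W \<Longrightarrow> (\<lambda>C. park_move w ` C) \<in> nc_parking_functions W c \<rightarrow> nc_parking_functions W c"
  using park_move_class W_mult by (auto simp: nc_parking_functions_def quotient_def) blast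

lemma finite_parking: "finite (nc_parking_functions W c)"
  unfolding nc_parking_functions_def
  using finite_W finite_nc_flats equiv_type[OF equiv_park_rel] by (intro finite_quotient) auto

lemma park_nc_eq: "park_nc W c = (free_module (nc_parking_functions W c), \<lambda>w. free_map (\<lambda>C. park_move w ` C))"
  by (simp add: park_nc_def park_move_def case_prod_beta')

text \<open>The formula for induced characters: w fixes the class of (u, X) exactly when the
  conjugate of w by u lies in the stabilizer of X, and each such class is counted once for each
  element of that stabilizer.\<close>

lemma card_fixed_parking:
  assumes w: "w \<in> W"
  shows "real (card {C \<in> nc_parking_functions W c. park_move w ` C = C}) =
    (\<Sum>X\<in>nc_flats W c. (\<Sum>u\<in>W. if transpose u ** w ** u \<in> pointwise_stabilizer W X then 1 else 0)
       / card (pointwise_stabilizer W X))"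
proof -
  let ?P = "nc_parking_functions W c" and ?A = "W \<times> nc_flats W c" and ?R = "park_rel W c"
  \<comment> \<open>Every pair carries weight one over the size of its class, so a fixed class has
    total weight 1 and any other class 0.\<close>
  define h where "h = (\<lambda>p. (if transpose (fst p) ** w ** fst p \<in> pointwise_stabilizer W (snd p) then 1 else 0)
      / real (card (pointwise_stabilizer W (snd p))))"
  have finA: "finite ?A" using finite_W finite_nc_flats by simp
  have quot: "?P = ?A // ?R" by (simp add: nc_parking_functions_def)
  have fixes_iff: "park_move w ` (?R `` {(u, X)}) = ?R `` {(u, X)} \<longleftrightarrow> transpose u ** w ** u \<in> pointwise_stabilizer W X"
    if u: "u \<in> W" and X: "X \<in> nc_flats W c" for u X
  proof -
    have "park_move w ` (?R `` {(u, X)}) = ?R `` {(u, X)} \<longleftrightarrow> ((u, X), (w ** u, X)) \<in> ?R"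
      unfolding park_move_class[OF w u X]
      using eq_equiv_class_iff[OF equiv_park_rel, of "(u, X)" "(w ** u, X)"] u X W_mult[OF w u] by auto
    then show ?thesis using u X W_mult[OF w u] by (simp add: park_rel_iff matrix_mul_assoc)
  qed
  have class_sum: "(\<Sum>p\<in>C. h p) = (if park_move w ` C = C then 1 else 0)" if C: "C \<in> ?P" for C
  proof -
    obtain u X where u: "u \<in> W" and X: "X \<in> nc_flats W c" and CuX: "C = ?R `` {(u, X)}"
      using C by (auto simp: quot quotient_def)
    have "h p = (if park_move w ` C = C then 1 else 0) / real (card (pointwise_stabilizer W X))" if p: "p \<in> C" for p
    proof -
      obtain v where v: "p = (v, X)" "v \<in> W" "((u, X), (v, X)) \<in> ?R"
        using p by (cases p) (auto simp: CuX park_rel_iff)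
      have "C = ?R `` {(v, X)}" unfolding CuX using equiv_class_eq[OF equiv_park_rel v(3)] .
      then show ?thesis using fixes_iff[OF v(2) X] by (simp add: h_def v(1))
    qed
    then have "(\<Sum>p\<in>C. h p) = real (card C) * ((if park_move w ` C = C then 1 else 0) / real (card (pointwise_stabilizer W X)))"
      by simp
    moreover have "card (pointwise_stabilizer W X) \<noteq> 0"
      using one_stabilizer finite_stabilizer by (metis card_0_eq empty_iff)
    ultimately show ?thesis using card_class[OF u X] by (simp add: CuX)
  qed
  have "real (card {C \<in> ?P. park_move w ` C = C}) = (\<Sum>C\<in>?P. if park_move w ` C = C then 1 else 0)"
    using finite_parking by (simp add: sum.inter_filter[symmetric])
  also have "\<dots> = (\<Sum>C\<in>?P. \<Sum>p\<in>C. h p)" by (simp add: class_sum)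
  also have "\<dots> = (\<Sum>p\<in>\<Union>?P. h p)"
  proof (subst sum.Union_disjoint)
    show "\<forall>C\<in>?P. finite C"
      using finA Union_quotient[OF equiv_park_rel] by (metis quot Union_upper finite_subset)
    show "\<forall>C\<in>?P. \<forall>D\<in>?P. C \<noteq> D \<longrightarrow> C \<inter> D = {}"
      using quotient_disj[OF equiv_park_rel] by (auto simp: quot)
  qed simp
  also have "\<Union>?P = ?A" unfolding quot by (rule Union_quotient[OF equiv_park_rel])
  also have "(\<Sum>p\<in>?A. h p) = (\<Sum>u\<in>W. \<Sum>X\<in>nc_flats W c. h (u, X))"
    by (simp add: sum.cartesian_product)
  also have "\<dots> = (\<Sum>X\<in>nc_flats W c. \<Sum>u\<in>W. h (u, X))" by (rule sum.swap)
  finally show ?thesis by (simp add: h_def sum_divide_distrib)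
qed

section \<open>Averaging determinants over the group\<close>

lemma det_conjugate:
  assumes u: "u \<in> W" shows "det (mat 1 + t *\<^sub>R (transpose u ** w ** u)) = det (mat 1 + t *\<^sub>R w)"
proof -
  have "mat 1 + t *\<^sub>R (transpose u ** w ** u) = transpose u ** (mat 1 + t *\<^sub>R w) ** u"
    by (simp add: matrix_add_ldistrib matrix_add_rdistrib matrix_scalar_ac scalar_matrix_assoc[symmetric] W_cancel(1)[OF u])
  then have "det (mat 1 + t *\<^sub>R (transpose u ** w ** u)) = det (mat 1 + t *\<^sub>R w) * det (transpose u ** u)"
    by (simp add: det_mul)
  then show ?thesis by (simp add: W_cancel(1)[OF u])
qed

text \<open>Frobenius reciprocity carried out by hand. The determinant is a class function, so
  substituting a conjugate for w reduces each inner sum to one over the stabilizer of X.\<close>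

lemma sum_det_fixed_parking:
  "(\<Sum>w\<in>W. det (mat 1 + t *\<^sub>R w) * real (card {C \<in> nc_parking_functions W c. park_move w ` C = C})) =
    real (card W) * (\<Sum>X\<in>nc_flats W c. (1 + t) ^ dim X)"
proof -
  let ?S = "pointwise_stabilizer W" and ?d = "\<lambda>w. det (mat 1 + t *\<^sub>R w)"
  have inner: "(\<Sum>w\<in>W. ?d w * (if transpose u ** w ** u \<in> ?S X then 1 else 0)) = card (?S X) * (1 + t) ^ dim X"
    if u: "u \<in> W" and X: "X \<in> nc_flats W c" for u X
  proof -
    have "(\<Sum>w\<in>W. ?d w * (if transpose u ** w ** u \<in> ?S X then 1 else 0))
        = (\<Sum>w\<in>W. ?d (transpose u ** w ** u) * (if transpose u ** w ** u \<in> ?S X then 1 else 0))"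
      by (simp add: det_conjugate[OF u])
    also have "\<dots> = (\<Sum>w\<in>W. ?d w * (if w \<in> ?S X then 1 else 0))"
    proof (rule sum.reindex_bij_witness[of _ "\<lambda>w. u ** w ** transpose u" "\<lambda>w. transpose u ** w ** u"])
    qed (use W_mult[OF W_mult] u W_transpose W_cancel[OF u] in \<open>auto simp: matrix_mul_assoc[symmetric]\<close>)
    also have "\<dots> = (\<Sum>w\<in>?S X. ?d w)"
      using finite_W stabilizer_sub by (intro sum.mono_neutral_cong_right) auto
    also have "\<dots> = card (?S X) * (1 + t) ^ dim X"
      by (rule sum_det_pointwise_stabilizer[OF irred cox X])
    finally show ?thesis .
  qed
  have "(\<Sum>w\<in>W. ?d w * real (card {C \<in> nc_parking_functions W c. park_move w ` C = C}))
      = (\<Sum>w\<in>W. \<Sum>X\<in>nc_flats W c. \<Sum>u\<in>W. ?d w * (if transpose u ** w ** u \<in> ?S X then 1 else 0) / card (?S X))"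
    by (intro sum.cong refl)
       (simp add: card_fixed_parking sum_distrib_left sum_divide_distrib)
  also have "\<dots> = (\<Sum>X\<in>nc_flats W c. \<Sum>u\<in>W. \<Sum>w\<in>W. ?d w * (if transpose u ** w ** u \<in> ?S X then 1 else 0) / card (?S X))"
    by (subst sum.swap) (intro sum.cong refl sum.swap)
  \<comment> \<open>The order of the stabilizer cancels and the summand no longer depends on u, so
    the sum over u contributes the factor \<open>card W\<close>.\<close>
  also have "\<dots> = (\<Sum>X\<in>nc_flats W c. \<Sum>u\<in>W. (1 + t) ^ dim X)"
  proof (intro sum.cong refl)
    fix X u assume X: "X \<in> nc_flats W c" and u: "u \<in> W"
    have "card (?S X) \<noteq> 0"
      using one_stabilizer finite_stabilizer by (metis card_0_eq empty_iff)
    then show "(\<Sum>w\<in>W. ?d w * (if transpose u ** w ** u \<in> ?S X then 1 else 0) / card (?S X)) = (1 + t) ^ dim X"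
      unfolding sum_divide_distrib[symmetric] inner[OF u X] by simp
  qed
  finally show ?thesis by (simp add: sum_distrib_left)
qed

section \<open>From averages to coefficients of the Kirkman polynomial\<close>

lemma character_park_nc:
  "w \<in> W \<Longrightarrow> character (park_nc W c) w = of_nat (card {C \<in> nc_parking_functions W c. park_move w ` C = C})"
  by (simp add: character_def park_nc_eq lin_trace_permutation[OF finite_parking park_move_funcset])

text \<open>The determinant identities are available for real t only; the real line is an infinite
  set, so it determines a complex polynomial.\<close>

lemma poly_eqI_real:
  fixes p q :: "complex poly"
  assumes "\<And>t :: real. poly p (of_real t) = poly q (of_real t)"
  shows "p = q"
proof -
  have "range complex_of_real \<subseteq> {z. poly (p - q) z = 0}" using assms by auto
  moreover have "infinite (range complex_of_real)"
    by (simp add: finite_image_iff inj_def infinite_UNIV_char_0)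
  ultimately have "infinite {z. poly (p - q) z = 0}" using finite_subset by blast
  then show ?thesis using poly_roots_finite[of "p - q"] by auto
qed

lemma Kirk_eq:
  "Kirk W c = (\<Sum>k = 0..CARD('n). Polynomial.monom
      (class_inner W (character (ext_power k)) (character (park_nc W c))) k)"
proof (rule poly_eqI_real)
  fix t :: real
  define fp where "fp = (\<lambda>w. card {C \<in> nc_parking_functions W c. park_move w ` C = C})"
  define m where "m = (\<lambda>k w :: real^'n^'n. \<Sum>S | card S = k. det (\<chi> i. if i \<in> S then column i w else axis i 1))"
  have cW: "card W \<noteq> 0" using orth_subgroup_one[OF subgroup_W] finite_W by (metis card_0_eq empty_iff)
  \<comment> \<open>The permutation character takes natural numbers as values, so the conjugation in
    \<open>class_inner\<close> has no effect, and the whole expression is real.\<close>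
  have inner: "class_inner W (character (ext_power k)) (character (park_nc W c))
      = of_real ((\<Sum>w\<in>W. m k w * fp w) / card W)" for k
    unfolding class_inner_def
    by (simp add: character_park_nc character_ext_power orth_subgroup_orthogonal[OF subgroup_W] m_def fp_def)
  have "poly (\<Sum>k = 0..CARD('n). Polynomial.monom
      (class_inner W (character (ext_power k)) (character (park_nc W c))) k) (of_real t)
    = of_real (\<Sum>k = 0..CARD('n). (\<Sum>w\<in>W. m k w * fp w) / card W * t ^ k)"
    by (simp only: poly_sum poly_monom inner of_real_sum of_real_mult of_real_power)
  also have "(\<Sum>k = 0..CARD('n). (\<Sum>w\<in>W. m k w * fp w) / card W * t ^ k)
    = (\<Sum>w\<in>W. (\<Sum>k = 0..CARD('n). t ^ k * m k w) * fp w) / card W"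
  proof -
    have "(\<Sum>k = 0..CARD('n). (\<Sum>w\<in>W. m k w * fp w) / card W * t ^ k)
      = (\<Sum>k = 0..CARD('n). \<Sum>w\<in>W. m k w * fp w / card W * t ^ k)"
      by (simp only: sum_divide_distrib sum_distrib_right)
    also have "\<dots> = (\<Sum>w\<in>W. \<Sum>k = 0..CARD('n). m k w * fp w / card W * t ^ k)"
      by (rule sum.swap)
    also have "\<dots> = (\<Sum>w\<in>W. (\<Sum>k = 0..CARD('n). t ^ k * m k w) * fp w) / card W"
      unfolding sum_distrib_right sum_divide_distrib by (intro sum.cong refl) simp
    finally show ?thesis .
  qed
  also have "\<dots> = (\<Sum>w\<in>W. det (mat 1 + t *\<^sub>R w) * fp w) / card W"
    by (simp only: det_mat_1_add_scaleR m_def)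
  also have "\<dots> = (\<Sum>X\<in>nc_flats W c. (1 + t) ^ dim X)"
    using cW by (simp add: sum_det_fixed_parking fp_def)
  also have "of_real \<dots> = poly (Kirk W c) (of_real t)"
    by (simp add: Kirk_def Nar_def poly_pcompose poly_sum poly_monom add.commute)
  finally show "poly (Kirk W c) (of_real t) = poly (\<Sum>k = 0..CARD('n). Polynomial.monom
      (class_inner W (character (ext_power k)) (character (park_nc W c))) k) (of_real t)" by simp
qed

lemma Kirk_eq_alg:
  assumes "parking_params W c x \<theta>" "rep_iso W (park_alg x \<theta>) (park_nc W c)"
  shows "Kirk W c = (\<Sum>k = 0..CARD('n). Polynomial.monom
      (class_inner W (character (ext_power k)) (character (park_alg x \<theta>))) k)"
proof -
  have "character (park_alg x \<theta>) w = character (park_nc W c) w" if w: "w \<in> W" for w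
    unfolding park_nc_eq
    by (rule character_park_alg[where g = "\<lambda>w C. park_move w ` C", OF subgroup_W w assms(1)
        assms(2)[unfolded park_nc_eq] finite_parking park_move_funcset[OF w]])
  then have "class_inner W \<psi> (character (park_alg x \<theta>)) = class_inner W \<psi> (character (park_nc W c))" for \<psi>
    by (simp add: class_inner_def)
  then show ?thesis by (simp add: Kirk_eq)
qed

end

theorem corollary3p3:
  fixes W :: "(real^'n^'n) set" and c :: "real^'n^'n"
  assumes "irreducible_reflection_group W" and "coxeter_element W c"
  shows "Kirk W c =
           (\<Sum>k = 0..CARD('n). Polynomial.monom
              (class_inner W (character (ext_power k)) (character (park_nc W c))) k)
       \<and> (\<forall>x \<theta>. parking_params W c x \<theta> \<and> rep_iso W (park_alg x \<theta>) (park_nc W c) \<longrightarrow>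
           Kirk W c =
             (\<Sum>k = 0..CARD('n). Polynomial.monom
                (class_inner W (character (ext_power k)) (character (park_alg x \<theta>))) k))"
  using Kirk_eq[OF assms] Kirk_eq_alg[OF assms] by blast

end
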